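(* Let $n\ge7$, let $\mathcal{P}_m\subset l_2(\nu)$ be a model, let $f_0\in l_2(\nu)$, and let $D_m\ge1$ be such that $D_m\ge\mathrm{pdim}(F(\underline X^n;\mathcal{P}_m))$ almost surely. Let the errors be i.i.d. sub-Gaussian with parameter $\sigma^2$: $\mathbb{E}\exp(t\epsilon_1)\le\exp(\sigma^2t^2/2)$ for all $t\in\mathbb{R}$. There are numerical constants $\mathfrak{c}^c,\mathfrak{k}^c,\mathfrak{d}^c,\mathfrak{c}^d,\mathfrak{k}^d,\mathfrak{d}^d,\bar{\mathfrak{c}}^c,\bar{\mathfrak{k}}^c,\bar{\mathfrak{c}}^d,\bar{\mathfrak{k}}^d,\mathfrak{v}$, which can be taken as $\mathfrak{c}^c=1152$, $\mathfrak{k}^c=7.56\times10^6$, $\mathfrak{d}^c=3.35\times10^5$, $\mathfrak{c}^d=18$, $\mathfrak{k}^d=819200$, $\mathfrak{d}^d=8$, $\bar{\mathfrak{c}}^c=144$, $\bar{\mathfrak{k}}^c=4.5\times10^7$, $\bar{\mathfrak{c}}^d=18$, $\bar{\mathfrak{k}}^d=5.62\times10^6$, $\mathfrak{v}=73728$, such that the following hold. [Continuous norm.] Suppose in addition that $\mathcal{P}_m$ and $f_0$ are uniformly bounded by $\Gamma$. Then for every $t>0$, $$l_\nu^2(\hat f_m,f_0)\le\mathfrak{c}^c\inf_{g\in\mathcal{P}_m}l_\nu^2(f_0,g)+\mathfrak{k}^c\frac{(\sigma^2\vee\Gamma^2)\kappa D_m\log n}{n}+\mathfrak{d}^c\frac{(\sigma^2\vee\Gamma^2)t}{n}$$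 with probability at least $\big(1-4\sum_{j\ge0}\exp(-2^jt/\mathfrak{v})-6\exp(-t)\big)\vee0$. Furthermore, $$\mathbb{E}\big[l_\nu^2(\hat f_m,f_0)\big]\le\bar{\mathfrak{c}}^c\inf_{g\in\mathcal{P}_m}l_\nu^2(f_0,g)+\bar{\mathfrak{k}}^c\frac{(\sigma^2\vee\Gamma^2)\kappa D_m\log n}{n}.$$ [Discrete norm.] (No uniform boundedness is assumed.) For every $t>0$, $$l_{\underline X^n}^2(\hat f_m,f_0)\le\mathfrak{c}^d\inf_{g\in\mathcal{P}_m}l_{\underline X^n}^2(f_0,g)+\mathfrak{k}^d\frac{\sigma^2\kappa D_m\log n}{n}+\mathfrak{d}^d\frac{\sigma^2t}{n}$$ with probability at least $\big(1-4\sum_{j\ge0}\exp(-2^jt/\mathfrak{v})\big)\vee0$, and $$\mathbb{E}\big[l_{\underline X^n}^2(\hat f_m,f_0)\big]\le\bar{\mathfrak{c}}^d\inf_{g\in\mathcal{P}_m}l_\nu^2(f_0,g)+\bar{\mathfrak{k}}^d\frac{\sigma^2\kappa D_m\log n}{n}.$$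
   Context: Regression model with random design: $X_1,\dots,X_n$ i.i.d. from a probability measure $\nu$ on $\Omega\subset\mathbb{R}^d$, $Y_i=f_0(X_i)+\epsilon_i$, errors independent of the $X_i$'s. $l_2(\nu)$ is the set of $\nu$-square-integrable functions. $l_\nu^2(f,g):=\int(f-g)^2\,d\nu$ and $l_{\underline X^n}^2(f,g):=\frac1n\sum_{i=1}^n(f(X_i)-g(X_i))^2$, $\underline X^n=(X_1,\dots,X_n)$. The estimator $\hat f_m\in\arg\min_{f\in\mathcal{P}_m}\frac1n\sum_{i=1}^n(Y_i-f(X_i))^2$ is assumed to exist. $F(\underline X^n;\mathcal{P}_m):=\{(g(X_1),\dots,g(X_n)):g\in\mathcal{P}_m\}\subset\mathbb{R}^n$. A set $V\subset\mathbb{R}^n$ has pseudo-dimension $\mathrm{pdim}(V)$ at most $t$ if for every set $I\subset\{1,\dots,n\}$ of $t+1$ distinct indices and every $x\in\mathbb{R}^{I}$ there is $J\subset I$ such that no $v\in V$ satisfies both $v_i>x_i$ for all $i\in J$ and $v_i<x_i$ for all $i\in I\setminus J$; $\mathrm{pdim}(V)$ is the smallest such $t$. $\kappa\ge1$ is an absolute constant (it exists, by Mendelson and Vershynin) such that for all $n$, every $V\subset\mathbb{R}^n$ with $\sup_{v\in V}\|v\|_\infty\le B$ and pseudo-dimension at most $t$, and every $\epsilon>0$, the minimal number of Euclidean $\epsilon$-balls covering $V$ is at most $(4+2B\sqrt n/\epsilon)^{\kappa t}$. Probabilities and expectations are understood as outer ones where measurability is an issue.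
   Formalization: The estimator is assumed jointly measurable in the data and the evaluation point (without measurability the outer-expectation claim fails), and the almost-sure conditions on the pseudo-dimension and on minimality are taken with respect to the law of the data. *)

theory Defs
  imports "HOL-Probability.Probability"
begin

text \<open>
  A vector of \<open>R^n\<close> is a function in \<open>extensional {..<n}\<close>; indices run over
  \<open>0, \<dots>, n - 1\<close>, so \<open>X_1\<close> and the first error carry the index \<open>0\<close>.
\<close>

definition restr :: "nat \<Rightarrow> (nat \<Rightarrow> 'w \<Rightarrow> 'b) \<Rightarrow> 'w \<Rightarrow> nat \<Rightarrow> 'b" where
  "restr n Z \<omega> = (\<lambda>i\<in>{..<n}. Z i \<omega>)"

definition l2 :: "'a measure \<Rightarrow> ('a \<Rightarrow> real) set" where
  "l2 \<nu> = {f \<in> borel_measurable \<nu>. integrable \<nu> (\<lambda>x. (f x)\<^sup>2)}"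

definition cont_loss :: "'a measure \<Rightarrow> ('a \<Rightarrow> real) \<Rightarrow> ('a \<Rightarrow> real) \<Rightarrow> real" where
  "cont_loss \<nu> f g = (\<integral>x. (f x - g x)\<^sup>2 \<partial>\<nu>)"

definition disc_loss :: "nat \<Rightarrow> (nat \<Rightarrow> 'a) \<Rightarrow> ('a \<Rightarrow> real) \<Rightarrow> ('a \<Rightarrow> real) \<Rightarrow> real" where
  "disc_loss n x f g = (\<Sum>i<n. (f (x i) - g (x i))\<^sup>2) / real n"

definition empirical_risk :: "nat \<Rightarrow> (nat \<Rightarrow> 'a) \<Rightarrow> (nat \<Rightarrow> real) \<Rightarrow> ('a \<Rightarrow> real) \<Rightarrow> real" where
  "empirical_risk n x y f = (\<Sum>i<n. (y i - f (x i))\<^sup>2) / real n"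

definition traces :: "nat \<Rightarrow> (nat \<Rightarrow> 'a) \<Rightarrow> ('a \<Rightarrow> real) set \<Rightarrow> (nat \<Rightarrow> real) set" where
  "traces n x P = (\<lambda>g. \<lambda>i\<in>{..<n}. g (x i)) ` P"

definition pdim_at_most :: "nat \<Rightarrow> (nat \<Rightarrow> real) set \<Rightarrow> nat \<Rightarrow> bool" where
  "pdim_at_most n V t \<longleftrightarrow>
     (\<forall>I x. I \<subseteq> {..<n} \<and> card I = t + 1 \<longrightarrow>
        (\<exists>J\<subseteq>I. \<not> (\<exists>v\<in>V. (\<forall>i\<in>J. v i > x i) \<and> (\<forall>i\<in>I - J. v i < x i))))"

text \<open>The least element exists, since \<open>pdim_at_most n V n\<close> holds vacuously.\<close>

definition pdim :: "nat \<Rightarrow> (nat \<Rightarrow> real) set \<Rightarrow> nat" where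
  "pdim n V = (LEAST t. pdim_at_most n V t)"

text \<open>
  Centres are arbitrary points of \<open>R^n\<close>. The least number exists for bounded \<open>V\<close>, the only
  sets to which this is applied.
\<close>

definition covering_number :: "nat \<Rightarrow> real \<Rightarrow> (nat \<Rightarrow> real) set \<Rightarrow> nat" where
  "covering_number n r V =
     (LEAST k. \<exists>C. C \<subseteq> extensional {..<n} \<and> finite C \<and> card C = k \<and>
        (\<forall>v\<in>V. \<exists>c\<in>C. sqrt (\<Sum>i<n. (v i - c i)\<^sup>2) \<le> r))"

definition covering_constant :: "real \<Rightarrow> bool" where
  "covering_constant \<kappa> \<longleftrightarrow> \<kappa> \<ge> 1 \<and>
     (\<forall>n V B t r. V \<subseteq> extensional {..<n} \<and> (\<forall>v\<in>V. \<forall>i<n. \<bar>v i\<bar> \<le> B) \<and>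
        pdim_at_most n V t \<and> r > 0 \<longrightarrow>
        real (covering_number n r V) \<le> (4 + 2 * B * sqrt (real n) / r) powr (\<kappa> * real t))"

definition outer_expectation :: "'w measure \<Rightarrow> ('w \<Rightarrow> real) \<Rightarrow> ennreal" where
  "outer_expectation M Z =
     (INF u \<in> {u \<in> borel_measurable M. \<forall>\<omega>\<in>space M. ennreal (Z \<omega>) \<le> u \<omega>}. \<integral>\<^sup>+\<omega>. u \<omega> \<partial>M)"

text \<open>
  The failure of \<open>A\<close> has outer probability at most \<open>1 - p\<close>. For non-measurable \<open>A\<close> this is
  stronger than a lower bound \<open>p\<close> on the outer probability of \<open>A\<close> itself.
\<close>

definition holds_with_prob_at_least :: "'w measure \<Rightarrow> ('w \<Rightarrow> bool) \<Rightarrow> real \<Rightarrow> bool" where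
  "holds_with_prob_at_least M A p \<longleftrightarrow>
     outer_measure_of M {\<omega> \<in> space M. \<not> A \<omega>} \<le> ennreal (1 - p)"

end

theory Submission
  imports Defs
begin

text \<open>
  With the design fixed, the basic inequality places the estimator in a ball around a
  near-optimal \<open>g\<close> whose radius is comparable to the norm of the noise vector. A single net
  of this ball has at most \<open>n powr (3 * \<kappa> * D)\<close> elements, and the sub-Gaussian bounds on the inner
  products of the noise with the finitely many net directions are relative to the length of the
  direction, so neither chaining nor peeling is needed. The infimum over the model is in general
  not a measurable function of the design. It is replaced by a conditional quantile of the loss,
  which is measurable and no larger.

  For the continuous norm, the noise is fixed and the estimator becomes a measurable selection
  from the model. The continuous loss is compared with the loss on a ghost sample, and the two
  samples are exchanged coordinatewise. For fixed data this leaves a uniformly distributed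
  finite set of exchanges and two nets, one for each half of the data, so the supremum over
  the model enters only under a finite average and its measurability is irrelevant.

  All bounds are proved for parameters slightly larger than \<open>\<sigma>\<close> and \<open>\<Gamma>\<close>, with a near-minimiser of
  the bias. The degenerate cases and the infimum are recovered as limits.
\<close>

subsection \<open>Covering numbers of traces\<close>

text \<open>The noise norm needs no estimate of its own: the signed coordinate vectors join the net
  directions, so the level \<open>sqrt S\<close> also bounds every noise coordinate, and the norm is
  at most \<open>sqrt n * sqrt S\<close>. This exceeds the target deviation by a factor
  \<open>sqrt n\<close>. The net is therefore taken with mesh of order \<open>1 / n\<close> relative
  to the radius, and this mesh is the source of \<open>ln n\<close> in the discrete rate.

  All comparisons are multiplicative: squares of sums are split with a factor two, and sums of
  bounded nonnegative terms are compared with multiples of their means. This gives the rate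
  \<open>1 / n\<close> without any variance estimate and makes the leading constants products of
  small factors. The bounds obtained have smaller constants than the claim, and the series in the
  claimed probability enters only through its first term.\<close>

abbreviation nrm :: "nat \<Rightarrow> (nat \<Rightarrow> real) \<Rightarrow> real" where
  "nrm n v \<equiv> L2_set v {..<n}"

lemma nrm_diff_triangle: "nrm n (\<lambda>i. u i - w i) \<le> nrm n (\<lambda>i. u i - v i) + nrm n (\<lambda>i. v i - w i)"
  using L2_set_triangle_ineq[of "\<lambda>i. u i - v i" "\<lambda>i. v i - w i" "{..<n}"] by simp

lemma nrm_diff_commute: "nrm n (\<lambda>i. u i - v i) = nrm n (\<lambda>i. v i - u i)"
  by (simp add: L2_set_def power2_commute)

lemma nrm_power2: "(nrm n v)\<^sup>2 = (\<Sum>i<n. (v i)\<^sup>2)"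
  by (simp add: L2_set_def sum_nonneg)

lemma inner_le_nrm: "(\<Sum>i<n. u i * v i) \<le> nrm n u * nrm n v"
proof -
  have "(\<Sum>i<n. u i * v i) \<le> (\<Sum>i<n. \<bar>u i\<bar> * \<bar>v i\<bar>)"
    by (intro sum_mono) (simp flip: abs_mult)
  also have "\<dots> \<le> nrm n u * nrm n v" by (rule L2_set_mult_ineq)
  finally show ?thesis .
qed

lemma abs_le_nrm: "i < n \<Longrightarrow> \<bar>v i\<bar> \<le> nrm n v"
  using member_le_L2_set[of "{..<n}" i "\<lambda>i. \<bar>v i\<bar>"] by (simp add: L2_set_def)

lemma nrm_le_of_abs_le: "(\<And>i. i < n \<Longrightarrow> \<bar>v i\<bar> \<le> c) \<Longrightarrow> 0 \<le> c \<Longrightarrow> nrm n v \<le> sqrt (real n) * c"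
proof -
  assume *: "\<And>i. i < n \<Longrightarrow> \<bar>v i\<bar> \<le> c" and c: "0 \<le> c"
  have "(\<Sum>i<n. (v i)\<^sup>2) \<le> (\<Sum>i<n. c\<^sup>2)"
    using * c by (intro sum_mono) (simp add: abs_le_square_iff[symmetric])
  then have "sqrt (\<Sum>i<n. (v i)\<^sup>2) \<le> sqrt (real n * c\<^sup>2)" by simp
  then show ?thesis using c by (simp add: L2_set_def real_sqrt_mult)
qed

lemma pdim_at_most_pdim: "pdim_at_most n V (pdim n V)"
  unfolding pdim_def
proof (rule LeastI)
  show "pdim_at_most n V n"
    unfolding pdim_at_most_def
  proof (intro allI impI)
    fix I and x :: "nat \<Rightarrow> real" assume I: "I \<subseteq> {..<n} \<and> card I = n + 1"
    then have "card I \<le> n" using card_mono[of "{..<n}" I] by simp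
    with I show "\<exists>J\<subseteq>I. \<not> (\<exists>v\<in>V. (\<forall>i\<in>J. v i > x i) \<and> (\<forall>i\<in>I - J. v i < x i))" by simp
  qed
qed

text \<open>The thresholds are shifted by \<open>w\<close>. Each element of \<open>W\<close> only
  has to be a translate of some element of \<open>V\<close>, so with \<open>w = 0\<close> the lemma
  also gives monotonicity under passing to subsets.\<close>

lemma pdim_at_most_translate:
  assumes V: "pdim_at_most n V t"
    and W: "\<And>v'. v' \<in> W \<Longrightarrow> \<exists>v\<in>V. \<forall>i<n. v' i = v i - w i"
  shows "pdim_at_most n W t"
  unfolding pdim_at_most_def
proof (intro allI impI)
  fix I and x :: "nat \<Rightarrow> real" assume I: "I \<subseteq> {..<n} \<and> card I = t + 1"
  then obtain J where J: "J \<subseteq> I"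
    "\<not> (\<exists>v\<in>V. (\<forall>i\<in>J. v i > x i + w i) \<and> (\<forall>i\<in>I - J. v i < x i + w i))"
    using V[unfolded pdim_at_most_def, rule_format, of I "\<lambda>i. x i + w i"] by blast
  have "\<not> (\<exists>v\<in>W. (\<forall>i\<in>J. v i > x i) \<and> (\<forall>i\<in>I - J. v i < x i))"
  proof
    assume "\<exists>v\<in>W. (\<forall>i\<in>J. v i > x i) \<and> (\<forall>i\<in>I - J. v i < x i)"
    then obtain v' where v': "v' \<in> W" "\<forall>i\<in>J. v' i > x i" "\<forall>i\<in>I - J. v' i < x i" by blast
    from W[OF v'(1)] obtain v where v: "v \<in> V" "\<forall>i<n. v' i = v i - w i" by blast
    have "\<forall>i\<in>J. v i > x i + w i" "\<forall>i\<in>I - J. v i < x i + w i"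
    proof safe
      fix i assume i: "i \<in> J"
      then have "i < n" using I J(1) by auto
      then show "v i > x i + w i" using v(2) v'(2) i by fastforce
    next
      fix i assume i: "i \<in> I" "i \<notin> J"
      then have "i < n" using I by auto
      then show "v i < x i + w i" using v(2) bspec[OF v'(3), of i] i by auto
    qed
    with J(2) v(1) show False by blast
  qed
  with J(1) show "\<exists>J\<subseteq>I. \<not> (\<exists>v\<in>W. (\<forall>i\<in>J. v i > x i) \<and> (\<forall>i\<in>I - J. v i < x i))" by blast
qed

text \<open>This makes the \<open>LEAST\<close> in \<open>covering_number\<close> a number attained
  by some cover. The centres are the points of a grid, and every vector is rounded down
  coordinatewise.\<close>

lemma finite_cover_exists:
  fixes V :: "(nat \<Rightarrow> real) set"
  assumes V: "\<And>v i. v \<in> V \<Longrightarrow> i < n \<Longrightarrow> \<bar>v i\<bar> \<le> B" and r: "r > 0"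
  obtains C where "C \<subseteq> extensional {..<n}" "finite C"
    "\<forall>v\<in>V. \<exists>c\<in>C. sqrt (\<Sum>i<n. (v i - c i)\<^sup>2) \<le> r"
proof -
  \<comment> \<open>Any mesh with \<open>sqrt n * \<delta> \<le> r\<close> would do; the
    \<open>+ 1\<close> avoids division by zero for \<open>n = 0\<close>.\<close>
  define \<delta> where "\<delta> = r / (real n + 1)"
  have \<delta>: "\<delta> > 0" using r by (simp add: \<delta>_def)
  define m where "m = \<lceil>B / \<delta>\<rceil> + 1"
  define C where "C = PiE {..<n} (\<lambda>_. (\<lambda>k::int. \<delta> * of_int k) ` {-m..m})"
  have "finite C" by (auto simp: C_def intro!: finite_PiE)
  moreover have "C \<subseteq> extensional {..<n}" by (auto simp: C_def PiE_def)
  moreover have "\<exists>c\<in>C. sqrt (\<Sum>i<n. (v i - c i)\<^sup>2) \<le> r" if v: "v \<in> V" for v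
  proof -
    define c where "c = (\<lambda>i\<in>{..<n}. \<delta> * of_int \<lfloor>v i / \<delta>\<rfloor>)"
    have "c \<in> C"
    proof -
      have "\<lfloor>v i / \<delta>\<rfloor> \<in> {-m..m}" if "i < n" for i
      proof -
        have "v i / \<delta> \<le> B / \<delta>" "- (B / \<delta>) \<le> v i / \<delta>"
          using V[OF v that] \<delta> by (auto simp: field_simps abs_le_iff)
        then show ?thesis unfolding m_def by simp linarith
      qed
      then show ?thesis by (auto simp: c_def C_def)
    qed
    moreover have "nrm n (\<lambda>i. v i - c i) \<le> sqrt (real n) * \<delta>"
    proof (rule nrm_le_of_abs_le)
      fix i assume i: "i < n"
      have "\<bar>v i / \<delta> - of_int \<lfloor>v i / \<delta>\<rfloor>\<bar> \<le> 1" by linarith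
      then have "\<bar>v i / \<delta> - of_int \<lfloor>v i / \<delta>\<rfloor>\<bar> * \<delta> \<le> \<delta>" using \<delta> by (simp add: mult_left_le_one_le)
      also have "\<bar>v i / \<delta> - of_int \<lfloor>v i / \<delta>\<rfloor>\<bar> * \<delta> = \<bar>v i - c i\<bar>"
      proof -
        have "\<bar>v i / \<delta> - of_int \<lfloor>v i / \<delta>\<rfloor>\<bar> * \<delta> = \<bar>(v i / \<delta> - of_int \<lfloor>v i / \<delta>\<rfloor>) * \<delta>\<bar>"
          using \<delta> by (simp add: abs_mult)
        also have "(v i / \<delta> - of_int \<lfloor>v i / \<delta>\<rfloor>) * \<delta> = v i - c i"
          using \<delta> i by (simp add: c_def field_simps)
        finally show ?thesis .
      qed
      finally show "\<bar>v i - c i\<bar> \<le> \<delta>" .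
    qed (use \<delta> in simp)
    moreover have "sqrt (real n) * \<delta> \<le> r"
    proof -
      have "sqrt (real n) \<le> real n + 1" by (rule real_le_lsqrt) (auto simp: power2_eq_square algebra_simps)
      then have "sqrt (real n) * r \<le> (real n + 1) * r" using r by (intro mult_right_mono) auto
      then show ?thesis by (simp add: \<delta>_def field_simps)
    qed
    ultimately show ?thesis unfolding L2_set_def by (meson order_trans)
  qed
  ultimately show ?thesis using that by blast
qed

text \<open>Centres are moved into the set at the price of doubling the radius.\<close>

lemma internal_net:
  fixes V :: "(nat \<Rightarrow> real) set"
  assumes k: "covering_constant \<kappa>" and V: "\<And>v i. v \<in> V \<Longrightarrow> i < n \<Longrightarrow> \<bar>v i - u i\<bar> \<le> B"
    and t: "pdim_at_most n V t" "real t \<le> D" and r: "r > 0"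
    and L: "ln (4 + 2 * B * sqrt (real n) / r) \<le> L" and B: "B \<ge> 0"
  obtains C where "C \<subseteq> V" "finite C" "real (card C) \<le> exp (\<kappa> * D * L)"
    "\<And>v. v \<in> V \<Longrightarrow> \<exists>c\<in>C. nrm n (\<lambda>i. v i - c i) \<le> 2 * r"
proof -
  \<comment> \<open>The entropy bound is stated for extensional vectors bounded around the origin,
    so \<open>V\<close> is recentred at \<open>u\<close> and cut off outside the first
    \<open>n\<close> indices.\<close>
  define W where "W = (\<lambda>v. \<lambda>i\<in>{..<n}. v i - u i) ` V"
  have W: "W \<subseteq> extensional {..<n}" "\<And>v i. v \<in> W \<Longrightarrow> i < n \<Longrightarrow> \<bar>v i\<bar> \<le> B"
    using V by (auto simp: W_def)
  have W3: "pdim_at_most n W t"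
    by (rule pdim_at_most_translate[OF t(1), of _ u]) (auto simp: W_def)
  define good where "good k \<longleftrightarrow> (\<exists>C. C \<subseteq> extensional {..<n} \<and> finite C \<and> card C = k \<and>
        (\<forall>v\<in>W. \<exists>c\<in>C. sqrt (\<Sum>i<n. (v i - c i)\<^sup>2) \<le> r))" for k
  obtain C0 where "C0 \<subseteq> extensional {..<n}" "finite C0" "\<forall>v\<in>W. \<exists>c\<in>C0. sqrt (\<Sum>i<n. (v i - c i)\<^sup>2) \<le> r"
    using finite_cover_exists[of W n B r] W(2) r by blast
  then have "good (card C0)" by (auto simp: good_def)
  then have "good (LEAST k. good k)" by (rule LeastI)
  then have "good (covering_number n r W)" unfolding covering_number_def good_def .
  then obtain C where C: "finite C" "card C = covering_number n r W"
     "\<And>v. v \<in> W \<Longrightarrow> \<exists>c\<in>C. sqrt (\<Sum>i<n. (v i - c i)\<^sup>2) \<le> r" by (auto simp: good_def)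
  have k1: "\<kappa> \<ge> 1" using k by (simp add: covering_constant_def)
  define b where "b = 4 + 2 * B * sqrt (real n) / r"
  have b: "b \<ge> 4" using r B by (simp add: b_def)
  have "real (covering_number n r W) \<le> b powr (\<kappa> * real t)"
    using k W W3 r unfolding covering_constant_def b_def by blast
  also have "\<dots> = exp (\<kappa> * real t * ln b)" using b by (simp add: powr_def)
  also have "\<dots> \<le> exp (\<kappa> * D * L)"
  proof -
    have "\<kappa> * real t * ln b \<le> \<kappa> * D * L"
      using k1 t(2) L b by (intro mult_mono) (auto simp: b_def)
    then show ?thesis by simp
  qed
  finally have card: "real (card C) \<le> exp (\<kappa> * D * L)" using C(2) by simp
  define near where "near c v \<longleftrightarrow> v \<in> V \<and> nrm n (\<lambda>i. v i - u i - c i) \<le> r" for c v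
  define C' where "C' = (\<lambda>c. SOME v. near c v) ` {c\<in>C. \<exists>v. near c v}"
  show ?thesis
  proof
    have *: "near c (SOME v. near c v)" if "\<exists>v. near c v" for c
      using that by (rule someI_ex)
    show "C' \<subseteq> V" using * by (auto simp: C'_def near_def)
    show "finite C'" using C by (simp add: C'_def)
    have "card C' \<le> card C"
      unfolding C'_def using C(1)
      by (intro order_trans[OF card_image_le card_mono]) auto
    then show "real (card C') \<le> exp (\<kappa> * D * L)" using card by linarith
    fix v assume v: "v \<in> V"
    then obtain c where c: "c \<in> C" "sqrt (\<Sum>i<n. ((\<lambda>i\<in>{..<n}. v i - u i) i - c i)\<^sup>2) \<le> r"
      using C(3)[of "\<lambda>i\<in>{..<n}. v i - u i"] by (auto simp: W_def)
    from c(2) have nv: "near c v" using v by (simp add: near_def L2_set_def)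
    define v' where "v' = (SOME v. near c v)"
    have nv': "near c v'" using *[of c] nv by (auto simp: v'_def)
    have "nrm n (\<lambda>i. v i - v' i) \<le> nrm n (\<lambda>i. v i - (u i + c i)) + nrm n (\<lambda>i. (u i + c i) - v' i)"
      by (rule nrm_diff_triangle)
    also have "nrm n (\<lambda>i. (u i + c i) - v' i) = nrm n (\<lambda>i. v' i - (u i + c i))"
      by (rule nrm_diff_commute)
    finally have "nrm n (\<lambda>i. v i - v' i) \<le> 2 * r"
      using nv nv' by (simp add: near_def algebra_simps)
    moreover have "v' \<in> C'" using c(1) nv by (auto simp: C'_def v'_def)
    ultimately show "\<exists>c\<in>C'. nrm n (\<lambda>i. v i - c i) \<le> 2 * r" by blast
  qed
qed

subsection \<open>Tail bounds and outer measure\<close>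

text \<open>Above \<open>A + \<beta>\<close> the variable is counted in steps of length
  \<open>\<beta>\<close>. The bound \<open>exp (- 1) \<le> 1 / 2\<close> turns the probabilities of
  the steps into a geometric series with sum \<open>c\<close>. Since \<open>ennreal\<close>
  truncates at zero, \<open>Z\<close> may take negative values.\<close>

lemma (in prob_space) nn_integral_le_of_exp_tail:
  fixes Z :: "'a \<Rightarrow> real"
  assumes Z[measurable]: "Z \<in> borel_measurable M"
    and tail: "\<And>s. s > 0 \<Longrightarrow> emeasure M {x \<in> space M. Z x > A + \<beta> * s} \<le> ennreal (c * exp (- s))"
    and A: "A \<ge> 0" and \<beta>: "\<beta> > 0" and c: "c \<ge> 0"
  shows "(\<integral>\<^sup>+x. ennreal (Z x) \<partial>M) \<le> ennreal (A + \<beta> * (1 + c))"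
proof -
  define E where "E j = {x \<in> space M. Z x > A + \<beta> * real (Suc j)}" for j
  have [measurable]: "E j \<in> sets M" for j unfolding E_def by measurable
  have pt: "ennreal (Z x) \<le> ennreal (A + \<beta>) + (\<Sum>j. ennreal \<beta> * indicator (E j) x)"
    if x: "x \<in> space M" for x
  proof (cases "Z x \<le> A + \<beta>")
    case True
    then show ?thesis by (meson ennreal_leI le_iff_add order_trans)
  next
    case False
    \<comment> \<open>\<open>k\<close> counts the levels passed. Rounding up gives the upper bound
      on \<open>Z x\<close>, yet \<open>k\<close> stays strictly below
      \<open>(Z x - A) / \<beta>\<close>, so \<open>x\<close> satisfies the strict inequality
      defining \<open>E j\<close> for every \<open>j < k\<close>.\<close>
    define k where "k = nat \<lceil>(Z x - A) / \<beta> - 1\<rceil>"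
    have q: "(Z x - A) / \<beta> - 1 > 0" using False \<beta> by (simp add: field_simps)
    have k1: "(Z x - A) / \<beta> - 1 \<le> real k" unfolding k_def by (rule real_nat_ceiling_ge)
    have k2: "real k < (Z x - A) / \<beta>"
      using q unfolding k_def by linarith
    have "ennreal (Z x) \<le> ennreal (A + \<beta> + real k * \<beta>)"
      using k1 \<beta> by (intro ennreal_leI) (simp add: field_simps)
    also have "\<dots> = ennreal (A + \<beta>) + of_nat k * ennreal \<beta>"
      using A \<beta> by (simp add: ennreal_plus ennreal_mult'' ennreal_of_nat_eq_real_of_nat)
    also have "of_nat k * ennreal \<beta> = (\<Sum>j<k. ennreal \<beta> * indicator (E j) x)"
    proof -
      have "x \<in> E j" if "j < k" for j
      proof -
        have "real (Suc j) \<le> real k" using that by simp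
        then have "real (Suc j) < (Z x - A) / \<beta>" using k2 by linarith
        then show ?thesis using x \<beta> by (simp add: E_def field_simps)
      qed
      then show ?thesis by simp
    qed
    also have "(\<Sum>j<k. ennreal \<beta> * indicator (E j) x) \<le> (\<Sum>j. ennreal \<beta> * indicator (E j) x)"
      by (rule sum_le_suminf) auto
    finally show ?thesis by (simp add: add_left_mono)
  qed
  have Ej: "emeasure M (E j) \<le> ennreal (c * (1/2) ^ Suc j)" for j
  proof -
    have "emeasure M (E j) \<le> ennreal (c * exp (- real (Suc j)))"
      unfolding E_def by (rule tail) simp
    also have "\<dots> \<le> ennreal (c * (1/2) ^ Suc j)"
    proof (intro ennreal_leI mult_left_mono c)
      have "exp (-1) \<le> (1/2 :: real)"
        using exp_ge_add_one_self[of 1] by (simp add: exp_minus field_simps)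
      then have "exp (-1) ^ Suc j \<le> (1/2 :: real) ^ Suc j" by (intro power_mono) auto
      then show "exp (- real (Suc j)) \<le> (1/2) ^ Suc j"
        by (metis exp_of_nat_mult mult_minus1_right)
    qed
    finally show ?thesis .
  qed
  have "(\<integral>\<^sup>+x. ennreal (Z x) \<partial>M)
      \<le> (\<integral>\<^sup>+x. ennreal (A + \<beta>) + (\<Sum>j. ennreal \<beta> * indicator (E j) x) \<partial>M)"
    by (intro nn_integral_mono pt)
  also have "\<dots> = ennreal (A + \<beta>) + (\<Sum>j. ennreal \<beta> * emeasure M (E j))"
    by (simp add: nn_integral_add nn_integral_suminf nn_integral_cmult emeasure_space_1)
  also have "(\<Sum>j. ennreal \<beta> * emeasure M (E j)) \<le> (\<Sum>j. ennreal (\<beta> * c * (1/2) ^ Suc j))"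
  proof (intro suminf_le)
    fix j
    have "ennreal \<beta> * emeasure M (E j) \<le> ennreal \<beta> * ennreal (c * (1/2) ^ Suc j)"
      by (intro mult_left_mono Ej) auto
    also have "\<dots> = ennreal (\<beta> * c * (1/2) ^ Suc j)"
      using \<beta> c by (simp only: ennreal_mult'[symmetric] mult.assoc less_imp_le)
    finally show "ennreal \<beta> * emeasure M (E j) \<le> ennreal (\<beta> * c * (1/2) ^ Suc j)" .
  qed auto
  also have "\<dots> = ennreal (\<beta> * c)"
    using \<beta> c sums_mult[OF power_half_series, of "\<beta> * c"]
    by (intro suminf_ennreal_eq) auto
  finally show ?thesis using A \<beta> c by (simp add: algebra_simps flip: ennreal_plus)
qed

text \<open>Outer measure is continuous along increasing sequences of arbitrary sets, so a slack
  \<open>\<delta>\<close> in the threshold can be removed without measurability of \<open>L\<close>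
  or \<open>c\<close>.\<close>

lemma outer_measure_of_gt_le:
  assumes "\<And>\<delta>. \<delta> > 0 \<Longrightarrow> outer_measure_of M {x \<in> space M. L x > (c x :: real) + \<delta>} \<le> q"
  shows "outer_measure_of M {x \<in> space M. L x > c x} \<le> q"
proof -
  define S where "S k = {x \<in> space M. L x > c x + 1 / real (Suc k)}" for k
  have "incseq S"
  proof (rule incseq_SucI)
    fix k
    have "1 / real (Suc (Suc k)) \<le> 1 / real (Suc k)" by (simp add: field_simps)
    then show "S k \<subseteq> S (Suc k)" by (auto simp: S_def simp del: of_nat_Suc)
  qed
  have "{x \<in> space M. L x > c x} = (\<Union>k. S k)"
  proof (intro equalityI subsetI)
    fix x assume x: "x \<in> {x \<in> space M. L x > c x}"
    then obtain k where "1 / real (Suc k) < L x - c x"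
      using nat_approx_posE[of "L x - c x"] by auto
    then have "x \<in> S k" using x by (simp add: S_def del: of_nat_Suc)
    then show "x \<in> (\<Union>k. S k)" by blast
  next
    fix x assume "x \<in> (\<Union>k. S k)"
    then obtain k where "x \<in> space M" "L x > c x + 1 / real (Suc k)" by (auto simp: S_def)
    moreover have "1 / real (Suc k) > 0" by simp
    ultimately show "x \<in> {x \<in> space M. L x > c x}" unfolding mem_Collect_eq by linarith
  qed
  also have "outer_measure_of M \<dots> = (SUP k. outer_measure_of M (S k))"
    by (subst SUP_outer_measure_of_incseq) (use \<open>incseq S\<close> in \<open>auto simp: S_def\<close>)
  also have "\<dots> \<le> q"
    by (intro SUP_least) (use assms in \<open>auto simp: S_def\<close>)
  finally show ?thesis .
qed

text \<open>
  The threshold \<open>I\<close> need not be measurable. Every fibre of the set \<open>B\<close> below has the form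
  \<open>L x > J\<close> with \<open>J \<le> I x\<close> a quantile, and only rational thresholds enter its definition.
\<close>

lemma outer_measure_of_fibrewise:
  fixes L :: "'a \<times> 'b \<Rightarrow> real"
  assumes "prob_space M" "prob_space N" and L[measurable]: "L \<in> borel_measurable (M \<Otimes>\<^sub>M N)"
    and I: "AE x in M. emeasure N {y \<in> space N. L (x, y) > I x} \<le> q"
  shows "outer_measure_of (M \<Otimes>\<^sub>M N) {z \<in> space (M \<Otimes>\<^sub>M N). L z > I (fst z)} \<le> q"
proof -
  interpret M: prob_space M by fact
  interpret N: prob_space N by fact
  interpret pair_prob_space M N ..
  obtain r :: "nat \<Rightarrow> real" where r: "range r = \<rat>"
    using range_from_nat_into[OF _ countable_rat] Rats_0 by blast
  define \<phi> where "\<phi> a x = emeasure N {y \<in> space N. L (x, y) > a}" for a x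
  have [measurable]: "\<phi> a \<in> borel_measurable M" for a
    unfolding \<phi>_def by measurable
  from I have "AE x in M. \<phi> (I x) x \<le> q" by (simp add: \<phi>_def)
  from AE_E[OF this] obtain Z where "{x \<in> space M. \<not> \<phi> (I x) x \<le> q} \<subseteq> Z"
    "emeasure M Z = 0" "Z \<in> sets M" .
  then have Z: "Z \<in> null_sets M" "{x \<in> space M. \<not> \<phi> (I x) x \<le> q} \<subseteq> Z" by auto
  have [measurable]: "Z \<in> sets M" using Z(1) by auto
  define B where "B = {z \<in> space (M \<Otimes>\<^sub>M N). \<exists>k. \<phi> (r k) (fst z) \<le> q \<and> L z > r k}"
  have B[measurable]: "B \<in> sets (M \<Otimes>\<^sub>M N)" unfolding B_def by measurable
  have sec: "emeasure N (Pair x -` B) \<le> q" if x: "x \<in> space M" for x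
  proof -
    \<comment> \<open>Among finitely many admissible thresholds the smallest has the largest upper
      level set, which contains the others. Each finite stage is therefore a single set of measure
      at most \<open>q\<close>, and no union bound is paid.\<close>
    define U where "U k = {y \<in> space N. \<exists>i\<le>k. \<phi> (r i) x \<le> q \<and> L (x, y) > r i}" for k
    have U[measurable]: "U k \<in> sets N" for k
      using x unfolding U_def by measurable
    have "incseq U" by (auto simp: U_def incseq_def intro: order_trans)
    have le: "emeasure N (U k) \<le> q" for k
    proof -
      define S where "S = {r i | i. i \<le> k \<and> \<phi> (r i) x \<le> q}"
      have fin: "finite S" by (simp add: S_def)
      show ?thesis
      proof (cases "S = {}")
        case True
        then have "U k = {}" by (auto simp: U_def S_def)
        then show ?thesis by simp
      next
        case False
        have "Min S \<in> S" using fin False by (rule Min_in)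
        have "U k = {y \<in> space N. L (x, y) > Min S}"
        proof (intro equalityI subsetI)
          fix y assume "y \<in> U k"
          then obtain i where i: "y \<in> space N" "r i \<in> S" "L (x, y) > r i" by (auto simp: U_def S_def)
          moreover have "Min S \<le> r i" using fin i(2) by (rule Min_le)
          ultimately show "y \<in> {y \<in> space N. L (x, y) > Min S}" by auto
        next
          fix y assume "y \<in> {y \<in> space N. L (x, y) > Min S}"
          then show "y \<in> U k" using \<open>Min S \<in> S\<close> by (auto simp: U_def S_def)
        qed
        then have "emeasure N (U k) = \<phi> (Min S) x" by (simp add: \<phi>_def)
        also have "\<dots> \<le> q" using \<open>Min S \<in> S\<close> by (auto simp: S_def)
        finally show ?thesis .
      qed
    qed
    have "Pair x -` B = (\<Union>k. U k)"
      using x by (auto simp: B_def U_def space_pair_measure)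
    also have "emeasure N \<dots> = (SUP k. emeasure N (U k))"
      by (rule SUP_emeasure_incseq[symmetric]) (use \<open>incseq U\<close> in auto)
    also have "\<dots> \<le> q" by (intro SUP_least le)
    finally show ?thesis .
  qed
  have "emeasure (M \<Otimes>\<^sub>M N) B = (\<integral>\<^sup>+x. emeasure N (Pair x -` B) \<partial>M)"
    by (rule N.emeasure_pair_measure_alt) simp
  also have "\<dots> \<le> (\<integral>\<^sup>+x. q \<partial>M)" by (intro nn_integral_mono sec)
  also have "\<dots> = q" by (simp add: M.emeasure_space_1)
  finally have Bq: "emeasure (M \<Otimes>\<^sub>M N) B \<le> q" .
  have "{z \<in> space (M \<Otimes>\<^sub>M N). L z > I (fst z)} \<subseteq> B \<union> Z \<times> space N"
  proof
    fix z assume z: "z \<in> {z \<in> space (M \<Otimes>\<^sub>M N). L z > I (fst z)}"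
    obtain x y where xy: "z = (x, y)" by (cases z)
    have sp: "x \<in> space M" "y \<in> space N" using z xy by (auto simp: space_pair_measure)
    show "z \<in> B \<union> Z \<times> space N"
    proof (cases "x \<in> Z")
      case False
      then have \<phi>: "\<phi> (I x) x \<le> q" using Z(2) sp by auto
      \<comment> \<open>A rational threshold between \<open>I x\<close> and \<open>L z\<close> is
        admissible because \<open>\<phi>\<close> decreases in the threshold, and it still detects
        \<open>z\<close>.\<close>
      obtain p where p: "p \<in> \<rat>" "I x < p" "p < L z"
        using Rats_dense_in_real[of "I x" "L z"] z xy by auto
      then obtain k where k: "p = r k" using r by (metis imageE)
      have "\<phi> p x \<le> \<phi> (I x) x"
        unfolding \<phi>_def using p(2) sp by (intro emeasure_mono) auto
      then have "\<phi> (r k) x \<le> q" using \<phi> k by simp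
      then show ?thesis using z xy p k by (auto simp: B_def)
    qed (use sp xy in auto)
  qed
  then have "outer_measure_of (M \<Otimes>\<^sub>M N) {z \<in> space (M \<Otimes>\<^sub>M N). L z > I (fst z)}
      \<le> outer_measure_of (M \<Otimes>\<^sub>M N) (B \<union> Z \<times> space N)"
    by (rule outer_measure_of_mono)
  also have "\<dots> = emeasure (M \<Otimes>\<^sub>M N) (B \<union> Z \<times> space N)" by (rule outer_measure_of_eq) measurable
  also have "\<dots> \<le> emeasure (M \<Otimes>\<^sub>M N) B + emeasure (M \<Otimes>\<^sub>M N) (Z \<times> space N)"
    by (rule emeasure_subadditive) measurable
  also have "emeasure (M \<Otimes>\<^sub>M N) (Z \<times> space N) = 0"
    using Z(1) by (subst N.emeasure_pair_measure_Times) (auto simp: null_sets_def)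
  finally show ?thesis using Bq by simp
qed

section \<open>Exponential moment bounds for sums over a product measure\<close>

lemma chernoff_PiM:
  fixes h :: "'i \<Rightarrow> 'a \<Rightarrow> real"
  assumes N: "prob_space N" and fin: "finite I"
    and h[measurable]: "\<And>i. i \<in> I \<Longrightarrow> h i \<in> borel_measurable N"
    and a: "\<And>i. i \<in> I \<Longrightarrow> (\<integral>\<^sup>+z. ennreal (exp (h i z)) \<partial>N) \<le> ennreal (exp (a i))"
  shows "emeasure (PiM I (\<lambda>_. N)) {x \<in> space (PiM I (\<lambda>_. N)). (\<Sum>i\<in>I. h i (x i)) \<ge> u}
           \<le> ennreal (exp ((\<Sum>i\<in>I. a i) - u))"
proof -
  interpret N: prob_space N by fact
  interpret product_sigma_finite "\<lambda>_. N" by standard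
  let ?P = "PiM I (\<lambda>_. N)"
  have [measurable]: "(\<lambda>x. \<Sum>i\<in>I. h i (x i)) \<in> borel_measurable ?P"
  proof (rule borel_measurable_sum)
    fix i assume "i \<in> I"
    then have [measurable]: "h i \<in> borel_measurable N" "(\<lambda>x. x i) \<in> measurable ?P N" by auto
    show "(\<lambda>x. h i (x i)) \<in> borel_measurable ?P" by measurable
  qed
  have "emeasure ?P {x \<in> space ?P. (\<Sum>i\<in>I. h i (x i)) \<ge> u}
      = (\<integral>\<^sup>+x. indicator {x \<in> space ?P. (\<Sum>i\<in>I. h i (x i)) \<ge> u} x \<partial>?P)"
    by (rule nn_integral_indicator[symmetric]) measurable
  also have "\<dots> \<le> (\<integral>\<^sup>+x. ennreal (exp (- u)) * (\<Prod>i\<in>I. ennreal (exp (h i (x i)))) \<partial>?P)"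
  proof (rule nn_integral_mono)
    fix x assume "x \<in> space ?P"
    have "ennreal (exp (- u)) * (\<Prod>i\<in>I. ennreal (exp (h i (x i))))
        = ennreal (exp ((\<Sum>i\<in>I. h i (x i)) - u))"
      using fin by (simp add: prod_ennreal exp_sum[symmetric] ennreal_mult'[symmetric] exp_add[symmetric])
    moreover have "1 \<le> ennreal (exp ((\<Sum>i\<in>I. h i (x i)) - u))" if "(\<Sum>i\<in>I. h i (x i)) \<ge> u"
      using that by (simp flip: ennreal_1)
    ultimately show "indicator {x \<in> space ?P. (\<Sum>i\<in>I. h i (x i)) \<ge> u} x
        \<le> ennreal (exp (- u)) * (\<Prod>i\<in>I. ennreal (exp (h i (x i))))"
      by (auto simp: indicator_def)
  qed
  also have "\<dots> = ennreal (exp (- u)) * (\<integral>\<^sup>+x. (\<Prod>i\<in>I. ennreal (exp (h i (x i)))) \<partial>?P)"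
  proof (rule nn_integral_cmult, rule borel_measurable_prod_ennreal)
    fix i assume "i \<in> I"
    then have [measurable]: "h i \<in> borel_measurable N" "(\<lambda>x. x i) \<in> measurable ?P N" by auto
    show "(\<lambda>x. ennreal (exp (h i (x i)))) \<in> borel_measurable ?P" by measurable
  qed
  also have "(\<integral>\<^sup>+x. (\<Prod>i\<in>I. ennreal (exp (h i (x i)))) \<partial>?P) = (\<Prod>i\<in>I. \<integral>\<^sup>+z. ennreal (exp (h i z)) \<partial>N)"
    by (rule product_nn_integral_prod) (use fin in auto)
  also have "ennreal (exp (- u)) * \<dots> \<le> ennreal (exp (- u)) * (\<Prod>i\<in>I. ennreal (exp (a i)))"
    by (intro mult_left_mono prod_mono_ennreal a) auto
  also have "\<dots> = ennreal (exp ((\<Sum>i\<in>I. a i) - u))"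
    using fin by (simp add: prod_ennreal exp_sum[symmetric] ennreal_mult'[symmetric] exp_add[symmetric])
  finally show ?thesis .
qed

text \<open>Each direction fails with probability at most \<open>exp (- (q + s))\<close>, and the
  union over at most \<open>exp q\<close> directions costs the factor \<open>exp q\<close>.
  Directions of length zero never fail, because the inequality in the event is strict.\<close>

lemma subgaussian_directions:
  assumes N: "prob_space N" and sets_N: "sets N = sets borel"
    and sub: "\<And>t. (\<integral>\<^sup>+y. ennreal (exp (t * y)) \<partial>N) \<le> ennreal (exp (\<sigma>\<^sup>2 * t\<^sup>2 / 2))"
    and \<sigma>: "\<sigma> > 0" and C: "finite C" "real (card C) \<le> exp q" and qs: "q + s > 0"
    and S: "S = 2 * \<sigma>\<^sup>2 * (q + s)"
  shows "emeasure (PiM {..<n} (\<lambda>_. N))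
      {e \<in> space (PiM {..<n} (\<lambda>_. N)). \<exists>c\<in>C. (\<Sum>i<n. c i * e i) > sqrt S * nrm n c} \<le> ennreal (exp (- s))"
proof -
  let ?P = "PiM {..<n} (\<lambda>_. N)"
  let ?A = "\<lambda>c. {e \<in> space ?P. (\<Sum>i<n. c i * e i) > sqrt S * nrm n c}"
  have [measurable_cong]: "sets N = sets borel" by fact
  have S0: "S > 0" using S \<sigma> qs by simp
  have meas: "?A c \<in> sets ?P" for c by measurable
  have one: "emeasure ?P (?A c) \<le> ennreal (exp (- (q + s)))" for c
  proof (cases "nrm n c = 0")
    case True
    then have "c i = 0" if "i < n" for i using that by (simp add: L2_set_eq_0_iff)
    then have "?A c = {}" using True by simp
    then have "emeasure ?P (?A c) = 0" by (simp only: emeasure_empty)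
    then show ?thesis by simp
  next
    case False
    then have pos: "nrm n c > 0" using L2_set_nonneg[of c "{..<n}"] by linarith
    \<comment> \<open>The optimal Chernoff parameter for variance
      \<open>\<sigma>\<^sup>2 * (nrm n c)\<^sup>2\<close> at the level
      \<open>sqrt S * nrm n c\<close>: the moment costs \<open>q + s\<close> and the level gains
      \<open>2 * (q + s)\<close>.\<close>
    define l where "l = sqrt S / (\<sigma>\<^sup>2 * nrm n c)"
    have l: "l > 0" using S0 \<sigma> pos by (simp add: l_def)
    have "(\<Sum>i<n. \<sigma>\<^sup>2 * (l * c i)\<^sup>2 / 2) = \<sigma>\<^sup>2 * l\<^sup>2 / 2 * (nrm n c)\<^sup>2"
      by (simp add: nrm_power2 sum_distrib_left power_mult_distrib mult_ac)
    also have "\<dots> = q + s"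
      using S0 \<sigma> pos by (simp add: l_def power_divide power_mult_distrib S field_simps power4_eq_xxxx power2_eq_square)
    finally have a: "(\<Sum>i<n. \<sigma>\<^sup>2 * (l * c i)\<^sup>2 / 2) = q + s" .
    have "l * (sqrt S * nrm n c) = (sqrt S)\<^sup>2 / \<sigma>\<^sup>2"
      using pos by (simp add: l_def power2_eq_square)
    also have "\<dots> = 2 * (q + s)" using S0 \<sigma> by (simp add: S)
    finally have u: "l * (sqrt S * nrm n c) = 2 * (q + s)" .
    have "?A c \<subseteq> {e \<in> space ?P. (\<Sum>i<n. l * c i * e i) \<ge> 2 * (q + s)}"
    proof safe
      fix e assume "(\<Sum>i<n. c i * e i) > sqrt S * nrm n c"
      then have "l * (sqrt S * nrm n c) \<le> l * (\<Sum>i<n. c i * e i)" using l by simp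
      then show "(\<Sum>i<n. l * c i * e i) \<ge> 2 * (q + s)"
        using u by (simp add: sum_distrib_left mult.assoc)
    qed
    then have "emeasure ?P (?A c) \<le> emeasure ?P {e \<in> space ?P. (\<Sum>i<n. l * c i * e i) \<ge> 2 * (q + s)}"
      by (rule emeasure_mono) measurable
    also have "\<dots> \<le> ennreal (exp ((\<Sum>i<n. \<sigma>\<^sup>2 * (l * c i)\<^sup>2 / 2) - 2 * (q + s)))"
      by (rule chernoff_PiM[OF N, of "{..<n}" "\<lambda>i y. l * c i * y"]) (use sub in auto)
    finally show ?thesis using a by simp
  qed
  have "emeasure ?P {e \<in> space ?P. \<exists>c\<in>C. (\<Sum>i<n. c i * e i) > sqrt S * nrm n c} = emeasure ?P (\<Union>c\<in>C. ?A c)"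
    by (rule arg_cong[where f = "emeasure ?P"]) auto
  also have "\<dots> \<le> (\<Sum>c\<in>C. emeasure ?P (?A c))"
    using C(1) meas by (intro emeasure_subadditive_finite) auto
  also have "\<dots> \<le> (\<Sum>c\<in>C. ennreal (exp (- (q + s))))" by (intro sum_mono one)
  also have "\<dots> = ennreal (real (card C) * exp (- (q + s)))"
    by (simp add: ennreal_mult' ennreal_of_nat_eq_real_of_nat)
  also have "\<dots> \<le> ennreal (exp q * exp (- (q + s)))"
    using C(2) by (intro ennreal_leI mult_right_mono) auto
  also have "exp q * exp (- (q + s)) = exp (- s)" by (simp flip: exp_add)
  finally show ?thesis .
qed

text \<open>Linear bounds on the exponential reduce the exponential moments of a variable with
  values in the unit interval to functions of its mean alone.\<close>

lemma exp_le_chord: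
  assumes "0 \<le> x" "x \<le> (1 :: real)"
  shows "exp x \<le> 1 + 2 * x" "exp (- x) \<le> 1 - x / 2"
proof -
  have "x\<^sup>2 \<le> x" using assms by (simp add: power2_eq_square mult_left_le)
  with exp_bound[OF assms] show "exp x \<le> 1 + 2 * x" by linarith
  have "exp (- x) = 1 / exp x" by (simp add: exp_minus field_simps)
  also have "\<dots> \<le> 1 / (1 + x)" using assms by (intro divide_left_mono) (auto simp: exp_ge_add_one_self)
  also have "\<dots> \<le> 1 - x / 2"
    using assms \<open>x\<^sup>2 \<le> x\<close> by (simp add: field_simps power2_eq_square)
  finally show "exp (- x) \<le> 1 - x / 2" .
qed

context
  fixes N :: "'a measure" and h :: "'a \<Rightarrow> real" and B :: real and I :: "'i set"
  assumes N: "prob_space N" and h[measurable]: "h \<in> borel_measurable N"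
    and h0: "\<And>z. z \<in> space N \<Longrightarrow> 0 \<le> h z" and hB: "\<And>z. z \<in> space N \<Longrightarrow> h z \<le> B"
    and B: "B > 0" and I: "finite I"
begin

lemma bounded_integrable: "integrable N h"
proof -
  interpret prob_space N by fact
  show ?thesis
    by (rule integrable_const_bound[of _ B]) (use h0 hB in auto)
qed

text \<open>The exponential moment at scale \<open>1 / B\<close> is bounded through the mean alone.
  The factor two on the mean replaces a variance term and leaves a deviation linear in
  \<open>t\<close>.\<close>

lemma sum_upper_tail:
  "emeasure (PiM I (\<lambda>_. N)) {x \<in> space (PiM I (\<lambda>_. N)). (\<Sum>i\<in>I. h (x i)) > 2 * real (card I) * (\<integral>z. h z \<partial>N) + B * t}
    \<le> ennreal (exp (- t))"
proof -
  interpret prob_space N by fact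
  let ?P = "PiM I (\<lambda>_. N)"
  let ?m = "\<integral>z. h z \<partial>N"
  have "(\<integral>\<^sup>+z. ennreal (exp (h z / B)) \<partial>N) \<le> (\<integral>\<^sup>+z. ennreal (1 + 2 * h z / B) \<partial>N)"
  proof (intro nn_integral_mono ennreal_leI)
    fix z assume "z \<in> space N"
    then show "exp (h z / B) \<le> 1 + 2 * h z / B"
      using exp_le_chord(1)[of "h z / B"] h0[of z] hB[of z] B by simp
  qed
  also have "\<dots> = ennreal (\<integral>z. 1 + 2 * h z / B \<partial>N)"
    using bounded_integrable h0 B by (intro nn_integral_eq_integral) auto
  also have "(\<integral>z. 1 + 2 * h z / B \<partial>N) = 1 + 2 * ?m / B"
    using bounded_integrable by (simp add: prob_space)
  also have "ennreal (1 + 2 * ?m / B) \<le> ennreal (exp (2 * ?m / B))"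
    by (intro ennreal_leI exp_ge_add_one_self)
  finally have 1: "(\<integral>\<^sup>+z. ennreal (exp (h z / B)) \<partial>N) \<le> ennreal (exp (2 * ?m / B))" .
  have "emeasure ?P {x \<in> space ?P. (\<Sum>i\<in>I. h (x i)) > 2 * real (card I) * ?m + B * t}
      \<le> emeasure ?P {x \<in> space ?P. (\<Sum>i\<in>I. h (x i) / B) \<ge> 2 * real (card I) * ?m / B + t}"
  proof (rule emeasure_mono)
    show "{x \<in> space ?P. (\<Sum>i\<in>I. h (x i)) > 2 * real (card I) * ?m + B * t}
        \<subseteq> {x \<in> space ?P. (\<Sum>i\<in>I. h (x i) / B) \<ge> 2 * real (card I) * ?m / B + t}"
    proof safe
      fix x assume "(\<Sum>i\<in>I. h (x i)) > 2 * real (card I) * ?m + B * t"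
      then have "(2 * real (card I) * ?m + B * t) / B \<le> (\<Sum>i\<in>I. h (x i)) / B"
        using B by (intro divide_right_mono) auto
      then show "(\<Sum>i\<in>I. h (x i) / B) \<ge> 2 * real (card I) * ?m / B + t"
        using B by (simp add: sum_divide_distrib add_divide_distrib)
    qed
    have "(\<lambda>x. \<Sum>i\<in>I. h (x i) / B) \<in> borel_measurable ?P"
    proof (rule borel_measurable_sum)
      fix i assume "i \<in> I"
      then have [measurable]: "(\<lambda>x. x i) \<in> measurable ?P N" by auto
      show "(\<lambda>x. h (x i) / B) \<in> borel_measurable ?P" by measurable
    qed
    then show "{x \<in> space ?P. (\<Sum>i\<in>I. h (x i) / B) \<ge> 2 * real (card I) * ?m / B + t} \<in> sets ?P"
      by measurable
  qed
  also have "\<dots> \<le> ennreal (exp ((\<Sum>i\<in>I. 2 * ?m / B) - (2 * real (card I) * ?m / B + t)))"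
    by (rule chernoff_PiM[OF N I, of "\<lambda>_ z. h z / B"]) (use 1 in auto)
  finally show ?thesis by (simp add: field_simps)
qed

text \<open>The Chernoff exponent is \<open>- (card I * mean / (4 * B))\<close>, which
  \<open>large\<close> makes at most \<open>- 1\<close>. The constant probability is what a ghost
  sample needs.\<close>

lemma sum_lower_tail:
  assumes large: "real (card I) * (\<integral>z. h z \<partial>N) \<ge> 4 * B"
  shows "emeasure (PiM I (\<lambda>_. N)) {x \<in> space (PiM I (\<lambda>_. N)). (\<Sum>i\<in>I. h (x i)) \<le> real (card I) * (\<integral>z. h z \<partial>N) / 4}
    \<le> ennreal (1 / 2)"
proof -
  interpret prob_space N by fact
  let ?P = "PiM I (\<lambda>_. N)"
  let ?m = "\<integral>z. h z \<partial>N"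
  have "(\<integral>\<^sup>+z. ennreal (exp (- h z / B)) \<partial>N) \<le> (\<integral>\<^sup>+z. ennreal (1 - h z / (2 * B)) \<partial>N)"
  proof (intro nn_integral_mono ennreal_leI)
    fix z assume "z \<in> space N"
    then show "exp (- h z / B) \<le> 1 - h z / (2 * B)"
      using exp_le_chord(2)[of "h z / B"] h0[of z] hB[of z] B by (simp add: mult.commute)
  qed
  also have "\<dots> = ennreal (\<integral>z. 1 - h z / (2 * B) \<partial>N)"
  proof (rule nn_integral_eq_integral)
    show "AE z in N. 0 \<le> 1 - h z / (2 * B)"
    proof (rule AE_I2)
      fix z assume "z \<in> space N"
      then show "0 \<le> 1 - h z / (2 * B)" using hB[of z] B by (simp add: field_simps)
    qed
  qed (use bounded_integrable in auto)
  also have "(\<integral>z. 1 - h z / (2 * B) \<partial>N) = 1 + - (?m / (2 * B))"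
    using bounded_integrable by (simp add: prob_space)
  also have "ennreal (1 + - (?m / (2 * B))) \<le> ennreal (exp (- (?m / (2 * B))))"
    by (intro ennreal_leI exp_ge_add_one_self)
  finally have 1: "(\<integral>\<^sup>+z. ennreal (exp (- h z / B)) \<partial>N) \<le> ennreal (exp (- (?m / (2 * B))))" .
  have "emeasure ?P {x \<in> space ?P. (\<Sum>i\<in>I. h (x i)) \<le> real (card I) * ?m / 4}
      \<le> emeasure ?P {x \<in> space ?P. (\<Sum>i\<in>I. - h (x i) / B) \<ge> - (real (card I) * ?m / (4 * B))}"
  proof (rule emeasure_mono)
    show "{x \<in> space ?P. (\<Sum>i\<in>I. h (x i)) \<le> real (card I) * ?m / 4}
        \<subseteq> {x \<in> space ?P. (\<Sum>i\<in>I. - h (x i) / B) \<ge> - (real (card I) * ?m / (4 * B))}"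
      using B by (auto simp: sum_divide_distrib[symmetric] sum_negf field_simps)
    have "(\<lambda>x. \<Sum>i\<in>I. - h (x i) / B) \<in> borel_measurable ?P"
    proof (rule borel_measurable_sum)
      fix i assume "i \<in> I"
      then have [measurable]: "(\<lambda>x. x i) \<in> measurable ?P N" by auto
      show "(\<lambda>x. - h (x i) / B) \<in> borel_measurable ?P" by measurable
    qed
    then show "{x \<in> space ?P. (\<Sum>i\<in>I. - h (x i) / B) \<ge> - (real (card I) * ?m / (4 * B))} \<in> sets ?P"
      by measurable
  qed
  also have "\<dots> \<le> ennreal (exp ((\<Sum>i\<in>I. - (?m / (2 * B))) - - (real (card I) * ?m / (4 * B))))"
    by (rule chernoff_PiM[OF N I, of "\<lambda>_ z. - h z / B"]) (use 1 in auto)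
  also have "\<dots> \<le> ennreal (1 / 2)"
  proof (rule ennreal_leI)
    have "(\<Sum>i\<in>I. - (?m / (2 * B))) - - (real (card I) * ?m / (4 * B)) = - (real (card I) * ?m / (4 * B))"
      using B by (simp add: field_simps)
    also have "\<dots> \<le> - 1" using large B by (simp add: field_simps)
    finally have "exp ((\<Sum>i\<in>I. - (?m / (2 * B))) - - (real (card I) * ?m / (4 * B))) \<le> exp (- 1)" by simp
    also have "\<dots> \<le> 1 / 2" using exp_le_chord(2)[of 1] by simp
    finally show "exp ((\<Sum>i\<in>I. - (?m / (2 * B))) - - (real (card I) * ?m / (4 * B))) \<le> 1 / 2" .
  qed
  finally show ?thesis .
qed

end

subsection \<open>Deviation of least squares on a fixed design\<close>

lemma one_le_entropy:
  assumes k: "covering_constant \<kappa>" and n: "n \<ge> 7" and D: "D \<ge> 1"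
  shows "1 \<le> \<kappa> * D * ln (real n)"
proof -
  have k1: "\<kappa> \<ge> 1" using k by (simp add: covering_constant_def)
  have ln1: "ln (real n) \<ge> 1"
  proof -
    have "exp 1 \<le> real n" using exp_le n by linarith
    then show ?thesis using n by (simp add: ln_ge_iff)
  qed
  have "1 \<le> \<kappa> * D" using mult_mono[OF k1 D] k1 by simp
  then show ?thesis using ln1 mult_mono[of 1 "\<kappa> * D" 1 "ln (real n)"] by simp
qed

text \<open>The left side of the first inequality is the base of the covering bound for a ball of
  radius \<open>R\<close> at scale \<open>R / (2 * n)\<close>. In the second, \<open>y\<close> is
  the entropy term: one more factor \<open>exp y\<close> pays for the \<open>2 * n\<close> signed
  coordinate vectors added to the net.\<close>

lemma entropy_numerics:
  fixes y :: real
  assumes n: "n \<ge> 7" and y: "ln (real n) \<le> y"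
  shows "4 + 4 * real n * sqrt (real n) \<le> real n ^ 3" "exp (3 * y) + 2 * real n \<le> exp (4 * y)"
proof -
  have "sqrt (real n) \<le> real n" using n by (intro real_le_lsqrt) (auto simp: power2_eq_square)
  then have "4 * real n * sqrt (real n) \<le> 4 * real n * real n" by (intro mult_left_mono) auto
  moreover have "7 * (real n * real n) \<le> real n * (real n * real n)" using n by (intro mult_right_mono) auto
  moreover have "7 * 7 \<le> real n * real n" using n by (intro mult_mono) auto
  ultimately show "4 + 4 * real n * sqrt (real n) \<le> real n ^ 3" by (simp add: power3_eq_cube mult.assoc)
  have ny: "real n \<le> exp y" using n y by (metis exp_le_cancel_iff exp_ln gr0I not_numeral_le_zero of_nat_0_less_iff)
  then have 1: "7 \<le> exp y" using n by linarith
  have "0 < ln (real n)" using n by simp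
  then have "0 \<le> y" using y by linarith
  have "2 * exp y * 1 \<le> exp y * exp y * exp y" using 1 \<open>0 \<le> y\<close> by (intro mult_mono) auto
  moreover have "2 * (exp y * exp y * exp y) \<le> exp y * (exp y * exp y * exp y)"
    using 1 by (intro mult_right_mono) auto
  moreover have "exp (3 * y) = exp y * exp y * exp y" "exp (4 * y) = exp y * (exp y * exp y * exp y)"
    by (simp_all flip: exp_add)
  ultimately show "exp (3 * y) + 2 * real n \<le> exp (4 * y)" using ny by linarith
qed

text \<open>
  Since the estimate on \<open>\<langle>c, e\<rangle>\<close> is relative to the length of \<open>c\<close>, one net of the ball of
  radius \<open>R\<close>, in which the estimator lies by the basic inequality, replaces peeling.
\<close>

lemma least_squares_deviation:
  fixes V :: "(nat \<Rightarrow> real) set" and u w :: "nat \<Rightarrow> real"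
  assumes N: "prob_space N" and sets_N: "sets N = sets borel"
    and sub: "\<And>t. (\<integral>\<^sup>+y. ennreal (exp (t * y)) \<partial>N) \<le> ennreal (exp (\<sigma>\<^sup>2 * t\<^sup>2 / 2))"
    and \<sigma>: "\<sigma> > 0" and k: "covering_constant \<kappa>" and n: "n \<ge> 7"
    and d: "pdim_at_most n V d" "real d \<le> D" and D: "D \<ge> 1" and w: "w \<in> V" and s: "s > 0"
    and S: "S = 2 * \<sigma>\<^sup>2 * (4 * (\<kappa> * D * ln (real n)) + s)"
  obtains A where "A \<in> sets (PiM {..<n} (\<lambda>_. N))" "emeasure (PiM {..<n} (\<lambda>_. N)) A \<le> ennreal (exp (- s))"
    "\<And>e v. e \<in> space (PiM {..<n} (\<lambda>_. N)) \<Longrightarrow> e \<notin> A \<Longrightarrow> v \<in> V \<Longrightarrow>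
        (\<Sum>i<n. (u i + e i - v i)\<^sup>2) \<le> (\<Sum>i<n. (u i + e i - w i)\<^sup>2) \<Longrightarrow>
        nrm n (\<lambda>i. v i - u i) \<le> nrm n (\<lambda>i. w i - u i) + 4 * sqrt S"
proof -
  let ?P = "PiM {..<n} (\<lambda>_. N)"
  have [measurable_cong]: "sets N = sets borel" by fact
  define y where "y = \<kappa> * D * ln (real n)"
  have k1: "\<kappa> \<ge> 1" using k by (simp add: covering_constant_def)
  have ln0: "ln (real n) > 0" using n by simp
  have kD: "1 \<le> \<kappa> * D" using mult_mono[OF k1 D] k1 by simp
  then have y: "ln (real n) \<le> y" using ln0 mult_right_mono[OF kD, of "ln (real n)"] by (simp add: y_def)
  have y0: "y > 0" using y ln0 by linarith
  have S': "S = 2 * \<sigma>\<^sup>2 * (4 * y + s)" by (simp add: S y_def)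
  have S0: "S > 0" using S' \<sigma> y0 s by simp
  define b where "b = nrm n (\<lambda>i. w i - u i)"
  have b0: "b \<ge> 0" by (simp add: b_def)
  define q where "q = sqrt S"
  have q0: "q > 0" using S0 by (simp add: q_def)
  define r where "r = sqrt (real n)"
  have r2: "r * r = real n" by (simp add: r_def)
  have r0: "r \<ge> 1" using n by (simp add: r_def)
  \<comment> \<open>The basic inequality and Cauchy-Schwarz with noise norm at most
    \<open>r * q\<close> give \<open>(a - r * q)\<^sup>2 \<le> (b + r * q)\<^sup>2\<close>, so
    \<open>a \<le> b + 2 * r * q\<close>. The distance from \<open>w\<close> is at most
    \<open>a + b\<close>, hence at most \<open>R\<close>.\<close>
  define R where "R = 2 * b + 2 * r * q"
  have R0: "R > 0" unfolding R_def using b0 mult_pos_pos[of r q] r0 q0 by linarith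
  define VR where "VR = {v \<in> V. nrm n (\<lambda>i. v i - w i) \<le> R}"
  have dVR: "pdim_at_most n VR d"
    by (rule pdim_at_most_translate[OF d(1), of _ "\<lambda>_. 0"]) (auto simp: VR_def)
  have n0: "real n > 0" using n by simp
  \<comment> \<open>Moving the centres into \<open>VR\<close> doubles the radius, so the effective
    mesh is \<open>R / n\<close>.\<close>
  obtain C where C: "C \<subseteq> VR" "finite C" "real (card C) \<le> exp (\<kappa> * D * (3 * ln (real n)))"
    "\<And>v. v \<in> VR \<Longrightarrow> \<exists>c\<in>C. nrm n (\<lambda>i. v i - c i) \<le> 2 * (R / (2 * real n))"
  proof (rule internal_net[OF k _ dVR d(2), of w R "R / (2 * real n)" "3 * ln (real n)"])
    fix v i assume "v \<in> VR" "i < n"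
    then show "\<bar>v i - w i\<bar> \<le> R" using abs_le_nrm[of i n "\<lambda>i. v i - w i"] by (auto simp: VR_def)
  next
    show "R / (2 * real n) > 0" "R \<ge> 0" using R0 n0 by auto
    have "2 * R * sqrt (real n) / (R / (2 * real n)) = 4 * real n * sqrt (real n)"
      using R0 n0 by (simp add: field_simps)
    then have "ln (4 + 2 * R * sqrt (real n) / (R / (2 * real n))) = ln (4 + 4 * real n * sqrt (real n))"
      by simp
    also have "\<dots> \<le> ln (real n ^ 3)"
    proof -
      have "0 < 4 + 4 * real n * sqrt (real n)" by (rule add_pos_nonneg) auto
      then show ?thesis using entropy_numerics(1)[OF n y] n0 by (intro ln_mono) auto
    qed
    also have "\<dots> = 3 * ln (real n)" using n0 by (simp add: ln_realpow)
    finally show "ln (4 + 2 * R * sqrt (real n) / (R / (2 * real n))) \<le> 3 * ln (real n)" .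
  qed (rule that; blast)
  \<comment> \<open>The signed coordinate vectors. Along them the directional bound reads
    \<open>\<bar>e i\<bar> \<le> q\<close>, which is how the noise norm is controlled by
    \<open>r * q\<close>.\<close>
  define E where "E = (\<lambda>(j, b). \<lambda>i::nat. if i = j then (if b then 1 else - 1) else (0::real)) ` ({..<n} \<times> (UNIV :: bool set))"
  define C' where "C' = (\<lambda>c i. c i - w i) ` C \<union> E"
  have finC': "finite C'" using C(2) by (simp add: C'_def E_def)
  have "real (card C') \<le> exp (4 * y)"
  proof -
    have "card C' \<le> card ((\<lambda>c i. c i - w i) ` C) + card E" unfolding C'_def by (rule card_Un_le)
    also have "\<dots> \<le> card C + card ({..<n} \<times> (UNIV :: bool set))"
      unfolding E_def by (intro add_mono card_image_le) (use C(2) in auto)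
    also have "card ({..<n} \<times> (UNIV :: bool set)) = 2 * n" by (simp add: card_cartesian_product)
    finally have "real (card C') \<le> real (card C) + 2 * real n" by linarith
    also have "real (card C) \<le> exp (3 * y)" using C(3) by (simp add: y_def mult_ac)
    finally show ?thesis using entropy_numerics(2)[OF n y] by linarith
  qed
  define A where "A = {e \<in> space ?P. \<exists>c\<in>C'. (\<Sum>i<n. c i * e i) > sqrt S * nrm n c}"
  have meas: "{e \<in> space ?P. (\<Sum>i<n. c i * e i) > sqrt S * nrm n c} \<in> sets ?P" for c by measurable
  show ?thesis
  proof
    show "A \<in> sets ?P"
      unfolding A_def using finC' by (intro sets.sets_Collect_finite_Ex meas) auto
    show "emeasure ?P A \<le> ennreal (exp (- s))"
      unfolding A_def using y0 s
      by (intro subgaussian_directions[OF N sets_N sub \<sigma> finC' \<open>real (card C') \<le> exp (4 * y)\<close> _ S']) auto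
  next
    fix e v assume e: "e \<in> space ?P" "e \<notin> A" and v: "v \<in> V"
      and le: "(\<Sum>i<n. (u i + e i - v i)\<^sup>2) \<le> (\<Sum>i<n. (u i + e i - w i)\<^sup>2)"
    define a where "a = nrm n (\<lambda>i. v i - u i)"
    have a0: "a \<ge> 0" by (simp add: a_def)
    have dir: "(\<Sum>i<n. c i * e i) \<le> q * nrm n c" if "c \<in> C'" for c
      using e that by (auto simp: A_def q_def not_less)
    have "\<bar>e i\<bar> \<le> q" if i: "i < n" for i
    proof -
      have "(\<lambda>j. if j = i then (if b then 1 else - 1) else 0) \<in> C'" for b
        using i by (auto simp: C'_def E_def intro!: image_eqI[of _ _ "(i, b)"])
      note dir[OF this]
      moreover have "(\<Sum>j<n. (if j = i then (if b then 1 else - 1) else 0) * e j) = (if b then 1 else - 1) * e i" for b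
        using i by (simp add: if_distrib[of "\<lambda>x. x * _"] sum.delta' cong: if_cong)
      moreover have "nrm n (\<lambda>j. if j = i then (if b then 1 else - 1) else 0) = 1" for b
      proof -
        have "(\<Sum>j<n. ((if j = i then (if b then 1 else - 1) else 0) :: real)\<^sup>2) = (\<Sum>j<n. if j = i then 1 else 0)"
          by (intro sum.cong) auto
        then show ?thesis using i by (simp add: L2_set_def)
      qed
      ultimately have *: "(if b then 1 else - 1) * e i \<le> q" for b by (metis mult.right_neutral)
      from *[of True] *[of False] show ?thesis by simp
    qed
    then have en: "nrm n e \<le> r * q" unfolding r_def using q0 by (intro nrm_le_of_abs_le) auto
    have "(\<Sum>i<n. (u i + e i - w i)\<^sup>2) - (\<Sum>i<n. (u i + e i - v i)\<^sup>2)
        = (\<Sum>i<n. (w i - u i)\<^sup>2) - (\<Sum>i<n. (v i - u i)\<^sup>2) + 2 * (\<Sum>i<n. (v i - w i) * e i)"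
      unfolding sum_subtractf[symmetric] sum_distrib_left sum.distrib[symmetric]
      by (intro sum.cong) (auto simp: power2_eq_square algebra_simps)
    then have basic: "a\<^sup>2 \<le> b\<^sup>2 + 2 * (\<Sum>i<n. (v i - w i) * e i)"
      using le by (simp add: a_def b_def nrm_power2)
    have "nrm n (\<lambda>i. v i - w i) \<le> a + nrm n (\<lambda>i. u i - w i)"
      unfolding a_def by (rule nrm_diff_triangle)
    then have vw: "nrm n (\<lambda>i. v i - w i) \<le> a + b" by (simp add: b_def nrm_diff_commute[of w u n])
    have "(\<Sum>i<n. (v i - w i) * e i) \<le> nrm n (\<lambda>i. v i - w i) * nrm n e" by (rule inner_le_nrm)
    also have "\<dots> \<le> (a + b) * (r * q)" using vw en a0 b0 by (intro mult_mono) auto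
    finally have "a\<^sup>2 \<le> b\<^sup>2 + 2 * ((a + b) * (r * q))" using basic by linarith
    then have "(a - r * q)\<^sup>2 \<le> (b + r * q)\<^sup>2" by (simp add: power2_eq_square algebra_simps)
    then have "a - r * q \<le> b + r * q"
      using b0 q0 r0 by (intro power2_le_imp_le[of "a - r * q" "b + r * q"]) auto
    then have "a + b \<le> R" by (simp add: R_def algebra_simps)
    then have "v \<in> VR" using v vw by (simp add: VR_def)
    from C(4)[OF this] obtain c where c: "c \<in> C" "nrm n (\<lambda>i. v i - c i) \<le> R / real n" by auto
    have "(\<Sum>i<n. (v i - w i) * e i) = (\<Sum>i<n. (c i - w i) * e i) + (\<Sum>i<n. (v i - c i) * e i)"
      unfolding sum.distrib[symmetric] by (intro sum.cong) (auto simp: algebra_simps)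
    also have "(\<Sum>i<n. (c i - w i) * e i) \<le> q * nrm n (\<lambda>i. c i - w i)"
      using c(1) by (intro dir) (auto simp: C'_def)
    also have "nrm n (\<lambda>i. c i - w i) \<le> R / real n + (a + b)"
      using nrm_diff_triangle[of c w n v] c(2) vw nrm_diff_commute[of c v n] by linarith
    also have "(\<Sum>i<n. (v i - c i) * e i) \<le> nrm n (\<lambda>i. v i - c i) * nrm n e" by (rule inner_le_nrm)
    also have "\<dots> \<le> (R / real n) * (r * q)" using c(2) en R0 n0 by (intro mult_mono) auto
    finally have inner: "(\<Sum>i<n. (v i - w i) * e i) \<le> q * (R / real n + (a + b)) + R / real n * (r * q)"
      using q0 by simp
    \<comment> \<open>The net error enters twice: once through the length of the net direction, and
      once, multiplied by the noise norm, through the remainder. Mesh \<open>R / n\<close> suffices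
      because both \<open>1 + r\<close> and \<open>r\<close> are at most
      \<open>n = r * r\<close>.\<close>
    have "R / real n * (1 + r) \<le> 2 * b + 4 * q"
    proof -
      have "r * 1 \<le> r * r" using r0 by (intro mult_left_mono) auto
      then have rn: "r \<le> real n" using r2 by simp
      have "7 \<le> r * r" using n r2 by simp
      then have r3: "2 \<le> r" using r0 by (intro power2_le_imp_le[of 2 r]) (auto simp: power2_eq_square)
      have "2 * r \<le> real n" unfolding r2[symmetric] using r3 r0 by (intro mult_right_mono) auto
      then have 1: "1 + r \<le> real n" using r0 by linarith
      have "R * (1 + r) = 2 * b * (1 + r) + 2 * q * (r + real n)"
        using r2 by (simp add: R_def algebra_simps)
      also have "\<dots> \<le> 2 * b * real n + 2 * q * (real n + real n)"
        using 1 b0 q0 rn by (intro add_mono mult_left_mono) auto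
      also have "\<dots> = (2 * b + 4 * q) * real n" by (simp add: algebra_simps)
      finally show ?thesis using n0 by (simp add: field_simps)
    qed
    then have "q * (R / real n * (1 + r)) \<le> q * (2 * b + 4 * q)" using q0 by (intro mult_left_mono) auto
    moreover have "q * (R / real n + (a + b)) + R / real n * (r * q) = q * (a + b) + q * (R / real n * (1 + r))"
      by (simp add: algebra_simps add_divide_distrib)
    ultimately have "(\<Sum>i<n. (v i - w i) * e i) \<le> q * (a + b) + q * (2 * b + 4 * q)"
      using inner by linarith
    then have "2 * (\<Sum>i<n. (v i - w i) * e i) \<le> 2 * (q * (a + b) + q * (2 * b + 4 * q))"
      by (intro mult_left_mono) auto
    \<comment> \<open>Completing the square in \<open>a\<^sup>2 \<le> b\<^sup>2 + 2 * q * a + 6 * q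
      * b + 8 * q\<^sup>2\<close>; the constant 4 of the conclusion is \<open>1 + 3\<close>.\<close>
    then have "(a - q)\<^sup>2 \<le> (b + 3 * q)\<^sup>2" using basic by (simp add: power2_eq_square algebra_simps)
    then have "a - q \<le> b + 3 * q" using b0 q0 by (intro power2_le_imp_le[of "a - q" "b + 3 * q"]) auto
    then show "nrm n (\<lambda>i. v i - u i) \<le> nrm n (\<lambda>i. w i - u i) + 4 * sqrt S"
      by (simp add: a_def b_def q_def)
  qed
qed

subsection \<open>Exchanging a sample with a ghost sample\<close>

text \<open>The exponential moment of a random sign, in a form that follows from second order bounds
  on the unit interval. It is applied to one exchanged coordinate at a time.\<close>

lemma exp_plus_exp_minus_le:
  assumes "\<bar>x\<bar> \<le> (1 :: real)"
  shows "exp x + exp (- x) \<le> 2 * exp (x\<^sup>2)"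
proof -
  have *: "exp y + exp (- y) \<le> 2 + 2 * y\<^sup>2" if y: "0 \<le> y" "y \<le> 1" for y :: real
  proof -
    have "exp y \<le> 1 + y + y\<^sup>2" using y by (rule exp_bound)
    moreover have "exp (- y) \<le> 1 / (1 + y)"
      using y exp_ge_add_one_self[of y] by (simp add: exp_minus inverse_eq_divide divide_left_mono)
    moreover have "1 / (1 + y) \<le> 1 - y + y\<^sup>2"
    proof -
      have "1 \<le> (1 - y + y\<^sup>2) * (1 + y)" using y by (simp add: algebra_simps power2_eq_square)
      then show ?thesis using y by (simp add: pos_divide_le_eq)
    qed
    ultimately show ?thesis by linarith
  qed
  have "exp x + exp (- x) = exp \<bar>x\<bar> + exp (- \<bar>x\<bar>)" by (simp add: abs_if)
  also have "\<dots> \<le> 2 + 2 * x\<^sup>2" using *[of "\<bar>x\<bar>"] assms by simp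
  also have "\<dots> \<le> 2 * exp (x\<^sup>2)" using exp_ge_add_one_self[of "x\<^sup>2"] by linarith
  finally show ?thesis .
qed

text \<open>The total \<open>W\<close> of both halves is invariant under exchanges, so the event
  forces \<open>Q' S - Q S\<close> to exceed \<open>(W + 2 * m) / 3\<close>. The exponential moment
  of this difference is self-normalised: \<open>(D i)\<^sup>2 \<le> B * (p i + p' i)\<close> bounds
  the quadratic term by a multiple of the same \<open>W\<close>.\<close>

lemma card_swaps_le:
  fixes p p' :: "nat \<Rightarrow> real"
  assumes B: "B > 0" and p: "\<And>i. i < n \<Longrightarrow> 0 \<le> p i \<and> p i \<le> B" and p': "\<And>i. i < n \<Longrightarrow> 0 \<le> p' i \<and> p' i \<le> B"
  shows "real (card {S \<in> Pow {..<n}. (\<Sum>i<n. if i \<in> S then p i else p' i)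
            > 2 * (\<Sum>i<n. if i \<in> S then p' i else p i) + m})
         \<le> 2 ^ n * exp (- (2 * m / (9 * B)))" (is "real (card ?G) \<le> _")
proof -
  \<comment> \<open>With this choice the terms proportional to \<open>W\<close> cancel at the end.\<close>
  define l where "l = 1 / (3 * B)"
  have l: "l > 0" using B by (simp add: l_def)
  define W where "W = (\<Sum>i<n. p i + p' i)"
  define D where "D i = p' i - p i" for i
  define Q' where "Q' S = (\<Sum>i<n. if i \<in> S then p i else p' i)" for S
  define Q where "Q S = (\<Sum>i<n. if i \<in> S then p' i else p i)" for S
  have W: "Q S + Q' S = W" for S
    unfolding Q_def Q'_def W_def sum.distrib[symmetric] by (intro sum.cong) auto
  have 1: "1 \<le> exp (l * (Q' S - Q S)) * exp (- (l * ((W + 2 * m) / 3)))" if "S \<in> ?G" for S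
  proof -
    have "Q' S > 2 * Q S + m" using that by (auto simp: Q_def Q'_def)
    then have "W + 2 * m \<le> 3 * (Q' S - Q S)" unfolding W[of S, symmetric] by simp
    then have "(W + 2 * m) / 3 \<le> Q' S - Q S" by simp
    then have "l * ((W + 2 * m) / 3) \<le> l * (Q' S - Q S)" using l by (intro mult_left_mono) auto
    then show ?thesis by (simp flip: exp_add)
  qed
  have diff: "Q' S - Q S = (\<Sum>i\<in>S. - D i) + (\<Sum>i\<in>{..<n} - S. D i)" if S: "S \<in> Pow {..<n}" for S
  proof -
    have "Q' S - Q S = (\<Sum>i<n. if i \<in> S then - D i else D i)"
      unfolding Q_def Q'_def sum_subtractf[symmetric] D_def by (intro sum.cong) auto
    also have "\<dots> = (\<Sum>i\<in>{..<n} \<inter> {i. i \<in> S}. - D i) + (\<Sum>i\<in>{..<n} \<inter> - {i. i \<in> S}. D i)"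
      by (rule sum.If_cases) simp
    also have "{..<n} \<inter> {i. i \<in> S} = S" using S by auto
    also have "{..<n} \<inter> - {i. i \<in> S} = {..<n} - S" by auto
    finally show ?thesis .
  qed
  have fin: "finite S" if "S \<in> Pow {..<n}" for S using that finite_subset[of S "{..<n}"] by auto
  have "real (card ?G) = (\<Sum>S\<in>?G. 1)" by simp
  also have "\<dots> \<le> (\<Sum>S\<in>?G. exp (l * (Q' S - Q S)) * exp (- (l * ((W + 2 * m) / 3))))"
    by (intro sum_mono 1)
  also have "\<dots> \<le> (\<Sum>S\<in>Pow {..<n}. exp (l * (Q' S - Q S)) * exp (- (l * ((W + 2 * m) / 3))))"
    by (intro sum_mono2) auto
  also have "\<dots> = (\<Sum>S\<in>Pow {..<n}. exp (l * (Q' S - Q S))) * exp (- (l * ((W + 2 * m) / 3)))"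
    by (simp add: sum_distrib_right)
  also have "(\<Sum>S\<in>Pow {..<n}. exp (l * (Q' S - Q S)))
     = (\<Sum>S\<in>Pow {..<n}. (\<Prod>i\<in>S. exp (- (l * D i))) * (\<Prod>i\<in>{..<n} - S. exp (l * D i)))"
  proof (intro sum.cong refl)
    fix S assume S: "S \<in> Pow {..<n}"
    show "exp (l * (Q' S - Q S)) = (\<Prod>i\<in>S. exp (- (l * D i))) * (\<Prod>i\<in>{..<n} - S. exp (l * D i))"
      using fin[OF S] unfolding diff[OF S]
      by (simp add: exp_sum[symmetric] exp_add[symmetric] sum_distrib_left sum_negf algebra_simps)
  qed
  \<comment> \<open>The sum over all subsets is an expanded product, the counting form of
    independence of the exchanges.\<close>
  also have "\<dots> = (\<Prod>i<n. exp (- (l * D i)) + exp (l * D i))"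
    by (rule prod_add[symmetric]) simp
  also have "\<dots> \<le> (\<Prod>i<n. 2 * exp ((l * D i)\<^sup>2))"
  proof (intro prod_mono conjI)
    fix i assume "i \<in> {..<n}"
    then have "\<bar>D i\<bar> \<le> B" using p[of i] p'[of i] by (auto simp: D_def abs_le_iff)
    then have "\<bar>l * D i\<bar> \<le> 1" using B by (simp add: l_def abs_mult)
    from exp_plus_exp_minus_le[OF this]
    show "exp (- (l * D i)) + exp (l * D i) \<le> 2 * exp ((l * D i)\<^sup>2)" by (simp add: add.commute)
  qed (simp add: add_nonneg_nonneg)
  also have "\<dots> = 2 ^ n * exp (\<Sum>i<n. (l * D i)\<^sup>2)"
    by (simp add: prod.distrib exp_sum)
  also have "\<dots> \<le> 2 ^ n * exp (l\<^sup>2 * B * W)"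
  proof -
    have "(\<Sum>i<n. (l * D i)\<^sup>2) \<le> (\<Sum>i<n. l\<^sup>2 * B * (p i + p' i))"
    proof (rule sum_mono)
      fix i assume "i \<in> {..<n}"
      then have "\<bar>D i\<bar> \<le> B" "\<bar>D i\<bar> \<le> p i + p' i" using p[of i] p'[of i] by (auto simp: D_def abs_le_iff)
      then have "\<bar>D i\<bar> * \<bar>D i\<bar> \<le> B * (p i + p' i)" using B by (intro mult_mono) auto
      then have "(D i)\<^sup>2 \<le> B * (p i + p' i)" by (simp add: power2_eq_square)
      then have "l\<^sup>2 * (D i)\<^sup>2 \<le> l\<^sup>2 * (B * (p i + p' i))" by (intro mult_left_mono) auto
      then show "(l * D i)\<^sup>2 \<le> l\<^sup>2 * B * (p i + p' i)" by (simp add: power_mult_distrib mult.assoc)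
    qed
    also have "\<dots> = l\<^sup>2 * B * W" by (simp add: W_def sum_distrib_left)
    finally show ?thesis by simp
  qed
  finally have "real (card ?G) \<le> 2 ^ n * exp (l\<^sup>2 * B * W) * exp (- (l * ((W + 2 * m) / 3)))"
    by simp
  also have "\<dots> = 2 ^ n * exp (l\<^sup>2 * B * W - l * ((W + 2 * m) / 3))"
    by (simp add: exp_add[symmetric])
  also have "l\<^sup>2 * B * W - l * ((W + 2 * m) / 3) = - (2 * m / (9 * B))"
    using B by (simp add: l_def power2_eq_square field_simps)
  finally show ?thesis .
qed

text \<open>The pseudo-dimension is controlled only on samples of \<open>n\<close> points, so each
  half has its own net and the union bound runs over pairs of centres. Passing from \<open>f\<close>
  to the centres costs a factor two and \<open>16 * \<Gamma>\<^sup>2\<close> on each side. With the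
  factor two of \<open>card_swaps_le\<close> this makes 8, and the additive errors are absorbed by
  \<open>4 * m\<close> because \<open>m \<ge> 72 * \<Gamma>\<^sup>2\<close>.\<close>

lemma card_bad_swaps_le:
  fixes P :: "('a \<Rightarrow> real) set" and x x' :: "nat \<Rightarrow> 'a"
  assumes k: "covering_constant \<kappa>" and n: "n \<ge> 7" and D: "D \<ge> 1" and G: "\<Gamma> > 0" and t: "t > 0"
    and bd: "\<And>g i. g \<in> insert f0 P \<Longrightarrow> i < n \<Longrightarrow> \<bar>g (x i)\<bar> \<le> \<Gamma> \<and> \<bar>g (x' i)\<bar> \<le> \<Gamma>"
    and pd: "real (pdim n (traces n x P)) \<le> D" "real (pdim n (traces n x' P)) \<le> D"
    and m: "m = 18 * \<Gamma>\<^sup>2 * (4 * (\<kappa> * D * ln (real n)) + t)"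
  shows "real (card {S \<in> Pow {..<n}. \<exists>f\<in>P. (\<Sum>i<n. if i \<in> S then (f (x i) - f0 (x i))\<^sup>2 else (f (x' i) - f0 (x' i))\<^sup>2)
            > 8 * (\<Sum>i<n. if i \<in> S then (f (x' i) - f0 (x' i))\<^sup>2 else (f (x i) - f0 (x i))\<^sup>2) + 4 * m})
         \<le> 2 ^ n * exp (- t)" (is "real (card ?G) \<le> _")
proof -
  define y where "y = \<kappa> * D * ln (real n)"
  have y1: "1 \<le> y" unfolding y_def by (rule one_le_entropy[OF k n D])
  have n0: "real n > 0" using n by simp
  \<comment> \<open>The mesh is \<open>2 * \<Gamma>\<close> for the sum over the sample, not for its
    average. The total squared error is therefore of the size of a single summand, and the net still
    has at most \<open>exp (2 * y)\<close> elements.\<close>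
  have net: "\<exists>C. C \<subseteq> traces n z P \<and> finite C \<and> real (card C) \<le> exp (2 * y) \<and>
      (\<forall>f\<in>P. \<exists>c\<in>C. (\<Sum>i<n. (f (z i) - c i)\<^sup>2) \<le> 4 * \<Gamma>\<^sup>2)"
    if bd: "\<And>g i. g \<in> insert f0 P \<Longrightarrow> i < n \<Longrightarrow> \<bar>g (z i)\<bar> \<le> \<Gamma>"
      and pd: "real (pdim n (traces n z P)) \<le> D" for z :: "nat \<Rightarrow> 'a"
  proof -
    obtain C where C: "C \<subseteq> traces n z P" "finite C" "real (card C) \<le> exp (\<kappa> * D * (2 * ln (real n)))"
      "\<And>v. v \<in> traces n z P \<Longrightarrow> \<exists>c\<in>C. nrm n (\<lambda>i. v i - c i) \<le> 2 * \<Gamma>"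
    proof (rule internal_net[OF k _ pdim_at_most_pdim pd G, of "\<lambda>i. f0 (z i)" "2 * \<Gamma>" "2 * ln (real n)"])
      fix v i assume "v \<in> traces n z P" "i < n"
      then obtain g where "g \<in> P" "v i = g (z i)" by (auto simp: traces_def)
      then show "\<bar>v i - f0 (z i)\<bar> \<le> 2 * \<Gamma>" using bd[of g i] bd[of f0 i] \<open>i < n\<close> by auto
    next
      show "2 * \<Gamma> \<ge> 0" using G by simp
      have "2 * (2 * \<Gamma>) * sqrt (real n) / \<Gamma> = 4 * sqrt (real n)" using G by simp
      then have "ln (4 + 2 * (2 * \<Gamma>) * sqrt (real n) / \<Gamma>) = ln (4 + 4 * sqrt (real n))" by simp
      also have "\<dots> \<le> ln (real n ^ 2)"
      proof (rule ln_mono)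
        have "sqrt (real n) \<le> real n" using n by (intro real_le_lsqrt) (auto simp: power2_eq_square)
        moreover have "7 * real n \<le> real n * real n" using n by (intro mult_right_mono) auto
        ultimately show "4 + 4 * sqrt (real n) \<le> real n ^ 2" using n unfolding power2_eq_square by linarith
        show "0 < 4 + 4 * sqrt (real n)" by (rule add_pos_nonneg) auto
      qed
      also have "\<dots> = 2 * ln (real n)" using n0 by (simp add: ln_realpow)
      finally show "ln (4 + 2 * (2 * \<Gamma>) * sqrt (real n) / \<Gamma>) \<le> 2 * ln (real n)" .
    qed (rule that; blast)
    have "\<exists>c\<in>C. (\<Sum>i<n. (f (z i) - c i)\<^sup>2) \<le> 4 * \<Gamma>\<^sup>2" if f: "f \<in> P" for f
    proof -
      obtain c where c: "c \<in> C" "nrm n (\<lambda>i. (\<lambda>i\<in>{..<n}. f (z i)) i - c i) \<le> 2 * \<Gamma>"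
        using C(4)[of "\<lambda>i\<in>{..<n}. f (z i)"] f by (auto simp: traces_def)
      have "(nrm n (\<lambda>i. (\<lambda>i\<in>{..<n}. f (z i)) i - c i))\<^sup>2 \<le> (2 * \<Gamma>)\<^sup>2"
        using c(2) by (intro power_mono) auto
      then have "(\<Sum>i<n. (f (z i) - c i)\<^sup>2) \<le> 4 * \<Gamma>\<^sup>2" by (simp add: nrm_power2 power_mult_distrib)
      with c(1) show ?thesis by blast
    qed
    moreover have "\<kappa> * D * (2 * ln (real n)) = 2 * y" by (simp add: y_def)
    ultimately show ?thesis using C(1-3) by (intro exI[of _ C]) metis
  qed
  obtain C where C: "C \<subseteq> traces n x P" "finite C" "real (card C) \<le> exp (2 * y)"
      "\<And>f. f \<in> P \<Longrightarrow> \<exists>c\<in>C. (\<Sum>i<n. (f (x i) - c i)\<^sup>2) \<le> 4 * \<Gamma>\<^sup>2"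
    using net[OF _ pd(1)] bd by blast
  obtain C' where C': "C' \<subseteq> traces n x' P" "finite C'" "real (card C') \<le> exp (2 * y)"
      "\<And>f. f \<in> P \<Longrightarrow> \<exists>c\<in>C'. (\<Sum>i<n. (f (x' i) - c i)\<^sup>2) \<le> 4 * \<Gamma>\<^sup>2"
    using net[OF _ pd(2)] bd by blast
  define p where "p c i = (c i - f0 (x i))\<^sup>2" for c and i :: nat
  define p' where "p' c i = (c i - f0 (x' i))\<^sup>2" for c and i :: nat
  define F where "F c c' = {S \<in> Pow {..<n}. (\<Sum>i<n. if i \<in> S then p c i else p' c' i)
            > 2 * (\<Sum>i<n. if i \<in> S then p' c' i else p c i) + m}" for c c'
  have G2: "\<Gamma>\<^sup>2 > 0" using G by simp
  have sq: "a\<^sup>2 \<le> 4 * \<Gamma>\<^sup>2" if "\<bar>a\<bar> \<le> 2 * \<Gamma>" for a :: real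
    using power_mono[OF that, of 2] by (simp add: power_mult_distrib)
  have cardF: "real (card (F c c')) \<le> 2 ^ n * exp (- (4 * y + t))" if c: "c \<in> C" "c' \<in> C'" for c c'
  proof -
    have "real (card (F c c')) \<le> 2 ^ n * exp (- (2 * m / (9 * (4 * \<Gamma>\<^sup>2))))"
      unfolding F_def
    proof (rule card_swaps_le)
      fix i assume i: "i < n"
      obtain f where f: "f \<in> P" "c i = f (x i)" using c(1) C(1) i by (auto simp: traces_def)
      have "\<bar>c i - f0 (x i)\<bar> \<le> 2 * \<Gamma>" using bd[of f i] bd[of f0 i] f i by auto
      then show "0 \<le> p c i \<and> p c i \<le> 4 * \<Gamma>\<^sup>2" unfolding p_def using sq by auto
      obtain f where f: "f \<in> P" "c' i = f (x' i)" using c(2) C'(1) i by (auto simp: traces_def)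
      have "\<bar>c' i - f0 (x' i)\<bar> \<le> 2 * \<Gamma>" using bd[of f i] bd[of f0 i] f i by auto
      then show "0 \<le> p' c' i \<and> p' c' i \<le> 4 * \<Gamma>\<^sup>2" unfolding p'_def using sq by auto
    qed (use G2 in simp)
    \<comment> \<open>The factor 18 in \<open>m\<close> is chosen here: each pair of centres fails
      for a fraction \<open>exp (- (4 * y + t))\<close> of the exchanges, and there are at most
      \<open>exp (4 * y)\<close> pairs.\<close>
    also have "2 * m / (9 * (4 * \<Gamma>\<^sup>2)) = 4 * y + t" using G by (simp add: m y_def field_simps)
    finally show ?thesis .
  qed
  have half: "(a - b)\<^sup>2 \<le> 2 * (a' - b)\<^sup>2 + 2 * (a' - a)\<^sup>2" for a a' b :: real
  proof -
    have "0 \<le> ((a' - b) + (a' - a))\<^sup>2" by simp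
    then show ?thesis by (simp add: power2_eq_square algebra_simps)
  qed
  have if_le: "(c \<Longrightarrow> a \<le> 2 * b + 2 * d) \<Longrightarrow> (\<not> c \<Longrightarrow> a' \<le> 2 * b' + 2 * d) \<Longrightarrow>
      (if c then a else a') \<le> 2 * (if c then b else b') + 2 * d" for c and a a' b b' d :: real
    by (cases c) auto
  have "?G \<subseteq> (\<Union>(c, c')\<in>C \<times> C'. F c c')"
  proof
    fix S assume "S \<in> ?G"
    then obtain f where S: "S \<in> Pow {..<n}" and f: "f \<in> P"
      and gt: "(\<Sum>i<n. if i \<in> S then (f (x i) - f0 (x i))\<^sup>2 else (f (x' i) - f0 (x' i))\<^sup>2)
            > 8 * (\<Sum>i<n. if i \<in> S then (f (x' i) - f0 (x' i))\<^sup>2 else (f (x i) - f0 (x i))\<^sup>2) + 4 * m" by auto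
    obtain c where c: "c \<in> C" "(\<Sum>i<n. (f (x i) - c i)\<^sup>2) \<le> 4 * \<Gamma>\<^sup>2" using C(4)[OF f] by blast
    obtain c' where c': "c' \<in> C'" "(\<Sum>i<n. (f (x' i) - c' i)\<^sup>2) \<le> 4 * \<Gamma>\<^sup>2" using C'(4)[OF f] by blast
    define e where "e i = (f (x i) - c i)\<^sup>2 + (f (x' i) - c' i)\<^sup>2" for i
    have e: "(\<Sum>i<n. e i) \<le> 8 * \<Gamma>\<^sup>2" using c(2) c'(2) by (simp add: e_def sum.distrib)
    have "(\<Sum>i<n. if i \<in> S then (f (x i) - f0 (x i))\<^sup>2 else (f (x' i) - f0 (x' i))\<^sup>2)
        \<le> (\<Sum>i<n. 2 * (if i \<in> S then p c i else p' c' i) + 2 * e i)"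
    proof (rule sum_mono)
      fix i
      show "(if i \<in> S then (f (x i) - f0 (x i))\<^sup>2 else (f (x' i) - f0 (x' i))\<^sup>2)
        \<le> 2 * (if i \<in> S then p c i else p' c' i) + 2 * e i"
        using half[of "f (x i)" "f0 (x i)" "c i"] half[of "f (x' i)" "f0 (x' i)" "c' i"]
          zero_le_power2[of "f (x i) - c i"] zero_le_power2[of "f (x' i) - c' i"]
        unfolding p_def p'_def e_def power2_commute[of "c i" "f (x i)"] power2_commute[of "c' i" "f (x' i)"]
        by (intro if_le; simp only: distrib_left; linarith)
    qed
    also have "\<dots> = 2 * (\<Sum>i<n. if i \<in> S then p c i else p' c' i) + 2 * (\<Sum>i<n. e i)"
      by (simp add: sum.distrib sum_distrib_left)
    finally have 1: "(\<Sum>i<n. if i \<in> S then (f (x i) - f0 (x i))\<^sup>2 else (f (x' i) - f0 (x' i))\<^sup>2)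
      \<le> 2 * (\<Sum>i<n. if i \<in> S then p c i else p' c' i) + 16 * \<Gamma>\<^sup>2" using e by linarith
    have "(\<Sum>i<n. if i \<in> S then p' c' i else p c i)
        \<le> (\<Sum>i<n. 2 * (if i \<in> S then (f (x' i) - f0 (x' i))\<^sup>2 else (f (x i) - f0 (x i))\<^sup>2) + 2 * e i)"
    proof (rule sum_mono)
      fix i
      show "(if i \<in> S then p' c' i else p c i)
        \<le> 2 * (if i \<in> S then (f (x' i) - f0 (x' i))\<^sup>2 else (f (x i) - f0 (x i))\<^sup>2) + 2 * e i"
        using half[of "c i" "f0 (x i)" "f (x i)"] half[of "c' i" "f0 (x' i)" "f (x' i)"]
          zero_le_power2[of "f (x i) - c i"] zero_le_power2[of "f (x' i) - c' i"]
        unfolding p_def p'_def e_def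
        by (intro if_le; simp only: distrib_left; linarith)
    qed
    also have "\<dots> = 2 * (\<Sum>i<n. if i \<in> S then (f (x' i) - f0 (x' i))\<^sup>2 else (f (x i) - f0 (x i))\<^sup>2) + 2 * (\<Sum>i<n. e i)"
      by (simp add: sum.distrib sum_distrib_left)
    finally have 2: "(\<Sum>i<n. if i \<in> S then p' c' i else p c i)
      \<le> 2 * (\<Sum>i<n. if i \<in> S then (f (x' i) - f0 (x' i))\<^sup>2 else (f (x i) - f0 (x i))\<^sup>2) + 16 * \<Gamma>\<^sup>2"
      using e by linarith
    have "m \<ge> 18 * \<Gamma>\<^sup>2 * 4" unfolding m using y1 t G2
      by (intro mult_left_mono) (auto simp: y_def)
    then have "m \<ge> 72 * \<Gamma>\<^sup>2" by simp
    with 1 2 gt G2 have "(\<Sum>i<n. if i \<in> S then p c i else p' c' i)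
        > 2 * (\<Sum>i<n. if i \<in> S then p' c' i else p c i) + m" by linarith
    then have "S \<in> F c c'" using S unfolding F_def by simp
    with c c' show "S \<in> (\<Union>(c, c')\<in>C \<times> C'. F c c')" by auto
  qed
  then have "card ?G \<le> card (\<Union>(c, c')\<in>C \<times> C'. F c c')"
    by (intro card_mono finite_UN_I) (auto simp: C C' F_def)
  also have "\<dots> \<le> (\<Sum>(c, c')\<in>C \<times> C'. card (F c c'))"
    using card_UN_le[of "C \<times> C'" "\<lambda>(c, c'). F c c'"] C(2) C'(2) by (simp add: case_prod_beta)
  finally have "real (card ?G) \<le> (\<Sum>(c, c')\<in>C \<times> C'. real (card (F c c')))"
    by (simp add: case_prod_beta flip: of_nat_sum)
  also have "\<dots> \<le> (\<Sum>(c, c')\<in>C \<times> C'. 2 ^ n * exp (- (4 * y + t)))"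
    by (intro sum_mono) (use cardF in auto)
  also have "\<dots> = (real (card C) * real (card C')) * (2 ^ n * exp (- (4 * y + t)))"
    by (simp add: case_prod_beta card_cartesian_product)
  also have "\<dots> \<le> (exp (2 * y) * exp (2 * y)) * (2 ^ n * exp (- (4 * y + t)))"
    using C(3) C'(3) by (intro mult_right_mono mult_mono) auto
  also have "\<dots> = 2 ^ n * (exp (2 * y) * exp (2 * y) * exp (- (4 * y + t)))" by simp
  also have "exp (2 * y) * exp (2 * y) * exp (- (4 * y + t)) = exp (- t)" by (simp flip: exp_add)
  finally show ?thesis .
qed

text \<open>Both samples form one vector of length \<open>2 * n\<close>, with the ghost of point
  \<open>i\<close> at \<open>n + i\<close>. Exchanging them is then a permutation of the indices,
  under which the product measure is invariant.\<close>

definition swap :: "nat \<Rightarrow> nat set \<Rightarrow> nat \<Rightarrow> nat" where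
  "swap n S j = (if j < n then (if j \<in> S then n + j else j) else if j - n \<in> S then j - n else j)"

lemma swap_less: "j < 2 * n \<Longrightarrow> S \<subseteq> {..<n} \<Longrightarrow> swap n S j < 2 * n"
  by (auto simp: swap_def)

lemma inj_on_swap: "S \<subseteq> {..<n} \<Longrightarrow> inj_on (swap n S) {..<2 * n}"
  unfolding inj_on_def swap_def by (auto split: if_splits)

locale bounded_model =
  fixes \<nu> :: "'a measure" and n :: nat and P :: "('a \<Rightarrow> real) set" and f0 :: "'a \<Rightarrow> real"
    and \<kappa> D \<Gamma> :: real
  assumes nu: "prob_space \<nu>" and k: "covering_constant \<kappa>" and n: "n \<ge> 7" and D: "D \<ge> 1" and G: "\<Gamma> > 0"
    and meas: "\<And>g. g \<in> insert f0 P \<Longrightarrow> g \<in> borel_measurable \<nu>"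
    and bd: "\<And>g z. g \<in> insert f0 P \<Longrightarrow> z \<in> space \<nu> \<Longrightarrow> \<bar>g z\<bar> \<le> \<Gamma>"
    and pd: "AE x in PiM {..<n} (\<lambda>_. \<nu>). real (pdim n (traces n x P)) \<le> D"
begin

lemma sq_diff_bd:
  assumes "g \<in> insert f0 P" "z \<in> space \<nu>"
  shows "(g z - f0 z)\<^sup>2 \<le> 4 * \<Gamma>\<^sup>2"
proof -
  have "\<bar>g z - f0 z\<bar> \<le> 2 * \<Gamma>" using bd[OF assms] bd[of f0 z] assms(2) by auto
  from power_mono[OF this, of 2] show ?thesis by (simp add: power_mult_distrib)
qed

text \<open>
  Without joint measurability of \<open>E\<close> this fails: for a well-ordering of \<open>[0, 1]\<close> of type \<open>\<omega>\<^sub>1\<close>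
  under the continuum hypothesis, the indicators of final segments have pseudo-dimension one, and
  the segment beyond all sample points has full Lebesgue measure.
\<close>

lemma selector_deviation:
  fixes E :: "(nat \<Rightarrow> 'a) \<Rightarrow> 'a \<Rightarrow> real"
  assumes E: "(\<lambda>(x, z). E x z) \<in> borel_measurable (PiM {..<n} (\<lambda>_. \<nu>) \<Otimes>\<^sub>M \<nu>)"
    and EP: "AE x in PiM {..<n} (\<lambda>_. \<nu>). E x \<in> P"
    and t: "t > 0"
    and K: "K = 288 * \<Gamma>\<^sup>2 * (4 * (\<kappa> * D * ln (real n)) + t) / real n"
  shows "emeasure (PiM {..<n} (\<lambda>_. \<nu>)) {x \<in> space (PiM {..<n} (\<lambda>_. \<nu>)).
      cont_loss \<nu> (E x) f0 > 32 * disc_loss n x (E x) f0 + K} \<le> ennreal (2 * exp (- t))"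
proof -
  interpret nu: prob_space \<nu> by (rule nu)
  interpret product_prob_space "\<lambda>_. \<nu>" "UNIV :: nat set" by standard
  let ?X = "PiM {..<n} (\<lambda>_. \<nu>)" and ?Z = "PiM {..<2 * n} (\<lambda>_. \<nu>)" and ?Y = "PiM {n..<2 * n} (\<lambda>_. \<nu>)"
  interpret X: prob_space ?X by (rule prob_space_PiM) (rule nu)
  interpret Y: prob_space ?Y by (rule prob_space_PiM) (rule nu)
  interpret Z: prob_space ?Z by (rule prob_space_PiM) (rule nu)
  note [measurable] = E
  have [measurable]: "f0 \<in> borel_measurable \<nu>" using meas by simp
  define m where "m = 18 * \<Gamma>\<^sup>2 * (4 * (\<kappa> * D * ln (real n)) + t)"
  have "1 \<le> \<kappa> * D * ln (real n)" by (rule one_le_entropy[OF k n D])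
  then have m0: "m \<ge> 18 * \<Gamma>\<^sup>2 * 4" unfolding m_def using t by (intro mult_left_mono) auto
  have n0: "real n > 0" using n by simp
  have K': "K * real n = 16 * m" using n0 by (simp add: K m_def)
  define h where "h x z = (E x z - f0 z)\<^sup>2" for x z
  have hm[measurable]: "(\<lambda>(x, z). h x z) \<in> borel_measurable (?X \<Otimes>\<^sub>M \<nu>)" unfolding h_def by measurable
  define L where "L x = (\<integral>z. h x z \<partial>\<nu>)" for x
  have [measurable]: "L \<in> borel_measurable ?X" unfolding L_def by measurable
  \<comment> \<open>The set where \<open>E x \<in> P\<close> need not be measurable; a measurable
    null set containing its complement is removed instead.\<close>
  from AE_E[OF EP] obtain Q where Q: "{x \<in> space ?X. \<not> E x \<in> P} \<subseteq> Q" "emeasure ?X Q = 0" "Q \<in> sets ?X" .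
  note [measurable] = Q(3)
  define A where "A = {x \<in> space ?X. L x > 32 * ((\<Sum>i<n. h x (x i)) / real n) + K \<and> x \<notin> Q}"
  have A[measurable]: "A \<in> sets ?X" unfolding A_def by measurable
  have AP: "E x \<in> P" if "x \<in> A" for x using that Q(1) by (auto simp: A_def)
  have Asub: "A \<subseteq> space ?X" by (auto simp: A_def)
  \<comment> \<open>The selector sees only the first half, and its loss on the second half is too
    large. The thresholds 8 and \<open>4 * m\<close> are a quarter of 32 and
    \<open>16 * m = K * n\<close>.\<close>
  define A2 where "A2 = {z \<in> space ?Z. restrict z {..<n} \<in> A \<and>
      (\<Sum>i<n. h (restrict z {..<n}) (z (n + i))) > 8 * (\<Sum>i<n. h (restrict z {..<n}) (z i)) + 4 * m}"
  have restr[measurable]: "(\<lambda>z. restrict z {..<n}) \<in> measurable ?Z ?X"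
    by (rule measurable_restrict_subset) auto
  have comp: "(\<lambda>z. h (restrict z {..<n}) (z j)) \<in> borel_measurable ?Z" if "j < 2 * n" for j
  proof -
    have [measurable]: "(\<lambda>z. z j) \<in> measurable ?Z \<nu>" using that by auto
    have "(\<lambda>z. (restrict z {..<n}, z j)) \<in> measurable ?Z (?X \<Otimes>\<^sub>M \<nu>)" by measurable
    from measurable_compose[OF this hm] show ?thesis by simp
  qed
  have [measurable]: "(\<lambda>z. \<Sum>i<n. h (restrict z {..<n}) (z i)) \<in> borel_measurable ?Z"
    "(\<lambda>z. \<Sum>i<n. h (restrict z {..<n}) (z (n + i))) \<in> borel_measurable ?Z"
    by (auto intro!: borel_measurable_sum comp)
  have A2[measurable]: "A2 \<in> sets ?Z" unfolding A2_def by measurable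

  \<comment> \<open>For a fixed first half in \<open>A\<close>, the selected function is fixed and
    the ghost sum exceeds a quarter of its mean with probability at least one half.\<close>
  have ghost: "emeasure ?X A \<le> 2 * emeasure ?Z A2"
  proof -
    have sec: "ennreal (1 / 2) * indicator A x \<le> (\<integral>\<^sup>+x'. indicator A2 (merge {..<n} {n..<2 * n} (x, x')) \<partial>?Y)"
      if x: "x \<in> space ?X" for x
    proof (cases "x \<in> A")
      case True
      have Ex: "E x \<in> P" by (rule AP[OF True])
      have [measurable]: "h x \<in> borel_measurable \<nu>" using x by measurable
      have hb: "0 \<le> h x z" "z \<in> space \<nu> \<Longrightarrow> h x z \<le> 4 * \<Gamma>\<^sup>2" for z
        using sq_diff_bd[of "E x" z] Ex by (auto simp: h_def)
      have "L x * real n > (32 * ((\<Sum>i<n. h x (x i)) / real n) + K) * real n"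
        using True n0 by (simp add: A_def)
      then have big: "real n * L x > 32 * (\<Sum>i<n. h x (x i)) + 16 * m"
        using n0 K' by (simp add: algebra_simps)
      have sum0: "0 \<le> (\<Sum>i<n. h x (x i))" by (intro sum_nonneg hb)
      define low where "low = {x' \<in> space ?Y. (\<Sum>i\<in>{n..<2 * n}. h x (x' i)) \<le> real n * L x / 4}"
      have sm: "(\<lambda>x'. \<Sum>i\<in>{n..<2 * n}. h x (x' i)) \<in> borel_measurable ?Y"
      proof (rule borel_measurable_sum)
        fix i assume "i \<in> {n..<2 * n}"
        then have [measurable]: "(\<lambda>x. x i) \<in> measurable ?Y \<nu>" by auto
        show "(\<lambda>x'. h x (x' i)) \<in> borel_measurable ?Y" by measurable
      qed
      have lowm[measurable]: "low \<in> sets ?Y" unfolding low_def using sm by measurable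
      \<comment> \<open>The lower tail needs a mean of at least four times the range
        \<open>4 * \<Gamma>\<^sup>2\<close>; the term \<open>16 * m\<close> in the definition of
        \<open>A\<close> guarantees this.\<close>
      have "4 * (4 * \<Gamma>\<^sup>2) \<le> real n * L x"
        using big m0 sum0 zero_le_power2[of \<Gamma>] by linarith
      then have "emeasure ?Y low \<le> ennreal (1 / 2)"
        using sum_lower_tail[of \<nu> "h x" "4 * \<Gamma>\<^sup>2" "{n..<2 * n}"] hb G nu
        by (simp add: L_def low_def)
      then have "measure ?Y low \<le> 1 / 2"
        unfolding Y.emeasure_eq_measure by (subst (asm) ennreal_le_iff) auto
      then have "1 / 2 \<le> measure ?Y (space ?Y - low)" by (subst Y.prob_compl) auto
      then have "ennreal (1 / 2) \<le> emeasure ?Y (space ?Y - low)"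
        unfolding Y.emeasure_eq_measure by (rule ennreal_leI)
      also have "\<dots> = (\<integral>\<^sup>+x'. indicator (space ?Y - low) x' \<partial>?Y)" by simp
      also have "\<dots> \<le> (\<integral>\<^sup>+x'. indicator A2 (merge {..<n} {n..<2 * n} (x, x')) \<partial>?Y)"
      proof (rule nn_integral_mono)
        fix x' assume x': "x' \<in> space ?Y"
        let ?z = "merge {..<n} {n..<2 * n} (x, x')"
        have "?z \<in> A2" if "x' \<notin> low"
        proof -
          have "?z \<in> space (PiM ({..<n} \<union> {n..<2 * n}) (\<lambda>_. \<nu>))"
            using x x' by (intro measurable_space[OF measurable_merge]) (auto simp: space_pair_measure)
          moreover have un: "{..<n} \<union> {n..<2 * n} = {..<2 * n}" by auto
          ultimately have sp: "?z \<in> space ?Z" by simp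
          have r: "restrict ?z {..<n} = x"
            using x by (auto simp: restrict_def merge_def space_PiM PiE_def extensional_def fun_eq_iff)
          have "(\<Sum>i<n. h x (?z i)) = (\<Sum>i<n. h x (x i))" by (intro sum.cong) (auto simp: merge_def)
          moreover have "(\<Sum>i<n. h x (?z (n + i))) = (\<Sum>i\<in>{n..<2 * n}. h x (x' i))"
            by (rule sum.reindex_bij_witness[of _ "\<lambda>j. j - n" "\<lambda>i. n + i"]) (auto simp: merge_def)
          moreover have "(\<Sum>i\<in>{n..<2 * n}. h x (x' i)) > real n * L x / 4"
            using that x' by (auto simp: low_def not_le)
          moreover have "real n * L x / 4 > 8 * (\<Sum>i<n. h x (x i)) + 4 * m" using big by simp
          ultimately show ?thesis using sp True unfolding A2_def by (simp add: r)
        qed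
        then show "indicator (space ?Y - low) x' \<le> (indicator A2 ?z :: ennreal)"
          by (auto simp: indicator_def)
      qed
      finally show ?thesis using True by simp
    qed simp
    have "ennreal (1 / 2) * emeasure ?X A = (\<integral>\<^sup>+x. ennreal (1 / 2) * indicator A x \<partial>?X)"
      by (simp add: nn_integral_cmult)
    also have "\<dots> \<le> (\<integral>\<^sup>+x. (\<integral>\<^sup>+x'. indicator A2 (merge {..<n} {n..<2 * n} (x, x')) \<partial>?Y) \<partial>?X)"
      by (intro nn_integral_mono sec)
    also have "\<dots> = (\<integral>\<^sup>+z. indicator A2 z \<partial>PiM ({..<n} \<union> {n..<2 * n}) (\<lambda>_. \<nu>))"
    proof (rule product_nn_integral_fold[symmetric])
      have un: "{..<n} \<union> {n..<2 * n} = {..<2 * n}" by auto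
      show "indicator A2 \<in> borel_measurable (PiM ({..<n} \<union> {n..<2 * n}) (\<lambda>_. \<nu>))"
        unfolding un by measurable
    qed auto
    also have "{..<n} \<union> {n..<2 * n} = {..<2 * n}" by auto
    finally have *: "ennreal (1 / 2) * emeasure ?X A \<le> emeasure ?Z A2" by simp
    have "emeasure ?X A = 2 * (ennreal (1 / 2) * emeasure ?X A)"
    proof -
      have "ennreal 2 * ennreal (1 / 2) = ennreal (2 * (1 / 2))" by (rule ennreal_mult'[symmetric]) simp
      then have "2 * ennreal (1 / 2) = 1" by (simp only: ennreal_numeral) simp
      then show ?thesis by (simp flip: mult.assoc)
    qed
    also have "\<dots> \<le> 2 * emeasure ?Z A2" by (intro mult_left_mono *) auto
    finally show ?thesis .
  qed

  define T where "T S z = (\<lambda>j\<in>{..<2 * n}. z (swap n S j))" for S and z :: "nat \<Rightarrow> 'a"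
  have distr_T: "distr ?Z ?Z (T S) = ?Z" if "S \<subseteq> {..<n}" for S
    unfolding T_def using that
    by (intro distr_PiM_reindex inj_on_swap) (auto intro: nu simp: swap_less)
  have T_meas[measurable]: "T S \<in> measurable ?Z ?Z" if "S \<subseteq> {..<n}" for S
    unfolding T_def
  proof (rule measurable_restrict)
    fix j assume "j \<in> {..<2 * n}"
    then show "(\<lambda>z. z (swap n S j)) \<in> measurable ?Z \<nu>"
      using swap_less[OF _ that] by (intro measurable_component_singleton) auto
  qed
  have pdZ1: "AE z in ?Z. real (pdim n (traces n (\<lambda>i\<in>{..<n}. z i) P)) \<le> D"
  proof (rule AE_distrD[of "\<lambda>z. \<lambda>i\<in>{..<n}. z i"])
    show "(\<lambda>z. \<lambda>i\<in>{..<n}. z i) \<in> measurable ?Z ?X" by (rule measurable_restrict) auto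
    have *: "distr ?Z ?X (\<lambda>z. \<lambda>i\<in>{..<n}. z i) = ?X"
      by (rule distr_PiM_reindex[of _ "\<lambda>_. \<nu>" "\<lambda>i. i"]) (auto intro: nu)
    show "AE x in distr ?Z ?X (\<lambda>z. \<lambda>i\<in>{..<n}. z i). real (pdim n (traces n x P)) \<le> D"
      by (subst *) (rule pd)
  qed
  have pdZ2: "AE z in ?Z. real (pdim n (traces n (\<lambda>i\<in>{..<n}. z (n + i)) P)) \<le> D"
  proof (rule AE_distrD[of "\<lambda>z. \<lambda>i\<in>{..<n}. z (n + i)"])
    show "(\<lambda>z. \<lambda>i\<in>{..<n}. z (n + i)) \<in> measurable ?Z ?X" by (rule measurable_restrict) auto
    have *: "distr ?Z ?X (\<lambda>z. \<lambda>i\<in>{..<n}. z (n + i)) = ?X"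
      by (rule distr_PiM_reindex[of _ "\<lambda>_. \<nu>" "\<lambda>i. n + i"]) (auto intro: nu)
    show "AE x in distr ?Z ?X (\<lambda>z. \<lambda>i\<in>{..<n}. z (n + i)). real (pdim n (traces n x P)) \<le> D"
      by (subst *) (rule pd)
  qed
  have tr: "traces n (\<lambda>i\<in>{..<n}. z i) P = traces n z P" for z
    by (auto simp: traces_def fun_eq_iff intro!: image_cong)
  \<comment> \<open>For fixed data the selector depends on the exchange, but only the membership of
    its values in \<open>P\<close> matters. The exchanges leading into \<open>A2\<close> are thus
    among those that are bad for some \<open>f \<in> P\<close>, and the bound is a plain
    cardinality. The pseudo-dimension is required only on the two original halves.\<close>
  have swaps: "AE z in ?Z. (\<Sum>S\<in>Pow {..<n}. indicator A2 (T S z)) \<le> ennreal (2 ^ n * exp (- t))"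
    using pdZ1 pdZ2 AE_space
  proof eventually_elim
    fix z assume pz: "real (pdim n (traces n (\<lambda>i\<in>{..<n}. z i) P)) \<le> D"
      "real (pdim n (traces n (\<lambda>i\<in>{..<n}. z (n + i)) P)) \<le> D" and z: "z \<in> space ?Z"
    have zsp: "z i \<in> space \<nu>" if "i < 2 * n" for i using z that by (auto simp: space_PiM)
    let ?H = "{S \<in> Pow {..<n}. \<exists>f\<in>P. (\<Sum>i<n. if i \<in> S then (f (z i) - f0 (z i))\<^sup>2 else (f (z (n + i)) - f0 (z (n + i)))\<^sup>2)
            > 8 * (\<Sum>i<n. if i \<in> S then (f (z (n + i)) - f0 (z (n + i)))\<^sup>2 else (f (z i) - f0 (z i))\<^sup>2) + 4 * m}"
    have "{S \<in> Pow {..<n}. T S z \<in> A2} \<subseteq> ?H"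
    proof safe
      fix S assume S: "T S z \<in> A2" "S \<subseteq> {..<n}"
      define f where "f = E (restrict (T S z) {..<n})"
      have f: "f \<in> P" using S AP by (auto simp: A2_def f_def)
      have gt: "(\<Sum>i<n. (f (T S z (n + i)) - f0 (T S z (n + i)))\<^sup>2) > 8 * (\<Sum>i<n. (f (T S z i) - f0 (T S z i))\<^sup>2) + 4 * m"
        using S(1) by (simp add: A2_def h_def f_def)
      have "(\<Sum>i<n. (f (T S z (n + i)) - f0 (T S z (n + i)))\<^sup>2)
         = (\<Sum>i<n. if i \<in> S then (f (z i) - f0 (z i))\<^sup>2 else (f (z (n + i)) - f0 (z (n + i)))\<^sup>2)"
        by (intro sum.cong) (auto simp: T_def swap_def)
      moreover have "(\<Sum>i<n. (f (T S z i) - f0 (T S z i))\<^sup>2)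
         = (\<Sum>i<n. if i \<in> S then (f (z (n + i)) - f0 (z (n + i)))\<^sup>2 else (f (z i) - f0 (z i))\<^sup>2)"
        by (intro sum.cong) (auto simp: T_def swap_def)
      ultimately show "\<exists>f\<in>P. (\<Sum>i<n. if i \<in> S then (f (z i) - f0 (z i))\<^sup>2 else (f (z (n + i)) - f0 (z (n + i)))\<^sup>2)
            > 8 * (\<Sum>i<n. if i \<in> S then (f (z (n + i)) - f0 (z (n + i)))\<^sup>2 else (f (z i) - f0 (z i))\<^sup>2) + 4 * m"
        using gt f by auto
    qed
    then have "real (card {S \<in> Pow {..<n}. T S z \<in> A2}) \<le> real (card ?H)"
      by (intro of_nat_mono card_mono) auto
    also have "\<dots> \<le> 2 ^ n * exp (- t)"
    proof (rule card_bad_swaps_le[OF k n D G t, of f0 P z "\<lambda>i. z (n + i)" m])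
      fix g i assume "g \<in> insert f0 P" "i < n"
      then show "\<bar>g (z i)\<bar> \<le> \<Gamma> \<and> \<bar>g (z (n + i))\<bar> \<le> \<Gamma>" using bd zsp by auto
    next
      show "real (pdim n (traces n z P)) \<le> D" using pz(1) tr by simp
      show "real (pdim n (traces n (\<lambda>i. z (n + i)) P)) \<le> D" using pz(2) tr[of "\<lambda>i. z (n + i)"] by simp
      show "m = 18 * \<Gamma>\<^sup>2 * (4 * (\<kappa> * D * ln (real n)) + t)" by (rule m_def)
    qed
    finally have "ennreal (real (card {S \<in> Pow {..<n}. T S z \<in> A2})) \<le> ennreal (2 ^ n * exp (- t))"
      by (rule ennreal_leI)
    moreover have "(\<Sum>S\<in>Pow {..<n}. indicator A2 (T S z)) = (of_nat (card {S \<in> Pow {..<n}. T S z \<in> A2}) :: ennreal)"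
    proof -
      have "(\<Sum>S\<in>Pow {..<n}. indicator A2 (T S z)) = (\<Sum>S\<in>Pow {..<n}. if T S z \<in> A2 then 1 else 0 :: ennreal)"
        by (intro sum.cong) (auto simp: indicator_def)
      also have "\<dots> = of_nat (card {S \<in> Pow {..<n}. T S z \<in> A2})"
        by (subst sum.inter_filter[symmetric]) auto
      finally show ?thesis .
    qed
    ultimately show "(\<Sum>S\<in>Pow {..<n}. indicator A2 (T S z)) \<le> ennreal (2 ^ n * exp (- t))"
      by (simp add: ennreal_of_nat_eq_real_of_nat)
  qed
  \<comment> \<open>By invariance the measure of \<open>A2\<close> is the average over all exchanges
    of the measures of its preimages; integrating the pointwise count bounds it.\<close>
  have "ennreal (2 ^ n) * emeasure ?Z A2 = (\<Sum>S\<in>Pow {..<n}. emeasure ?Z A2)"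
    by (simp add: card_Pow flip: ennreal_power)
  also have "\<dots> = (\<Sum>S\<in>Pow {..<n}. \<integral>\<^sup>+z. indicator A2 (T S z) \<partial>?Z)"
  proof (intro sum.cong refl)
    fix S assume "S \<in> Pow {..<n}"
    then have S: "S \<subseteq> {..<n}" by simp
    have "emeasure ?Z A2 = (\<integral>\<^sup>+z. indicator A2 z \<partial>distr ?Z ?Z (T S))" using distr_T[OF S] by simp
    also have "\<dots> = (\<integral>\<^sup>+z. indicator A2 (T S z) \<partial>?Z)"
      using S by (intro nn_integral_distr) auto
    finally show "emeasure ?Z A2 = (\<integral>\<^sup>+z. indicator A2 (T S z) \<partial>?Z)" .
  qed
  also have "\<dots> = (\<integral>\<^sup>+z. (\<Sum>S\<in>Pow {..<n}. indicator A2 (T S z)) \<partial>?Z)"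
  proof (rule nn_integral_sum[symmetric])
    fix S assume "S \<in> Pow {..<n}"
    then have [measurable]: "T S \<in> measurable ?Z ?Z" by (intro T_meas) simp
    show "(\<lambda>z. indicator A2 (T S z)) \<in> borel_measurable ?Z" by measurable
  qed
  also have "\<dots> \<le> (\<integral>\<^sup>+z. ennreal (2 ^ n * exp (- t)) \<partial>?Z)" by (intro nn_integral_mono_AE swaps)
  also have "\<dots> = ennreal (2 ^ n) * ennreal (exp (- t))"
    by (simp add: Z.emeasure_space_1 ennreal_mult')
  finally have "emeasure ?Z A2 \<le> ennreal (exp (- t))"
    by (subst (asm) ennreal_mult_le_mult_iff) auto
  then have "2 * emeasure ?Z A2 \<le> 2 * ennreal (exp (- t))" by (intro mult_left_mono) auto
  also have "\<dots> = ennreal (2 * exp (- t))" by (simp add: ennreal_mult')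
  finally have "emeasure ?X A \<le> ennreal (2 * exp (- t))" using ghost by (rule order_trans[rotated])
  moreover have "emeasure ?X {x \<in> space ?X. cont_loss \<nu> (E x) f0 > 32 * disc_loss n x (E x) f0 + K} \<le> emeasure ?X (A \<union> Q)"
    by (rule emeasure_mono) (auto simp: A_def cont_loss_def disc_loss_def L_def h_def)
  moreover have "emeasure ?X (A \<union> Q) = emeasure ?X A"
    using Q by (intro emeasure_Un_null_set) auto
  ultimately show ?thesis by simp
qed

end

subsection \<open>The regression model\<close>

text \<open>The estimator is a function of design and noise instead of design and response. These
  two are independent, so either can be frozen without changing the law of the other. The
  minimisation is stated for sums, which have the same minimisers as the averages.\<close>

locale regression =
  fixes \<nu> :: "'a measure" and N :: "real measure" and n :: nat and P :: "('a \<Rightarrow> real) set"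
    and f0 :: "'a \<Rightarrow> real" and \<kappa> D \<sigma> :: real
    and F :: "(nat \<Rightarrow> 'a) \<Rightarrow> (nat \<Rightarrow> real) \<Rightarrow> 'a \<Rightarrow> real"
  assumes nu: "prob_space \<nu>" and N: "prob_space N" and sets_N: "sets N = sets borel"
    and sub: "\<And>t. (\<integral>\<^sup>+y. ennreal (exp (t * y)) \<partial>N) \<le> ennreal (exp (\<sigma>\<^sup>2 * t\<^sup>2 / 2))"
    and \<sigma>: "\<sigma> > 0" and k: "covering_constant \<kappa>" and n: "n \<ge> 7" and D: "D \<ge> 1"
    and l2: "insert f0 P \<subseteq> l2 \<nu>"
    and pd: "AE x in PiM {..<n} (\<lambda>_. \<nu>). real (pdim n (traces n x P)) \<le> D"
    and F_meas: "(\<lambda>((x, e), z). F x e z) \<in> borel_measurable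
      ((PiM {..<n} (\<lambda>_. \<nu>) \<Otimes>\<^sub>M PiM {..<n} (\<lambda>_. N)) \<Otimes>\<^sub>M \<nu>)"
    and F_argmin: "AE (x, e) in PiM {..<n} (\<lambda>_. \<nu>) \<Otimes>\<^sub>M PiM {..<n} (\<lambda>_. N). F x e \<in> P \<and>
      (\<forall>g\<in>P. (\<Sum>i<n. (f0 (x i) + e i - F x e (x i))\<^sup>2) \<le> (\<Sum>i<n. (f0 (x i) + e i - g (x i))\<^sup>2))"
begin

abbreviation "\<X> \<equiv> PiM {..<n} (\<lambda>_. \<nu>)"
abbreviation "\<E> \<equiv> PiM {..<n} (\<lambda>_. N)"
abbreviation "\<Z> \<equiv> \<X> \<Otimes>\<^sub>M \<E>"

definition "H = \<kappa> * D * ln (real n)"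
definition "Ld z = disc_loss n (fst z) (F (fst z) (snd z)) f0"
definition "Lc z = cont_loss \<nu> (F (fst z) (snd z)) f0"

sublocale nu: prob_space \<nu> by (rule nu)
sublocale X: prob_space \<X> by (rule prob_space_PiM) (rule nu)
sublocale E: prob_space \<E> by (rule prob_space_PiM) (rule N)
sublocale XE: pair_prob_space \<X> \<E> ..

lemma f0_meas[measurable]: "f0 \<in> borel_measurable \<nu>"
  using l2 by (auto simp: l2_def)

lemma P_meas: "g \<in> P \<Longrightarrow> g \<in> borel_measurable \<nu>"
  using l2 by (auto simp: l2_def)

lemma H_ge_1: "H \<ge> 1"
  unfolding H_def by (rule one_le_entropy[OF k n D])

lemma n_pos: "real n > 0" using n by simp

lemma Ld_meas[measurable]: "Ld \<in> borel_measurable \<Z>"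
proof -
  have "(\<lambda>z. (F (fst z) (snd z) (fst z i) - f0 (fst z i))\<^sup>2) \<in> borel_measurable \<Z>" if "i < n" for i
  proof -
    have [measurable]: "(\<lambda>z. fst z i) \<in> measurable \<Z> \<nu>"
      using that by (intro measurable_compose[OF measurable_fst]) auto
    have "(\<lambda>z. (z, fst z i)) \<in> measurable \<Z> (\<Z> \<Otimes>\<^sub>M \<nu>)" by measurable
    from measurable_compose[OF this F_meas]
    have [measurable]: "(\<lambda>z. F (fst z) (snd z) (fst z i)) \<in> borel_measurable \<Z>"
      by (simp add: case_prod_beta)
    show ?thesis by measurable
  qed
  then show ?thesis
    unfolding Ld_def disc_loss_def by (intro borel_measurable_divide borel_measurable_sum) auto
qed

lemma Lc_meas[measurable]: "Lc \<in> borel_measurable \<Z>"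
proof -
  have [measurable]: "(\<lambda>(z, u). F (fst z) (snd z) u) \<in> borel_measurable (\<Z> \<Otimes>\<^sub>M \<nu>)"
    using F_meas by (simp add: case_prod_unfold)
  show ?thesis unfolding Lc_def cont_loss_def by measurable
qed

lemma disc_loss_measurable_design:
  assumes "g \<in> P"
  shows "(\<lambda>x. disc_loss n x f0 g) \<in> borel_measurable \<X>"
  unfolding disc_loss_def
proof (intro borel_measurable_divide borel_measurable_sum)
  have [measurable]: "g \<in> borel_measurable \<nu>" by (rule P_meas[OF assms])
  fix i assume "i \<in> {..<n}"
  then have [measurable]: "(\<lambda>x. x i) \<in> measurable \<X> \<nu>" by auto
  show "(\<lambda>x. (f0 (x i) - g (x i))\<^sup>2) \<in> borel_measurable \<X>" by measurable
qed auto

lemma disc_loss_measurable: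
  assumes "g \<in> P"
  shows "(\<lambda>z. disc_loss n (fst z) f0 g) \<in> borel_measurable \<Z>"
  by (rule measurable_compose[OF measurable_fst disc_loss_measurable_design[OF assms]])

lemma disc_loss_nonneg: "0 \<le> disc_loss n x f g"
  by (simp add: disc_loss_def sum_nonneg)

text \<open>The exceptional set of designs depends neither on \<open>g\<close> nor on
  \<open>s\<close>. This allows a comparison function chosen after the design, although
  \<open>P\<close> may be uncountable. The constants come from
  \<open>(b + 4 * sqrt S)\<^sup>2 \<le> 2 * b\<^sup>2 + 32 * S\<close> and the value of
  \<open>S\<close>.\<close>

lemma disc_loss_conditional_tail:
  "AE x in \<X>. \<forall>g\<in>P. \<forall>s>0. emeasure \<E> {e \<in> space \<E>. Ld (x, e) > 2 * disc_loss n x f0 g + (256 * \<sigma>\<^sup>2 * H + 64 * \<sigma>\<^sup>2 * s) / real n}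
     \<le> ennreal (exp (- s))"
  using XE.AE_pair[OF F_argmin] pd AE_space
proof eventually_elim
  fix x assume ae: "AE e in \<E>. case (x, e) of (x, e) \<Rightarrow> F x e \<in> P \<and>
      (\<forall>g\<in>P. (\<Sum>i<n. (f0 (x i) + e i - F x e (x i))\<^sup>2) \<le> (\<Sum>i<n. (f0 (x i) + e i - g (x i))\<^sup>2))"
    and px: "real (pdim n (traces n x P)) \<le> D" and x: "x \<in> space \<X>"
  show "\<forall>g\<in>P. \<forall>s>0. emeasure \<E> {e \<in> space \<E>. Ld (x, e) > 2 * disc_loss n x f0 g + (256 * \<sigma>\<^sup>2 * H + 64 * \<sigma>\<^sup>2 * s) / real n}
     \<le> ennreal (exp (- s))"
  proof (intro ballI allI impI)
    fix g and s :: real assume g: "g \<in> P" and s: "s > 0"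
    define S where "S = 2 * \<sigma>\<^sup>2 * (4 * (\<kappa> * D * ln (real n)) + s)"
    have S0: "S \<ge> 0" using H_ge_1 s by (simp add: S_def H_def)
    have w: "(\<lambda>i\<in>{..<n}. g (x i)) \<in> traces n x P" using g by (auto simp: traces_def)
    obtain A where A: "A \<in> sets \<E>" "emeasure \<E> A \<le> ennreal (exp (- s))"
      "\<And>e v. e \<in> space \<E> \<Longrightarrow> e \<notin> A \<Longrightarrow> v \<in> traces n x P \<Longrightarrow>
        (\<Sum>i<n. (f0 (x i) + e i - v i)\<^sup>2) \<le> (\<Sum>i<n. (f0 (x i) + e i - (\<lambda>i\<in>{..<n}. g (x i)) i)\<^sup>2) \<Longrightarrow>
        nrm n (\<lambda>i. v i - f0 (x i)) \<le> nrm n (\<lambda>i. (\<lambda>i\<in>{..<n}. g (x i)) i - f0 (x i)) + 4 * sqrt S"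
      by (rule least_squares_deviation[OF N sets_N sub \<sigma> k n pdim_at_most_pdim px D w s S_def,
          of "\<lambda>i. f0 (x i)"]) (rule that; assumption)
    from AE_E[OF ae] obtain Q where Q: "{e \<in> space \<E>. \<not> (case (x, e) of (x, e) \<Rightarrow> F x e \<in> P \<and>
      (\<forall>g\<in>P. (\<Sum>i<n. (f0 (x i) + e i - F x e (x i))\<^sup>2) \<le> (\<Sum>i<n. (f0 (x i) + e i - g (x i))\<^sup>2)))} \<subseteq> Q"
      "emeasure \<E> Q = 0" "Q \<in> sets \<E>" .
    have "{e \<in> space \<E>. Ld (x, e) > 2 * disc_loss n x f0 g + (256 * \<sigma>\<^sup>2 * H + 64 * \<sigma>\<^sup>2 * s) / real n} \<subseteq> A \<union> Q"
    proof (rule subsetI, rule ccontr)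
      fix e assume e: "e \<in> {e \<in> space \<E>. Ld (x, e) > 2 * disc_loss n x f0 g + (256 * \<sigma>\<^sup>2 * H + 64 * \<sigma>\<^sup>2 * s) / real n}"
        and "e \<notin> A \<union> Q"
      then have eA: "e \<notin> A" and eQ: "F x e \<in> P"
        "(\<Sum>i<n. (f0 (x i) + e i - F x e (x i))\<^sup>2) \<le> (\<Sum>i<n. (f0 (x i) + e i - g (x i))\<^sup>2)"
        using Q(1) g by auto
      define a where "a = nrm n (\<lambda>i. F x e (x i) - f0 (x i))"
      define b where "b = nrm n (\<lambda>i. f0 (x i) - g (x i))"
      have "a \<le> b + 4 * sqrt S"
        using A(3)[of e "\<lambda>i\<in>{..<n}. F x e (x i)"] eA e eQ
        by (auto simp: traces_def a_def b_def L2_set_def power2_commute[of "g _"])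
      then have "a\<^sup>2 \<le> (b + 4 * sqrt S)\<^sup>2" by (intro power_mono) (auto simp: a_def)
      also have "\<dots> \<le> 2 * b\<^sup>2 + 32 * S"
      proof -
        have "0 \<le> (b - 4 * sqrt S)\<^sup>2" by simp
        then show ?thesis using S0 by (simp add: power2_sum power2_diff power_mult_distrib)
      qed
      finally have "a\<^sup>2 / real n \<le> (2 * b\<^sup>2 + 32 * S) / real n" by (intro divide_right_mono) auto
      also have "\<dots> = 2 * (b\<^sup>2 / real n) + (256 * \<sigma>\<^sup>2 * H + 64 * \<sigma>\<^sup>2 * s) / real n"
        by (simp add: S_def H_def algebra_simps add_divide_distrib)
      finally show False using e
        by (simp add: Ld_def disc_loss_def a_def b_def nrm_power2)
    qed
    then have "emeasure \<E> {e \<in> space \<E>. Ld (x, e) > 2 * disc_loss n x f0 g + (256 * \<sigma>\<^sup>2 * H + 64 * \<sigma>\<^sup>2 * s) / real n}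
        \<le> emeasure \<E> (A \<union> Q)" using A(1) Q(3) by (intro emeasure_mono) auto
    also have "\<dots> = emeasure \<E> A" using A(1) Q by (intro emeasure_Un_null_set) auto
    finally show "emeasure \<E> {e \<in> space \<E>. Ld (x, e) > 2 * disc_loss n x f0 g + (256 * \<sigma>\<^sup>2 * H + 64 * \<sigma>\<^sup>2 * s) / real n}
     \<le> ennreal (exp (- s))" using A(2) by simp
  qed
qed

text \<open>The estimator lies in \<open>P\<close> almost surely and a probability measure is not
  null. Without this the real infima over \<open>P\<close> would have no meaning.\<close>

lemma P_nonempty: "P \<noteq> {}"
proof
  assume "P = {}"
  then have "AE z in \<Z>. False" using F_argmin by (auto simp: case_prod_beta)
  then show False using XE.AE_const by simp
qed

text \<open>On a fixed design the tail bound is applied to a near-minimiser for that design, and the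
  slack is removed by continuity of the measure. Only then are the fibres assembled, so no
  measurable choice of near-minimisers is involved.\<close>

lemma disc_loss_bound_INF:
  assumes s: "s > 0"
  shows "outer_measure_of \<Z> {z \<in> space \<Z>. Ld z > 2 * (INF g\<in>P. disc_loss n (fst z) f0 g) + (256 * \<sigma>\<^sup>2 * H + 64 * \<sigma>\<^sup>2 * s) / real n}
     \<le> ennreal (exp (- s))"
proof (rule outer_measure_of_fibrewise[OF X.prob_space_axioms E.prob_space_axioms Ld_meas])
  show "AE x in \<X>. emeasure \<E> {e \<in> space \<E>. Ld (x, e) > 2 * (INF g\<in>P. disc_loss n x f0 g) + (256 * \<sigma>\<^sup>2 * H + 64 * \<sigma>\<^sup>2 * s) / real n}
     \<le> ennreal (exp (- s))"
    using disc_loss_conditional_tail AE_space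
  proof eventually_elim
    fix x assume tail: "\<forall>g\<in>P. \<forall>s>0. emeasure \<E> {e \<in> space \<E>. Ld (x, e) > 2 * disc_loss n x f0 g + (256 * \<sigma>\<^sup>2 * H + 64 * \<sigma>\<^sup>2 * s) / real n}
     \<le> ennreal (exp (- s))" and x: "x \<in> space \<X>"
    let ?I = "INF g\<in>P. disc_loss n x f0 g"
    have [measurable]: "(\<lambda>e. Ld (x, e)) \<in> borel_measurable \<E>" using x by measurable
    have "outer_measure_of \<E> {e \<in> space \<E>. Ld (x, e) > 2 * ?I + (256 * \<sigma>\<^sup>2 * H + 64 * \<sigma>\<^sup>2 * s) / real n}
     \<le> ennreal (exp (- s))"
    proof (rule outer_measure_of_gt_le)
      fix \<delta> :: real assume \<delta>: "\<delta> > 0"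
      have "\<exists>y\<in>disc_loss n x f0 ` P. y < ?I + \<delta> / 2"
        by (rule cInf_lessD) (use P_nonempty \<delta> in auto)
      then obtain g where g: "g \<in> P" "disc_loss n x f0 g < ?I + \<delta> / 2" by blast
      let ?A = "{e \<in> space \<E>. Ld (x, e) > 2 * ?I + (256 * \<sigma>\<^sup>2 * H + 64 * \<sigma>\<^sup>2 * s) / real n + \<delta>}"
      have "outer_measure_of \<E> ?A = emeasure \<E> ?A" by (rule outer_measure_of_eq) measurable
      also have "\<dots> \<le> emeasure \<E> {e \<in> space \<E>. Ld (x, e) > 2 * disc_loss n x f0 g + (256 * \<sigma>\<^sup>2 * H + 64 * \<sigma>\<^sup>2 * s) / real n}"
        using g(2) by (intro emeasure_mono) auto
      also have "\<dots> \<le> ennreal (exp (- s))" using tail g(1) s by blast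
      finally show "outer_measure_of \<E> ?A \<le> ennreal (exp (- s))" .
    qed
    then show "emeasure \<E> {e \<in> space \<E>. Ld (x, e) > 2 * ?I + (256 * \<sigma>\<^sup>2 * H + 64 * \<sigma>\<^sup>2 * s) / real n}
     \<le> ennreal (exp (- s))" by (subst (asm) outer_measure_of_eq) auto
  qed
qed

lemma nn_integral_disc_loss:
  assumes g: "g \<in> P"
  shows "(\<integral>\<^sup>+x. ennreal (disc_loss n x f0 g) \<partial>\<X>) = ennreal (cont_loss \<nu> f0 g)"
proof -
  have [measurable]: "g \<in> borel_measurable \<nu>" by (rule P_meas[OF g])
  have f0l: "integrable \<nu> (\<lambda>z. (f0 z)\<^sup>2)" and gl: "integrable \<nu> (\<lambda>z. (g z)\<^sup>2)"
    using l2 g by (auto simp: l2_def)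
  have int: "integrable \<nu> (\<lambda>z. (f0 z - g z)\<^sup>2)"
  proof (rule Bochner_Integration.integrable_bound[of _ "\<lambda>z. 2 * (f0 z)\<^sup>2 + 2 * (g z)\<^sup>2"])
    show "AE z in \<nu>. norm ((f0 z - g z)\<^sup>2) \<le> norm (2 * (f0 z)\<^sup>2 + 2 * (g z)\<^sup>2)"
    proof (rule AE_I2)
      fix z
      have "0 \<le> (f0 z + g z)\<^sup>2" by simp
      then have "(f0 z - g z)\<^sup>2 \<le> 2 * (f0 z)\<^sup>2 + 2 * (g z)\<^sup>2"
        by (simp add: power2_sum power2_diff)
      then show "norm ((f0 z - g z)\<^sup>2) \<le> norm (2 * (f0 z)\<^sup>2 + 2 * (g z)\<^sup>2)" by simp
    qed
  qed (use f0l gl in auto)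
  have comp: "(\<integral>\<^sup>+x. ennreal ((f0 (x i) - g (x i))\<^sup>2) \<partial>\<X>) = ennreal (cont_loss \<nu> f0 g)" if i: "i < n" for i
  proof -
    interpret product_prob_space "\<lambda>_. \<nu>" "{..<n}" by standard
    have ci: "(\<lambda>x. x i) \<in> measurable \<X> \<nu>" using i by auto
    have "(\<integral>\<^sup>+x. ennreal ((f0 (x i) - g (x i))\<^sup>2) \<partial>\<X>) = (\<integral>\<^sup>+z. ennreal ((f0 z - g z)\<^sup>2) \<partial>distr \<X> \<nu> (\<lambda>x. x i))"
      by (rule nn_integral_distr[OF ci, symmetric]) measurable
    also have "distr \<X> \<nu> (\<lambda>x. x i) = \<nu>" by (rule PiM_component) (use i in simp)
    also have "(\<integral>\<^sup>+z. ennreal ((f0 z - g z)\<^sup>2) \<partial>\<nu>) = ennreal (cont_loss \<nu> f0 g)"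
      unfolding cont_loss_def by (rule nn_integral_eq_integral[OF int]) auto
    finally show ?thesis .
  qed
  have "(\<integral>\<^sup>+x. ennreal (disc_loss n x f0 g) \<partial>\<X>)
      = (\<integral>\<^sup>+x. (\<Sum>i<n. ennreal (1 / real n) * ennreal ((f0 (x i) - g (x i))\<^sup>2)) \<partial>\<X>)"
    by (intro nn_integral_cong)
      (simp add: disc_loss_def sum_distrib_left[symmetric] sum_nonneg ennreal_mult'[symmetric] divide_inverse mult.commute)
  also have "\<dots> = (\<Sum>i<n. (\<integral>\<^sup>+x. ennreal (1 / real n) * ennreal ((f0 (x i) - g (x i))\<^sup>2) \<partial>\<X>))"
  proof (rule nn_integral_sum)
    fix i assume "i \<in> {..<n}"
    then have [measurable]: "(\<lambda>x. x i) \<in> measurable \<X> \<nu>" by auto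
    show "(\<lambda>x. ennreal (1 / real n) * ennreal ((f0 (x i) - g (x i))\<^sup>2)) \<in> borel_measurable \<X>" by measurable
  qed
  also have "\<dots> = (\<Sum>i<n. ennreal (1 / real n) * ennreal (cont_loss \<nu> f0 g))"
  proof (intro sum.cong refl)
    fix i assume i: "i \<in> {..<n}"
    then have [measurable]: "(\<lambda>x. x i) \<in> measurable \<X> \<nu>" by auto
    show "(\<integral>\<^sup>+x. ennreal (1 / real n) * ennreal ((f0 (x i) - g (x i))\<^sup>2) \<partial>\<X>) = ennreal (1 / real n) * ennreal (cont_loss \<nu> f0 g)"
      using comp[of i] i by (subst nn_integral_cmult) auto
  qed
  also have "\<dots> = ennreal (real n * (1 / real n * cont_loss \<nu> f0 g))"
    by (simp add: ennreal_mult'[symmetric] ennreal_of_nat_eq_real_of_nat)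
  also have "real n * (1 / real n * cont_loss \<nu> f0 g) = cont_loss \<nu> f0 g" using n_pos by simp
  finally show ?thesis .
qed

text \<open>The infimum stands outside the expectation in the final bound, so a fixed
  \<open>g\<close> suffices and its empirical bias has mean \<open>cont_loss \<nu> f0 g\<close>. The
  noise is integrated first; 128 is \<open>64 * (1 + 1)\<close> from the exponential tail.\<close>

lemma disc_loss_expectation:
  assumes g: "g \<in> P"
  shows "(\<integral>\<^sup>+z. ennreal (Ld z) \<partial>\<Z>) \<le> ennreal (2 * cont_loss \<nu> f0 g + (256 * \<sigma>\<^sup>2 * H + 128 * \<sigma>\<^sup>2) / real n)"
proof -
  let ?C = "(256 * \<sigma>\<^sup>2 * H + 128 * \<sigma>\<^sup>2) / real n"
  have C0: "0 \<le> ?C" using H_ge_1 by simp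
  note [measurable] = disc_loss_measurable_design[OF g]
  have "(\<integral>\<^sup>+z. ennreal (Ld z) \<partial>\<Z>) = (\<integral>\<^sup>+x. \<integral>\<^sup>+e. ennreal (Ld (x, e)) \<partial>\<E> \<partial>\<X>)"
    by (rule E.nn_integral_fst[symmetric]) measurable
  also have "\<dots> \<le> (\<integral>\<^sup>+x. 2 * ennreal (disc_loss n x f0 g) + ennreal ?C \<partial>\<X>)"
  proof (rule nn_integral_mono_AE)
    show "AE x in \<X>. (\<integral>\<^sup>+e. ennreal (Ld (x, e)) \<partial>\<E>) \<le> 2 * ennreal (disc_loss n x f0 g) + ennreal ?C"
      using disc_loss_conditional_tail AE_space
    proof eventually_elim
      fix x assume tail: "\<forall>g\<in>P. \<forall>s>0. emeasure \<E> {e \<in> space \<E>. Ld (x, e) > 2 * disc_loss n x f0 g + (256 * \<sigma>\<^sup>2 * H + 64 * \<sigma>\<^sup>2 * s) / real n}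
     \<le> ennreal (exp (- s))" and x: "x \<in> space \<X>"
      have [measurable]: "(\<lambda>e. Ld (x, e)) \<in> borel_measurable \<E>" using x by measurable
      have "(\<integral>\<^sup>+e. ennreal (Ld (x, e)) \<partial>\<E>)
          \<le> ennreal (2 * disc_loss n x f0 g + 256 * \<sigma>\<^sup>2 * H / real n + 64 * \<sigma>\<^sup>2 / real n * (1 + 1))"
      proof (rule E.nn_integral_le_of_exp_tail[where c = 1])
        fix s :: real assume s: "s > 0"
        have eq: "2 * disc_loss n x f0 g + 256 * \<sigma>\<^sup>2 * H / real n + 64 * \<sigma>\<^sup>2 / real n * s
            = 2 * disc_loss n x f0 g + (256 * \<sigma>\<^sup>2 * H + 64 * \<sigma>\<^sup>2 * s) / real n"
          by (simp add: add_divide_distrib)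
        show "emeasure \<E> {e \<in> space \<E>. Ld (x, e) > 2 * disc_loss n x f0 g + 256 * \<sigma>\<^sup>2 * H / real n + 64 * \<sigma>\<^sup>2 / real n * s}
            \<le> ennreal (1 * exp (- s))"
          using tail g s unfolding eq by simp
      next
        show "0 \<le> 2 * disc_loss n x f0 g + 256 * \<sigma>\<^sup>2 * H / real n"
          using disc_loss_nonneg[of x f0 g] H_ge_1 by (intro add_nonneg_nonneg) auto
        show "0 < 64 * \<sigma>\<^sup>2 / real n" using \<sigma> n_pos by simp
      qed auto
      also have "2 * disc_loss n x f0 g + 256 * \<sigma>\<^sup>2 * H / real n + 64 * \<sigma>\<^sup>2 / real n * (1 + 1) = 2 * disc_loss n x f0 g + ?C"
        by (simp add: add_divide_distrib)
      also have "ennreal (2 * disc_loss n x f0 g + ?C) = 2 * ennreal (disc_loss n x f0 g) + ennreal ?C"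
        using C0 disc_loss_nonneg[of x f0 g] by (simp add: ennreal_plus ennreal_mult')
      finally show "(\<integral>\<^sup>+e. ennreal (Ld (x, e)) \<partial>\<E>) \<le> 2 * ennreal (disc_loss n x f0 g) + ennreal ?C" .
    qed
  qed
  also have "\<dots> = 2 * ennreal (cont_loss \<nu> f0 g) + ennreal ?C"
    by (subst nn_integral_add) (auto simp: nn_integral_cmult nn_integral_disc_loss[OF g] X.emeasure_space_1)
  also have "\<dots> = ennreal (2 * cont_loss \<nu> f0 g + ?C)"
    using C0 by (simp add: ennreal_plus ennreal_mult' cont_loss_def)
  finally show ?thesis .
qed

end

context regression
begin

lemma disc_loss_bound_fixed:
  assumes g: "g \<in> P" and s: "s > 0"
  shows "emeasure \<Z> {z \<in> space \<Z>. Ld z > 2 * disc_loss n (fst z) f0 g + (256 * \<sigma>\<^sup>2 * H + 64 * \<sigma>\<^sup>2 * s) / real n}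
     \<le> ennreal (exp (- s))"
proof -
  have "AE x in \<X>. emeasure \<E> {e \<in> space \<E>. Ld (x, e) > 2 * disc_loss n x f0 g + (256 * \<sigma>\<^sup>2 * H + 64 * \<sigma>\<^sup>2 * s) / real n}
     \<le> ennreal (exp (- s))"
    using disc_loss_conditional_tail by eventually_elim (use g s in blast)
  note le = outer_measure_of_fibrewise[OF X.prob_space_axioms E.prob_space_axioms Ld_meas this]
  note [measurable] = disc_loss_measurable[OF g]
  have "{z \<in> space \<Z>. Ld z > 2 * disc_loss n (fst z) f0 g + (256 * \<sigma>\<^sup>2 * H + 64 * \<sigma>\<^sup>2 * s) / real n} \<in> sets \<Z>"
    by measurable
  from le[unfolded outer_measure_of_eq[OF this]] show ?thesis .
qed

text \<open>The event that the estimator lies in \<open>P\<close> may be nonmeasurable, so the order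
  of the two almost-everywhere quantifiers is exchanged for the complement of a measurable null
  set.\<close>

lemma F_in_P: "AE e in \<E>. AE x in \<X>. F x e \<in> P"
proof -
  from AE_E[OF F_argmin] obtain Q where Q: "{z \<in> space \<Z>. \<not> (case z of (x, e) \<Rightarrow> F x e \<in> P \<and>
      (\<forall>g\<in>P. (\<Sum>i<n. (f0 (x i) + e i - F x e (x i))\<^sup>2) \<le> (\<Sum>i<n. (f0 (x i) + e i - g (x i))\<^sup>2)))} \<subseteq> Q"
      "emeasure \<Z> Q = 0" "Q \<in> sets \<Z>" .
  note [measurable] = Q(3)
  have m: "{z \<in> space \<Z>. (fst z, snd z) \<notin> Q} \<in> sets \<Z>" by simp measurable
  have "AE z in \<Z>. z \<notin> Q" using Q(2,3) by (intro AE_not_in) auto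
  then have "AE x in \<X>. AE e in \<E>. (x, e) \<notin> Q" by (rule XE.AE_pair)
  then have "AE e in \<E>. AE x in \<X>. (x, e) \<notin> Q" using XE.AE_commute[OF m] by simp
  then show ?thesis
    using AE_space
  proof eventually_elim
    fix e assume ae: "AE x in \<X>. (x, e) \<notin> Q" and e: "e \<in> space \<E>"
    show "AE x in \<X>. F x e \<in> P"
      using ae AE_space
    proof eventually_elim
      fix x assume "(x, e) \<notin> Q" "x \<in> space \<X>"
      then show "F x e \<in> P" using Q(1) e by (auto simp: space_pair_measure)
    qed
  qed
qed

section \<open>Continuous loss under a uniform bound on the model\<close>

context
  fixes \<Gamma> :: real
  assumes \<Gamma>: "\<Gamma> > 0" and bd: "\<forall>g\<in>insert f0 P. \<forall>z\<in>space \<nu>. \<bar>g z\<bar> \<le> \<Gamma>"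
begin

interpretation bounded_model \<nu> n P f0 \<kappa> D \<Gamma>
  by unfold_locales (use k n D \<Gamma> P_meas f0_meas bd pd in auto)

lemma cont_loss_deviation:
  assumes t: "t > 0"
  shows "emeasure \<Z> {z \<in> space \<Z>. Lc z > 32 * Ld z + 288 * \<Gamma>\<^sup>2 * (4 * H + t) / real n} \<le> ennreal (2 * exp (- t))"
    (is "emeasure \<Z> ?A \<le> _")
proof -
  have A: "?A \<in> sets \<Z>" by measurable
  have "emeasure \<Z> ?A = (\<integral>\<^sup>+e. emeasure \<X> ((\<lambda>x. (x, e)) -` ?A) \<partial>\<E>)"
    by (rule XE.emeasure_pair_measure_alt2[OF A])
  also have "\<dots> \<le> (\<integral>\<^sup>+e. ennreal (2 * exp (- t)) \<partial>\<E>)"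
  proof (rule nn_integral_mono_AE)
    show "AE e in \<E>. emeasure \<X> ((\<lambda>x. (x, e)) -` ?A) \<le> ennreal (2 * exp (- t))"
      using F_in_P AE_space
    proof eventually_elim
      fix e assume ae: "AE x in \<X>. F x e \<in> P" and e: "e \<in> space \<E>"
      have "(\<lambda>(x, z). ((x, e), z)) \<in> measurable (\<X> \<Otimes>\<^sub>M \<nu>) (\<Z> \<Otimes>\<^sub>M \<nu>)"
        using e by measurable
      from measurable_compose[OF this F_meas]
      have Fm: "(\<lambda>(x, z). F x e z) \<in> borel_measurable (\<X> \<Otimes>\<^sub>M \<nu>)" by (simp add: case_prod_unfold)
      have "(\<lambda>x. (x, e)) -` ?A = {x \<in> space \<X>. cont_loss \<nu> (F x e) f0 > 32 * disc_loss n x (F x e) f0 + 288 * \<Gamma>\<^sup>2 * (4 * H + t) / real n}"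
        using e by (auto simp: space_pair_measure Lc_def Ld_def)
      also have "emeasure \<X> \<dots> \<le> ennreal (2 * exp (- t))"
        by (rule selector_deviation[OF Fm ae t]) (simp add: H_def)
      finally show "emeasure \<X> ((\<lambda>x. (x, e)) -` ?A) \<le> ennreal (2 * exp (- t))" .
    qed
  qed
  also have "\<dots> = ennreal (2 * exp (- t))" by (simp add: E.emeasure_space_1)
  finally show ?thesis .
qed

lemma disc_loss_tail:
  assumes g: "g \<in> P"
  shows "emeasure \<Z> {z \<in> space \<Z>. disc_loss n (fst z) f0 g > 2 * cont_loss \<nu> f0 g + 4 * \<Gamma>\<^sup>2 * t / real n}
     \<le> ennreal (exp (- t))"
proof -
  have [measurable]: "g \<in> borel_measurable \<nu>" by (rule P_meas[OF g])
  let ?h = "\<lambda>z. (f0 z - g z)\<^sup>2"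
  let ?B = "{x \<in> space \<X>. disc_loss n x f0 g > 2 * cont_loss \<nu> f0 g + 4 * \<Gamma>\<^sup>2 * t / real n}"
  note [measurable] = disc_loss_measurable_design[OF g]
  have B: "?B \<in> sets \<X>" by measurable
  have eq: "{z \<in> space \<Z>. disc_loss n (fst z) f0 g > 2 * cont_loss \<nu> f0 g + 4 * \<Gamma>\<^sup>2 * t / real n} = ?B \<times> space \<E>"
    by (auto simp: space_pair_measure)
  have "emeasure \<Z> (?B \<times> space \<E>) = emeasure \<X> ?B"
    using B by (simp add: E.emeasure_pair_measure_Times E.emeasure_space_1)
  also have "emeasure \<X> ?B \<le> emeasure \<X> {x \<in> space \<X>. (\<Sum>i<n. ?h (x i)) > 2 * real (card {..<n}) * (\<integral>z. ?h z \<partial>\<nu>) + 4 * \<Gamma>\<^sup>2 * t}"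
  proof (rule emeasure_mono)
    show "?B \<subseteq> {x \<in> space \<X>. (\<Sum>i<n. ?h (x i)) > 2 * real (card {..<n}) * (\<integral>z. ?h z \<partial>\<nu>) + 4 * \<Gamma>\<^sup>2 * t}"
    proof safe
      fix x assume "disc_loss n x f0 g > 2 * cont_loss \<nu> f0 g + 4 * \<Gamma>\<^sup>2 * t / real n"
      then have "real n * (2 * cont_loss \<nu> f0 g + 4 * \<Gamma>\<^sup>2 * t / real n) < real n * disc_loss n x f0 g"
        using n_pos by (intro mult_strict_left_mono) auto
      moreover have "real n * disc_loss n x f0 g = (\<Sum>i<n. ?h (x i))"
        using n_pos by (simp add: disc_loss_def)
      moreover have "real n * (2 * cont_loss \<nu> f0 g + 4 * \<Gamma>\<^sup>2 * t / real n)
          = 2 * real (card {..<n}) * (\<integral>z. ?h z \<partial>\<nu>) + 4 * \<Gamma>\<^sup>2 * t"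
        using n_pos by (simp add: cont_loss_def distrib_left)
      ultimately show "(\<Sum>i<n. ?h (x i)) > 2 * real (card {..<n}) * (\<integral>z. ?h z \<partial>\<nu>) + 4 * \<Gamma>\<^sup>2 * t"
        by simp
    qed
    have "(\<lambda>x. \<Sum>i<n. ?h (x i)) \<in> borel_measurable \<X>"
    proof (rule borel_measurable_sum)
      fix i assume "i \<in> {..<n}"
      then have [measurable]: "(\<lambda>x. x i) \<in> measurable \<X> \<nu>" by auto
      show "(\<lambda>x. ?h (x i)) \<in> borel_measurable \<X>" by measurable
    qed
    then show "{x \<in> space \<X>. (\<Sum>i<n. ?h (x i)) > 2 * real (card {..<n}) * (\<integral>z. ?h z \<partial>\<nu>) + 4 * \<Gamma>\<^sup>2 * t} \<in> sets \<X>"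
      by measurable
  qed
  also have "\<dots> \<le> ennreal (exp (- t))"
  proof (rule sum_upper_tail[OF nu])
    fix z assume "z \<in> space \<nu>"
    then show "?h z \<le> 4 * \<Gamma>\<^sup>2" using sq_diff_bd[of g z] g by (simp add: power2_commute[of "f0 z"])
  qed (use \<Gamma> in auto)
  finally show ?thesis unfolding eq .
qed

text \<open>Three comparisons are chained: continuous to empirical loss of the estimator, empirical
  loss to empirical bias, and empirical bias to continuous bias. This gives
  \<open>128 = 32 * 2 * 2\<close>, \<open>9344 = 1152 + 8192\<close> and
  \<open>2592 = 544 + 2048\<close>, where the summands belong to \<open>\<Gamma>\<close> and
  \<open>\<sigma>\<close>. The failure probabilities add up as \<open>2 + 1 + 1\<close>.\<close>

lemma cont_loss_bound:
  assumes g: "g \<in> P" and t: "t > 0" and m: "\<sigma>\<^sup>2 \<le> m" "\<Gamma>\<^sup>2 \<le> m"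
  shows "emeasure \<Z> {z \<in> space \<Z>. Lc z > 128 * cont_loss \<nu> f0 g + m * (9344 * H + 2592 * t) / real n}
     \<le> ennreal (4 * exp (- t))"
proof -
  note [measurable] = disc_loss_measurable[OF g]
  let ?A1 = "{z \<in> space \<Z>. Lc z > 32 * Ld z + 288 * \<Gamma>\<^sup>2 * (4 * H + t) / real n}"
  let ?A2 = "{z \<in> space \<Z>. Ld z > 2 * disc_loss n (fst z) f0 g + (256 * \<sigma>\<^sup>2 * H + 64 * \<sigma>\<^sup>2 * t) / real n}"
  let ?A3 = "{z \<in> space \<Z>. disc_loss n (fst z) f0 g > 2 * cont_loss \<nu> f0 g + 4 * \<Gamma>\<^sup>2 * t / real n}"
  have "{z \<in> space \<Z>. Lc z > 128 * cont_loss \<nu> f0 g + m * (9344 * H + 2592 * t) / real n} \<subseteq> ?A1 \<union> (?A2 \<union> ?A3)"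
  proof (rule subsetI, rule ccontr)
    fix z assume z: "z \<in> {z \<in> space \<Z>. Lc z > 128 * cont_loss \<nu> f0 g + m * (9344 * H + 2592 * t) / real n}"
      and "z \<notin> ?A1 \<union> (?A2 \<union> ?A3)"
    then have le: "Lc z \<le> 32 * Ld z + 288 * \<Gamma>\<^sup>2 * (4 * H + t) / real n"
      "Ld z \<le> 2 * disc_loss n (fst z) f0 g + (256 * \<sigma>\<^sup>2 * H + 64 * \<sigma>\<^sup>2 * t) / real n"
      "disc_loss n (fst z) f0 g \<le> 2 * cont_loss \<nu> f0 g + 4 * \<Gamma>\<^sup>2 * t / real n" by auto
    have "Lc z \<le> 128 * cont_loss \<nu> f0 g + (64 * (4 * \<Gamma>\<^sup>2 * t / real n)
        + 32 * ((256 * \<sigma>\<^sup>2 * H + 64 * \<sigma>\<^sup>2 * t) / real n) + 288 * \<Gamma>\<^sup>2 * (4 * H + t) / real n)"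
      using le by linarith
    also have "64 * (4 * \<Gamma>\<^sup>2 * t / real n) + 32 * ((256 * \<sigma>\<^sup>2 * H + 64 * \<sigma>\<^sup>2 * t) / real n) + 288 * \<Gamma>\<^sup>2 * (4 * H + t) / real n
        = (\<Gamma>\<^sup>2 * (1152 * H + 544 * t) + \<sigma>\<^sup>2 * (8192 * H + 2048 * t)) / real n"
      using n_pos by (simp add: field_simps)
    also have "\<dots> \<le> (m * (1152 * H + 544 * t) + m * (8192 * H + 2048 * t)) / real n"
      using H_ge_1 t m by (intro divide_right_mono add_mono mult_right_mono) auto
    also have "\<dots> = m * (9344 * H + 2592 * t) / real n" by (simp add: algebra_simps)
    finally show False using z by simp
  qed
  then have "emeasure \<Z> {z \<in> space \<Z>. Lc z > 128 * cont_loss \<nu> f0 g + m * (9344 * H + 2592 * t) / real n}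
      \<le> emeasure \<Z> (?A1 \<union> (?A2 \<union> ?A3))" by (rule emeasure_mono) measurable
  also have "\<dots> \<le> emeasure \<Z> ?A1 + emeasure \<Z> (?A2 \<union> ?A3)" by (rule emeasure_subadditive) measurable
  also have "\<dots> \<le> emeasure \<Z> ?A1 + (emeasure \<Z> ?A2 + emeasure \<Z> ?A3)"
    by (intro add_left_mono emeasure_subadditive) measurable
  also have "\<dots> \<le> ennreal (2 * exp (- t)) + (ennreal (exp (- t)) + ennreal (exp (- t)))"
    by (intro add_mono cont_loss_deviation[OF t] disc_loss_bound_fixed[OF g t] disc_loss_tail[OF g])
  also have "\<dots> = ennreal (4 * exp (- t))" by (simp flip: ennreal_plus)
  finally show ?thesis .
qed

text \<open>The difference \<open>Lc - 32 * Ld\<close> has an exponential tail, and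
  \<open>ennreal\<close> truncates its negative values; \<open>Ld\<close> is integrated separately.
  The bias factor is only \<open>32 * 2\<close>, because the empirical bias has the continuous bias
  as its mean and needs no upper tail. Terms without \<open>H\<close> are absorbed by
  \<open>1 \<le> H\<close>, giving \<open>14304 = 1152 + 864 + 8192 + 4096\<close>.\<close>

lemma cont_loss_expectation:
  assumes g: "g \<in> P" and m: "\<sigma>\<^sup>2 \<le> m" "\<Gamma>\<^sup>2 \<le> m"
  shows "(\<integral>\<^sup>+z. ennreal (Lc z) \<partial>\<Z>) \<le> ennreal (64 * cont_loss \<nu> f0 g + m * (14304 * H) / real n)"
proof -
  have c0: "0 \<le> cont_loss \<nu> f0 g" by (simp add: cont_loss_def)
  have Ld0: "0 \<le> Ld z" for z by (simp add: Ld_def disc_loss_nonneg)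
  have A0: "0 \<le> 288 * \<Gamma>\<^sup>2 * (4 * H) / real n" "0 \<le> 288 * \<Gamma>\<^sup>2 / real n" using H_ge_1 by auto
  have "(\<integral>\<^sup>+z. ennreal (Lc z - 32 * Ld z) \<partial>\<Z>)
      \<le> ennreal (288 * \<Gamma>\<^sup>2 * (4 * H) / real n + 288 * \<Gamma>\<^sup>2 / real n * (1 + 2))"
  proof (rule XE.nn_integral_le_of_exp_tail)
    fix s :: real assume s: "s > 0"
    have "{z \<in> space \<Z>. Lc z - 32 * Ld z > 288 * \<Gamma>\<^sup>2 * (4 * H) / real n + 288 * \<Gamma>\<^sup>2 / real n * s}
        = {z \<in> space \<Z>. Lc z > 32 * Ld z + 288 * \<Gamma>\<^sup>2 * (4 * H + s) / real n}"
      by (auto simp: algebra_simps add_divide_distrib)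
    then show "emeasure \<Z> {z \<in> space \<Z>. Lc z - 32 * Ld z > 288 * \<Gamma>\<^sup>2 * (4 * H) / real n + 288 * \<Gamma>\<^sup>2 / real n * s}
        \<le> ennreal (2 * exp (- s))"
      using cont_loss_deviation[OF s] by simp
  next
    show "0 < 288 * \<Gamma>\<^sup>2 / real n" using \<Gamma> n_pos by simp
  qed (use A0 in auto)
  note dev = this
  have "(\<integral>\<^sup>+z. ennreal (Lc z) \<partial>\<Z>) \<le> (\<integral>\<^sup>+z. ennreal (Lc z - 32 * Ld z) + 32 * ennreal (Ld z) \<partial>\<Z>)"
  proof (rule nn_integral_mono)
    fix z
    have "ennreal (Lc z) \<le> ennreal (max 0 (Lc z - 32 * Ld z) + 32 * Ld z)" by (intro ennreal_leI) auto
    also have "\<dots> = ennreal (max 0 (Lc z - 32 * Ld z)) + ennreal (32 * Ld z)"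
      using Ld0[of z] by (intro ennreal_plus) auto
    also have "ennreal (max 0 (Lc z - 32 * Ld z)) = ennreal (Lc z - 32 * Ld z)"
      by (simp add: max_def ennreal_neg)
    also have "ennreal (32 * Ld z) = 32 * ennreal (Ld z)" by (simp add: ennreal_mult')
    finally show "ennreal (Lc z) \<le> ennreal (Lc z - 32 * Ld z) + 32 * ennreal (Ld z)" .
  qed
  also have "\<dots> = (\<integral>\<^sup>+z. ennreal (Lc z - 32 * Ld z) \<partial>\<Z>) + 32 * (\<integral>\<^sup>+z. ennreal (Ld z) \<partial>\<Z>)"
    by (subst nn_integral_add) (auto simp: nn_integral_cmult)
  also have "\<dots> \<le> ennreal (288 * \<Gamma>\<^sup>2 * (4 * H) / real n + 288 * \<Gamma>\<^sup>2 / real n * (1 + 2))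
      + 32 * ennreal (2 * cont_loss \<nu> f0 g + (256 * \<sigma>\<^sup>2 * H + 128 * \<sigma>\<^sup>2) / real n)"
    by (intro add_mono mult_left_mono dev disc_loss_expectation[OF g]) auto
  also have "\<dots> = ennreal (288 * \<Gamma>\<^sup>2 * (4 * H) / real n + 288 * \<Gamma>\<^sup>2 / real n * (1 + 2)
      + 32 * (2 * cont_loss \<nu> f0 g + (256 * \<sigma>\<^sup>2 * H + 128 * \<sigma>\<^sup>2) / real n))"
  proof -
    have plus: "ennreal a + 32 * ennreal b = ennreal (a + 32 * b)" if "0 \<le> a" "0 \<le> b" for a b :: real
      using that by (simp add: ennreal_plus ennreal_mult')
    show ?thesis
      using c0 A0 H_ge_1 by (intro plus add_nonneg_nonneg) auto
  qed
  also have "\<dots> \<le> ennreal (64 * cont_loss \<nu> f0 g + m * (14304 * H) / real n)"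
  proof (rule ennreal_leI)
    have "288 * \<Gamma>\<^sup>2 * (4 * H) / real n + 288 * \<Gamma>\<^sup>2 / real n * (1 + 2)
      + 32 * (2 * cont_loss \<nu> f0 g + (256 * \<sigma>\<^sup>2 * H + 128 * \<sigma>\<^sup>2) / real n)
      = 64 * cont_loss \<nu> f0 g + (\<Gamma>\<^sup>2 * (1152 * H + 864 * 1) + \<sigma>\<^sup>2 * (8192 * H + 4096 * 1)) / real n"
      using n_pos by (simp add: field_simps)
    also have "\<dots> \<le> 64 * cont_loss \<nu> f0 g + (m * (1152 * H + 864 * H) + m * (8192 * H + 4096 * H)) / real n"
    proof -
      have "0 \<le> m" using m(1) zero_le_power2[of \<sigma>] by linarith
      then show ?thesis
        using H_ge_1 m by (intro add_left_mono divide_right_mono add_mono mult_mono) auto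
    qed
    also have "\<dots> = 64 * cont_loss \<nu> f0 g + m * (14304 * H) / real n" by (simp add: algebra_simps)
    finally show "288 * \<Gamma>\<^sup>2 * (4 * H) / real n + 288 * \<Gamma>\<^sup>2 / real n * (1 + 2)
      + 32 * (2 * cont_loss \<nu> f0 g + (256 * \<sigma>\<^sup>2 * H + 128 * \<sigma>\<^sup>2) / real n)
      \<le> 64 * cont_loss \<nu> f0 g + m * (14304 * H) / real n" .
  qed
  finally show ?thesis .
qed

end

end

subsection \<open>Reduction to product measures\<close>

text \<open>The term \<open>j = 0\<close> alone suffices. Summability has to be shown because only
  then does a single nonnegative term bound the infinite sum from below.\<close>

lemma exp_le_geometric_exp_sum:
  assumes t: "t > 0" and c: "c \<ge> (1 :: real)"
  shows "exp (- t) \<le> (\<Sum>j::nat. exp (- (2 ^ j * t / c)))"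
proof -
  have q: "exp (- (t / c)) < 1" "0 \<le> exp (- (t / c))" using t c by auto
  have "summable (\<lambda>j::nat. exp (- (2 ^ j * t / c)))"
  proof (rule summable_comparison_test')
    show "summable (\<lambda>j::nat. exp (- (t / c)) ^ j)" by (rule summable_geometric) (use q in auto)
    fix j :: nat
    have "real j * (t / c) \<le> 2 ^ j * (t / c)"
      using t c less_exp[of j] by (intro mult_right_mono) (auto simp: of_nat_less_two_power less_imp_le)
    then show "norm (exp (- (2 ^ j * t / c))) \<le> exp (- (t / c)) ^ j"
      by (simp add: exp_of_nat_mult[symmetric])
  qed
  then have "(\<Sum>j\<in>{0}. exp (- (2 ^ j * t / c))) \<le> (\<Sum>j::nat. exp (- (2 ^ j * t / c)))"
    by (rule sum_le_suminf) auto
  then have "exp (- (t / c)) \<le> (\<Sum>j::nat. exp (- (2 ^ j * t / c)))" by simp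
  moreover have "exp (- t) \<le> exp (- (t / c))" using t c by (simp add: field_simps)
  ultimately show ?thesis by (rule order_trans[rotated])
qed

lemma (in prob_space) outer_measure_of_le_1: "outer_measure_of M S \<le> 1" if "S \<subseteq> space M"
  using outer_measure_of_mono[OF that, of M] by (simp add: emeasure_space_1)

text \<open>For negative \<open>r\<close> the claim reduces to the bound by the total mass.\<close>

lemma (in prob_space) holds_with_prob_at_leastI:
  assumes "outer_measure_of M {\<omega> \<in> space M. \<not> A \<omega>} \<le> ennreal p" "p \<le> 1 - r"
  shows "holds_with_prob_at_least M A (max r 0)"
proof (cases "r \<ge> 0")
  case True
  have "ennreal p \<le> ennreal (1 - r)" using assms(2) by (rule ennreal_leI)
  then show ?thesis using assms(1) True by (auto simp: holds_with_prob_at_least_def max_def)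
next
  case False
  then show ?thesis
    using outer_measure_of_le_1[of "{\<omega> \<in> space M. \<not> A \<omega>}"] by (auto simp: holds_with_prob_at_least_def max_def)
qed

text \<open>The preimage of a measurable hull of \<open>S\<close> is measurable and covers
  \<open>A\<close>.\<close>

lemma outer_measure_of_distr_le:
  assumes Z: "Z \<in> measurable M K" and sub: "A \<subseteq> space M" "\<And>\<omega>. \<omega> \<in> A \<Longrightarrow> Z \<omega> \<in> S"
    and S: "outer_measure_of (distr M K Z) S \<le> q" "S \<subseteq> space K"
  shows "outer_measure_of M A \<le> q"
proof -
  obtain E where E: "E \<in> sets (distr M K Z)" "S \<subseteq> E" "outer_measure_of (distr M K Z) S = emeasure (distr M K Z) E"
    using outer_measure_of_attain[of S "distr M K Z"] S(2) by auto
  have "outer_measure_of M A \<le> outer_measure_of M (Z -` E \<inter> space M)"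
    using sub E(2) by (intro outer_measure_of_mono) auto
  also have "\<dots> = emeasure M (Z -` E \<inter> space M)"
    using Z E(1) by (intro outer_measure_of_eq measurable_sets[OF Z]) auto
  also have "\<dots> = emeasure (distr M K Z) E" using Z E(1) by (simp add: emeasure_distr)
  finally show ?thesis using S(1) E(3) by simp
qed

lemma outer_expectation_le_nn_integral:
  assumes "(\<lambda>\<omega>. ennreal (Z \<omega>)) \<in> borel_measurable M"
  shows "outer_expectation M Z \<le> (\<integral>\<^sup>+\<omega>. ennreal (Z \<omega>) \<partial>M)"
  unfolding outer_expectation_def by (rule INF_lower) (use assms in auto)

lemma near_INF:
  fixes f :: "'a \<Rightarrow> real"
  assumes "P \<noteq> {}" "\<delta> > 0"
  obtains g where "g \<in> P" "f g < (INF g\<in>P. f g) + \<delta>"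
proof -
  have "\<exists>y\<in>f ` P. y < (INF g\<in>P. f g) + \<delta>"
    by (rule cInf_lessD) (use assms in auto)
  then show ?thesis using that by blast
qed

lemma (in prob_space) indep_set_imp_distr_Pair:
  assumes ind: "indep_set (sets (vimage_algebra (space M) U S)) (sets (vimage_algebra (space M) V T))"
    and U[measurable]: "U \<in> measurable M S" and V[measurable]: "V \<in> measurable M T"
  shows "distr M (S \<Otimes>\<^sub>M T) (\<lambda>\<omega>. (U \<omega>, V \<omega>)) = distr M S U \<Otimes>\<^sub>M distr M T V"
proof -
  interpret U: prob_space "distr M S U" by (rule prob_space_distr) (rule U)
  interpret V: prob_space "distr M T V" by (rule prob_space_distr) (rule V)
  show ?thesis
  proof (rule pair_measure_eqI[symmetric])
    show "sets (distr M S U \<Otimes>\<^sub>M distr M T V) = sets (distr M (S \<Otimes>\<^sub>M T) (\<lambda>\<omega>. (U \<omega>, V \<omega>)))"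
      by (simp cong: sets_pair_measure_cong)
    fix A B assume "A \<in> sets (distr M S U)" "B \<in> sets (distr M T V)"
    then have [measurable]: "A \<in> sets S" "B \<in> sets T" by auto
    have "emeasure (distr M (S \<Otimes>\<^sub>M T) (\<lambda>\<omega>. (U \<omega>, V \<omega>))) (A \<times> B)
        = emeasure M ((U -` A \<inter> space M) \<inter> (V -` B \<inter> space M))"
      by (subst emeasure_distr) (auto intro!: arg_cong[where f = "emeasure M"])
    also have "\<dots> = ennreal (prob (U -` A \<inter> space M) * prob (V -` B \<inter> space M))"
      unfolding emeasure_eq_measure
      by (subst indep_setD[OF ind]) (auto intro: in_vimage_algebra)
    also have "\<dots> = emeasure (distr M S U) A * emeasure (distr M T V) B"
      by (simp add: emeasure_distr emeasure_eq_measure ennreal_mult')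
    finally show "emeasure (distr M S U) A * emeasure (distr M T V) B
        = emeasure (distr M (S \<Otimes>\<^sub>M T) (\<lambda>\<omega>. (U \<omega>, V \<omega>))) (A \<times> B)" by simp
  qed unfold_locales
qed

theorem theorem4p2:
  fixes \<Omega> :: "(real ^ 'd) set"
    and \<nu> :: "(real ^ 'd) measure"
    and M :: "'w measure"
    and n :: nat
    and X :: "nat \<Rightarrow> 'w \<Rightarrow> real ^ 'd"
    and eps Y :: "nat \<Rightarrow> 'w \<Rightarrow> real"
    and f0 :: "real ^ 'd \<Rightarrow> real"
    and P :: "(real ^ 'd \<Rightarrow> real) set"
    and fhat :: "(nat \<Rightarrow> real ^ 'd) \<Rightarrow> (nat \<Rightarrow> real) \<Rightarrow> real ^ 'd \<Rightarrow> real"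
    and D \<sigma> \<kappa> :: real
  assumes n: "n \<ge> 7"
    and kappa: "covering_constant \<kappa>"
    and nu: "prob_space \<nu>" "sets \<nu> = sets (restrict_space borel \<Omega>)"
    and M: "prob_space M"
    and X_indep: "prob_space.indep_vars M (\<lambda>_. \<nu>) X {..<n}"
    and X_law: "\<forall>i<n. distr M \<nu> (X i) = \<nu>"
    and eps_indep: "prob_space.indep_vars M (\<lambda>_. borel) eps {..<n}"
    and eps_law: "\<forall>i<n. distr M borel (eps i) = distr M borel (eps 0)"
    and X_eps_indep: "prob_space.indep_set M
          (sets (vimage_algebra (space M) (restr n X) (PiM {..<n} (\<lambda>_. \<nu>))))
          (sets (vimage_algebra (space M) (restr n eps) (PiM {..<n} (\<lambda>_. borel))))"
    and subgaussian: "\<forall>t::real. integrable M (\<lambda>\<omega>. exp (t * eps 0 \<omega>)) \<and>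
          prob_space.expectation M (\<lambda>\<omega>. exp (t * eps 0 \<omega>)) \<le> exp (\<sigma>\<^sup>2 * t\<^sup>2 / 2)"
    and Y: "\<forall>i<n. \<forall>\<omega>\<in>space M. Y i \<omega> = f0 (X i \<omega>) + eps i \<omega>"
    and P: "P \<subseteq> l2 \<nu>"
    and f0: "f0 \<in> l2 \<nu>"
    and D: "D \<ge> 1"
           "AE x in distr M (PiM {..<n} (\<lambda>_. \<nu>)) (restr n X). real (pdim n (traces n x P)) \<le> D"
    and fhat_measurable: "(\<lambda>((x, y), z). fhat x y z) \<in> borel_measurable
          ((PiM {..<n} (\<lambda>_. \<nu>) \<Otimes>\<^sub>M PiM {..<n} (\<lambda>_. borel)) \<Otimes>\<^sub>M \<nu>)"
    and fhat_argmin: "AE (x, y) in distr M (PiM {..<n} (\<lambda>_. \<nu>) \<Otimes>\<^sub>M PiM {..<n} (\<lambda>_. borel))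
            (\<lambda>\<omega>. (restr n X \<omega>, restr n Y \<omega>)).
          is_arg_min (empirical_risk n x y) (\<lambda>f. f \<in> P) (fhat x y)"
  shows
    "(\<forall>\<Gamma>::real. (\<forall>g\<in>insert f0 P. \<forall>x\<in>\<Omega>. \<bar>g x\<bar> \<le> \<Gamma>) \<longrightarrow>
        (\<forall>t>0. holds_with_prob_at_least M
           (\<lambda>\<omega>. cont_loss \<nu> (fhat (restr n X \<omega>) (restr n Y \<omega>)) f0
              \<le> 1152 * (INF g\<in>P. cont_loss \<nu> f0 g)
                + 7560000 * (max (\<sigma>\<^sup>2) (\<Gamma>\<^sup>2) * \<kappa> * D * ln (real n) / real n)
                + 335000 * (max (\<sigma>\<^sup>2) (\<Gamma>\<^sup>2) * t / real n))
           (max (1 - 4 * (\<Sum>j::nat. exp (- (2 ^ j * t / 73728))) - 6 * exp (- t)) 0)) \<and>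
        outer_expectation M
           (\<lambda>\<omega>. cont_loss \<nu> (fhat (restr n X \<omega>) (restr n Y \<omega>)) f0)
          \<le> ennreal (144 * (INF g\<in>P. cont_loss \<nu> f0 g)
                + 45000000 * (max (\<sigma>\<^sup>2) (\<Gamma>\<^sup>2) * \<kappa> * D * ln (real n) / real n)))
   \<and> (\<forall>t>0. holds_with_prob_at_least M
           (\<lambda>\<omega>. disc_loss n (restr n X \<omega>) (fhat (restr n X \<omega>) (restr n Y \<omega>)) f0
              \<le> 18 * (INF g\<in>P. disc_loss n (restr n X \<omega>) f0 g)
                + 819200 * (\<sigma>\<^sup>2 * \<kappa> * D * ln (real n) / real n)
                + 8 * (\<sigma>\<^sup>2 * t / real n))
           (max (1 - 4 * (\<Sum>j::nat. exp (- (2 ^ j * t / 73728)))) 0))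
   \<and> outer_expectation M
           (\<lambda>\<omega>. disc_loss n (restr n X \<omega>) (fhat (restr n X \<omega>) (restr n Y \<omega>)) f0)
          \<le> ennreal (18 * (INF g\<in>P. cont_loss \<nu> f0 g)
                + 5620000 * (\<sigma>\<^sup>2 * \<kappa> * D * ln (real n) / real n))"
proof -

  \<comment> \<open>Reduction of the joint law to a product of design and noise\<close>
  interpret M: prob_space M by (rule M)
  define \<rho> where "\<rho> = distr M borel (eps 0)"
  define K where "K = PiM {..<n} (\<lambda>_. \<nu>) \<Otimes>\<^sub>M PiM {..<n} (\<lambda>_. borel :: real measure)"
  define \<Z> where "\<Z> = PiM {..<n} (\<lambda>_. \<nu>) \<Otimes>\<^sub>M PiM {..<n} (\<lambda>_. \<rho>)"
  define Z where "Z \<omega> = (restr n X \<omega>, restr n eps \<omega>)" for \<omega>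
  define T where "T z = (fst z, \<lambda>i\<in>{..<n}. f0 (fst z i) + snd z i)" for z :: "(nat \<Rightarrow> real ^ 'd) \<times> (nat \<Rightarrow> real)"
  define F where "F x e = fhat x (\<lambda>i\<in>{..<n}. f0 (x i) + e i)" for x e
  have n0: "real n > 0" "{..<n} \<noteq> {}" "0 < n" using n by (auto simp: lessThan_empty_iff)
  have cancel: "x * r / a * a / r = x" if "a > 0" "r > 0" for x a r :: real using that by simp
  \<comment> \<open>Products and quotients are abstracted into variables so that linear arithmetic
    applies. In \<open>lin1\<close>, \<open>lin2\<close> and \<open>lin4\<close> the slack
    \<open>\<eta>\<close> is split evenly between the near-minimiser (as in
    \<open>128 * (\<eta> / 256)\<close>) and the enlarged parameters; \<open>lin3\<close> involves
    no near-minimiser.\<close>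
  have lin1: "q = 9344 * a + 2592 * b + \<eta> / 2 \<Longrightarrow> 0 \<le> a \<Longrightarrow> 0 \<le> b \<Longrightarrow> c < j + \<eta> / 256 \<Longrightarrow> 0 \<le> j \<Longrightarrow>
      128 * c + q \<le> 1152 * j + 7560000 * a + 335000 * b + \<eta>" for q a b c j \<eta> :: real by linarith
  have lin2: "q = 14304 * a + \<eta> / 2 \<Longrightarrow> 0 \<le> a \<Longrightarrow> c < j + \<eta> / 128 \<Longrightarrow> 0 \<le> j \<Longrightarrow>
      64 * c + q \<le> 144 * j + 45000000 * a + \<eta>" for q a c j \<eta> :: real by linarith
  have lin3: "q = 256 * a + 8 * b + \<eta> \<Longrightarrow> 0 \<le> a \<Longrightarrow> 0 \<le> i \<Longrightarrow>
      2 * i + q \<le> 18 * i + 819200 * a + 8 * b + \<eta>" for q a b i \<eta> :: real by linarith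
  have lin4: "q = 256 * a + 128 * b + \<eta> / 2 \<Longrightarrow> b \<le> a \<Longrightarrow> 0 \<le> a \<Longrightarrow> c < j + \<eta> / 4 \<Longrightarrow> 0 \<le> j \<Longrightarrow>
      2 * c + q \<le> 18 * j + 5620000 * a + \<eta>" for q a b c j \<eta> :: real by linarith
  have sets_\<rho>: "sets \<rho> = sets borel" by (simp add: \<rho>_def)
  have sets_K: "sets \<Z> = sets K"
    unfolding \<Z>_def K_def by (intro sets_pair_measure_cong sets_PiM_cong) (simp_all add: sets_\<rho>)
  have f0_meas[measurable]: "f0 \<in> borel_measurable \<nu>" using f0 by (simp add: l2_def)
  have X_rv: "X i \<in> measurable M \<nu>" if "i < n" for i
    using X_indep that by (simp add: M.indep_vars_def)
  have eps_rv: "eps i \<in> borel_measurable M" if "i < n" for i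
    using eps_indep that by (simp add: M.indep_vars_def)
  have rho_prob: "prob_space \<rho>"
    unfolding \<rho>_def by (rule M.prob_space_distr) (rule eps_rv[OF n0(3)])
  have rX: "restr n X \<in> measurable M (PiM {..<n} (\<lambda>_. \<nu>))"
    unfolding restr_def[abs_def] by (rule measurable_restrict) (use X_rv in auto)
  have re: "restr n eps \<in> measurable M (PiM {..<n} (\<lambda>_. borel))"
    unfolding restr_def[abs_def] by (rule measurable_restrict) (use eps_rv in auto)
  have law_X: "distr M (PiM {..<n} (\<lambda>_. \<nu>)) (restr n X) = PiM {..<n} (\<lambda>_. \<nu>)"
  proof -
    have "distr M (PiM {..<n} (\<lambda>_. \<nu>)) (restr n X) = PiM {..<n} (\<lambda>i. distr M \<nu> (X i))"
      using X_indep M.indep_vars_iff_distr_eq_PiM'[OF n0(2), where M' = "\<lambda>_. \<nu>" and X = X] X_rv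
      by (simp add: restr_def[abs_def])
    also have "\<dots> = PiM {..<n} (\<lambda>_. \<nu>)" using X_law by (intro PiM_cong) auto
    finally show ?thesis .
  qed
  have law_eps: "distr M (PiM {..<n} (\<lambda>_. borel)) (restr n eps) = PiM {..<n} (\<lambda>_. \<rho>)"
  proof -
    have "distr M (PiM {..<n} (\<lambda>_. borel)) (restr n eps) = PiM {..<n} (\<lambda>i. distr M borel (eps i))"
      using eps_indep M.indep_vars_iff_distr_eq_PiM'[OF n0(2), where M' = "\<lambda>_. borel" and X = eps] eps_rv
      by (simp add: restr_def[abs_def])
    also have "\<dots> = PiM {..<n} (\<lambda>_. \<rho>)" unfolding \<rho>_def using eps_law by (intro PiM_cong refl) blast
    finally show ?thesis .
  qed
  have Z_meas: "Z \<in> measurable M K"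
    unfolding Z_def[abs_def] K_def using rX re by (rule measurable_Pair)
  have law_Z: "distr M K Z = \<Z>"
    using M.indep_set_imp_distr_Pair[OF X_eps_indep rX re] by (simp add: law_X law_eps K_def \<Z>_def Z_def[abs_def])
  have T_meas: "T \<in> measurable \<Z> K"
  proof -
    have "(\<lambda>z. \<lambda>i\<in>{..<n}. f0 (fst z i) + snd z i) \<in> measurable K (PiM {..<n} (\<lambda>_. borel))"
    proof (rule measurable_restrict)
      fix i assume i: "i \<in> {..<n}"
      have [measurable]: "(\<lambda>z. fst z i) \<in> measurable K \<nu>"
        unfolding K_def using i by (intro measurable_compose[OF measurable_fst]) auto
      have [measurable]: "(\<lambda>z. snd z i) \<in> borel_measurable K"
        unfolding K_def using i by (intro measurable_compose[OF measurable_snd]) auto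
      show "(\<lambda>z. f0 (fst z i) + snd z i) \<in> borel_measurable K" by measurable
    qed
    then have "T \<in> measurable K K"
      unfolding T_def[abs_def] by (subst (2) K_def) (auto simp: K_def intro!: measurable_Pair)
    then show ?thesis by (simp add: measurable_cong_sets[OF sets_K refl])
  qed
  have TZ: "T (Z \<omega>) = (restr n X \<omega>, restr n Y \<omega>)" if "\<omega> \<in> space M" for \<omega>
    using Y that by (auto simp: T_def Z_def restr_def fun_eq_iff)
  have law_Y: "distr M K (\<lambda>\<omega>. (restr n X \<omega>, restr n Y \<omega>)) = distr \<Z> K T"
  proof -
    have "distr M K (\<lambda>\<omega>. (restr n X \<omega>, restr n Y \<omega>)) = distr M K (T \<circ> Z)"
      by (rule distr_cong) (auto simp: TZ)
    also have "\<dots> = distr (distr M K Z) K T"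
      using T_meas Z_meas by (intro distr_distr[symmetric]) (simp_all add: measurable_cong_sets[OF sets_K refl])
    finally show ?thesis by (simp add: law_Z)
  qed
  have F_meas: "(\<lambda>((x, e), z). F x e z) \<in> borel_measurable (\<Z> \<Otimes>\<^sub>M \<nu>)"
  proof -
    have "(\<lambda>p. (T (fst p), snd p)) \<in> measurable (\<Z> \<Otimes>\<^sub>M \<nu>) (K \<Otimes>\<^sub>M \<nu>)"
      using T_meas by measurable
    from measurable_compose[OF this fhat_measurable[folded K_def]]
    show ?thesis by (simp add: case_prod_unfold T_def F_def)
  qed
  have F_argmin: "AE (x, e) in \<Z>. F x e \<in> P \<and>
      (\<forall>g\<in>P. (\<Sum>i<n. (f0 (x i) + e i - F x e (x i))\<^sup>2) \<le> (\<Sum>i<n. (f0 (x i) + e i - g (x i))\<^sup>2))"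
  proof -
    have "AE z in distr \<Z> K T. case z of (x, y) \<Rightarrow> is_arg_min (empirical_risk n x y) (\<lambda>f. f \<in> P) (fhat x y)"
      using fhat_argmin[folded K_def] unfolding law_Y .
    from AE_distrD[OF T_meas this] show ?thesis
    proof eventually_elim
      fix z assume a: "case T z of (x, y) \<Rightarrow> is_arg_min (empirical_risk n x y) (\<lambda>f. f \<in> P) (fhat x y)"
      obtain x e where z: "z = (x, e)" by (cases z)
      let ?y = "\<lambda>i\<in>{..<n}. f0 (x i) + e i"
      have er: "empirical_risk n x ?y f = (\<Sum>i<n. (f0 (x i) + e i - f (x i))\<^sup>2) / real n" for f
        by (simp add: empirical_risk_def)
      have "F x e \<in> P" "\<And>g. g \<in> P \<Longrightarrow> empirical_risk n x ?y (F x e) \<le> empirical_risk n x ?y g"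
        using a by (auto simp: z T_def F_def is_arg_min_def not_less)
      then show "case z of (x, e) \<Rightarrow> F x e \<in> P \<and>
        (\<forall>g\<in>P. (\<Sum>i<n. (f0 (x i) + e i - F x e (x i))\<^sup>2) \<le> (\<Sum>i<n. (f0 (x i) + e i - g (x i))\<^sup>2))"
        unfolding er z using n0(1) by (simp add: divide_le_cancel)
    qed
  qed
  have sub: "(\<integral>\<^sup>+y. ennreal (exp (t * y)) \<partial>\<rho>) \<le> ennreal (exp (\<sigma>\<^sup>2 * t\<^sup>2 / 2))" for t
  proof -
    have "(\<integral>\<^sup>+y. ennreal (exp (t * y)) \<partial>\<rho>) = (\<integral>\<^sup>+\<omega>. ennreal (exp (t * eps 0 \<omega>)) \<partial>M)"
      unfolding \<rho>_def by (rule nn_integral_distr) (use eps_rv[OF n0(3)] in auto)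
    also have "\<dots> = ennreal (M.expectation (\<lambda>\<omega>. exp (t * eps 0 \<omega>)))"
      by (rule nn_integral_eq_integral) (use subgaussian in auto)
    also have "\<dots> \<le> ennreal (exp (\<sigma>\<^sup>2 * t\<^sup>2 / 2))" using subgaussian by (intro ennreal_leI) auto
    finally show ?thesis .
  qed
  \<comment> \<open>Only the square of \<open>\<sigma>\<close> enters the claim, and it may vanish.
    Enlarging it by \<open>\<delta>\<close> preserves the exponential moment bound and makes the
    parameter positive.\<close>
  have reg: "regression \<nu> \<rho> n P f0 \<kappa> D (sqrt (\<sigma>\<^sup>2 + \<delta>)) F" if \<delta>: "\<delta> > 0" for \<delta>
  proof (rule regression.intro)
    fix t
    have "ennreal (exp (\<sigma>\<^sup>2 * t\<^sup>2 / 2)) \<le> ennreal (exp ((sqrt (\<sigma>\<^sup>2 + \<delta>))\<^sup>2 * t\<^sup>2 / 2))"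
      using \<delta> by (intro ennreal_leI) (simp add: mult_right_mono)
    then show "(\<integral>\<^sup>+y. ennreal (exp (t * y)) \<partial>\<rho>) \<le> ennreal (exp ((sqrt (\<sigma>\<^sup>2 + \<delta>))\<^sup>2 * t\<^sup>2 / 2))"
      using sub[of t] by (rule order_trans[rotated])
    show "0 < sqrt (\<sigma>\<^sup>2 + \<delta>)" using \<delta> by (simp add: add_nonneg_pos)
    show "AE x in PiM {..<n} (\<lambda>_. \<nu>). real (pdim n (traces n x P)) \<le> D" using D(2) by (simp only: law_X)
    show "(\<lambda>((x, e), z). F x e z) \<in> borel_measurable
      ((PiM {..<n} (\<lambda>_. \<nu>) \<Otimes>\<^sub>M PiM {..<n} (\<lambda>_. \<rho>)) \<Otimes>\<^sub>M \<nu>)" using F_meas by (simp only: \<Z>_def)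
    show "AE (x, e) in PiM {..<n} (\<lambda>_. \<nu>) \<Otimes>\<^sub>M PiM {..<n} (\<lambda>_. \<rho>). F x e \<in> P \<and>
      (\<forall>g\<in>P. (\<Sum>i<n. (f0 (x i) + e i - F x e (x i))\<^sup>2) \<le> (\<Sum>i<n. (f0 (x i) + e i - g (x i))\<^sup>2))"
      using F_argmin by (simp only: \<Z>_def)
    show "insert f0 P \<subseteq> l2 \<nu>" using P f0 by simp
  qed (fact nu(1) rho_prob sets_\<rho> kappa n D(1))+
  \<comment> \<open>An auxiliary instance with \<open>\<delta> = 1\<close> supplies the facts that
    do not involve the noise parameter: measurability of the losses, \<open>H \<ge> 1\<close> and
    nonemptiness of \<open>P\<close>.\<close>
  interpret R1: regression \<nu> \<rho> n P f0 \<kappa> D "sqrt (\<sigma>\<^sup>2 + 1)" F by (rule reg) simp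
  define H where "H = \<kappa> * D * ln (real n)"
  have H1: "H \<ge> 1" using R1.H_ge_1 unfolding R1.H_def H_def .
  define Ld where "Ld = R1.Ld"
  define Lc where "Lc = R1.Lc"
  have Ld_meas: "Ld \<in> borel_measurable \<Z>" unfolding Ld_def \<Z>_def by (rule R1.Ld_meas)
  have Lc_meas: "Lc \<in> borel_measurable \<Z>" unfolding Lc_def \<Z>_def by (rule R1.Lc_meas)
  have PX: "fhat (restr n X \<omega>) (restr n Y \<omega>) = F (fst (Z \<omega>)) (snd (Z \<omega>))" if "\<omega> \<in> space M" for \<omega>
    using TZ[OF that] by (simp add: F_def T_def Z_def)
  have Ld: "disc_loss n (restr n X \<omega>) (fhat (restr n X \<omega>) (restr n Y \<omega>)) f0 = Ld (Z \<omega>)" if "\<omega> \<in> space M" for \<omega>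
    using PX[OF that] by (simp add: Ld_def R1.Ld_def) (simp add: Z_def)
  have Lc: "cont_loss \<nu> (fhat (restr n X \<omega>) (restr n Y \<omega>)) f0 = Lc (Z \<omega>)" if "\<omega> \<in> space M" for \<omega>
    using PX[OF that] by (simp add: Lc_def R1.Lc_def)
  have outer_le: "outer_measure_of M A \<le> q"
    if "A \<subseteq> space M" "\<And>\<omega>. \<omega> \<in> A \<Longrightarrow> Z \<omega> \<in> S" "outer_measure_of \<Z> S \<le> q" "S \<subseteq> space \<Z>" for A S q
    using outer_measure_of_distr_le[OF Z_meas that(1,2)] that(3,4) sets_eq_imp_space_eq[OF sets_K]
    by (simp add: law_Z)
  have Z_space: "Z \<omega> \<in> space \<Z>" if "\<omega> \<in> space M" for \<omega>
    using measurable_space[OF Z_meas that] sets_eq_imp_space_eq[OF sets_K] by simp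
  have expect_le: "outer_expectation M g \<le> (\<integral>\<^sup>+z. ennreal (h z) \<partial>\<Z>)"
    if h: "h \<in> borel_measurable \<Z>" and g: "\<And>\<omega>. \<omega> \<in> space M \<Longrightarrow> g \<omega> = h (Z \<omega>)" for g h
  proof -
    have hK: "h \<in> borel_measurable K" using h by (simp add: measurable_cong_sets[OF sets_K refl])
    have "(\<lambda>\<omega>. ennreal (h (Z \<omega>))) \<in> borel_measurable M"
      using measurable_compose[OF Z_meas hK] by measurable
    then have gm: "(\<lambda>\<omega>. ennreal (g \<omega>)) \<in> borel_measurable M"
      by (rule measurable_cong[THEN iffD1, rotated]) (simp add: g)
    have "outer_expectation M g \<le> (\<integral>\<^sup>+\<omega>. ennreal (g \<omega>) \<partial>M)"
      by (rule outer_expectation_le_nn_integral[OF gm])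
    also have "\<dots> = (\<integral>\<^sup>+\<omega>. ennreal (h (Z \<omega>)) \<partial>M)" by (intro nn_integral_cong) (simp add: g)
    also have "\<dots> = (\<integral>\<^sup>+z. ennreal (h z) \<partial>distr M K Z)"
      using hK by (intro nn_integral_distr[symmetric] Z_meas) measurable
    finally show ?thesis by (simp add: law_Z)
  qed
  define J where "J = (INF g\<in>P. cont_loss \<nu> f0 g)"
  have J0: "J \<ge> 0"
    unfolding J_def by (rule cINF_greatest[OF R1.P_nonempty]) (simp add: cont_loss_def)
  have space_\<nu>: "space \<nu> = \<Omega>" using sets_eq_imp_space_eq[OF nu(2)] by (simp add: space_restrict_space)
  have norm_H: "a * \<kappa> * D * ln (real n) / real n = a * H / real n" for a by (simp add: H_def mult.assoc)
  have tail_sum: "exp (- s) \<le> (\<Sum>j::nat. exp (- (2 ^ j * t / 73728)))" if "t > 0" "s \<ge> t / 73728" for s t :: real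
  proof -
    have "exp (- s) \<le> exp (- (t / 73728))" using that by simp
    also have "\<dots> \<le> (\<Sum>j::nat. exp (- (2 ^ j * (t / 73728) / 1)))"
      by (rule exp_le_geometric_exp_sum) (use that in auto)
    finally show ?thesis by simp
  qed

  \<comment> \<open>Continuous norm on the original probability space\<close>
  have cont: "(\<forall>t>0. holds_with_prob_at_least M
           (\<lambda>\<omega>. cont_loss \<nu> (fhat (restr n X \<omega>) (restr n Y \<omega>)) f0
              \<le> 1152 * J + 7560000 * (max (\<sigma>\<^sup>2) (\<Gamma>\<^sup>2) * H / real n) + 335000 * (max (\<sigma>\<^sup>2) (\<Gamma>\<^sup>2) * t / real n))
           (max (1 - 4 * (\<Sum>j::nat. exp (- (2 ^ j * t / 73728))) - 6 * exp (- t)) 0)) \<and>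
        outer_expectation M (\<lambda>\<omega>. cont_loss \<nu> (fhat (restr n X \<omega>) (restr n Y \<omega>)) f0)
          \<le> ennreal (144 * J + 45000000 * (max (\<sigma>\<^sup>2) (\<Gamma>\<^sup>2) * H / real n))"
    if bd: "\<forall>g\<in>insert f0 P. \<forall>x\<in>\<Omega>. \<bar>g x\<bar> \<le> \<Gamma>" for \<Gamma> :: real
  proof -
    define m where "m = max (\<sigma>\<^sup>2) (\<Gamma>\<^sup>2)"
    have m0: "m \<ge> 0" by (simp add: m_def le_max_iff_disj)
    have bd': "\<forall>g\<in>insert f0 P. \<forall>z\<in>space \<nu>. \<bar>g z\<bar> \<le> sqrt (\<Gamma>\<^sup>2 + \<delta>)" if "\<delta> > 0" for \<delta>
    proof (intro ballI)
      fix g z assume g: "g \<in> insert f0 P" "z \<in> space \<nu>"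
      have "\<bar>g z\<bar> \<le> \<bar>\<Gamma>\<bar>" using bd g space_\<nu> by force
      also have "\<dots> \<le> sqrt (\<Gamma>\<^sup>2 + \<delta>)" using that by (intro real_le_rsqrt) auto
      finally show "\<bar>g z\<bar> \<le> sqrt (\<Gamma>\<^sup>2 + \<delta>)" .
    qed
    have G0: "sqrt (\<Gamma>\<^sup>2 + \<delta>) > 0" if "\<delta> > 0" for \<delta> using that by (simp add: add_nonneg_pos)
    have md: "(sqrt (\<sigma>\<^sup>2 + \<delta>))\<^sup>2 \<le> m + \<delta>" "(sqrt (\<Gamma>\<^sup>2 + \<delta>))\<^sup>2 \<le> m + \<delta>" if "\<delta> > 0" for \<delta>
      using that by (auto simp: m_def)
    have prob: "holds_with_prob_at_least M
           (\<lambda>\<omega>. cont_loss \<nu> (fhat (restr n X \<omega>) (restr n Y \<omega>)) f0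
              \<le> 1152 * J + 7560000 * (m * H / real n) + 335000 * (m * t / real n))
           (max (1 - 4 * (\<Sum>j::nat. exp (- (2 ^ j * t / 73728))) - 6 * exp (- t)) 0)" if t: "t > 0" for t
    proof (rule M.holds_with_prob_at_leastI)
      let ?c = "1152 * J + 7560000 * (m * H / real n) + 335000 * (m * t / real n)"
      let ?L = "\<lambda>\<omega>. cont_loss \<nu> (fhat (restr n X \<omega>) (restr n Y \<omega>)) f0"
      have "outer_measure_of M {\<omega> \<in> space M. ?L \<omega> > ?c} \<le> ennreal (4 * exp (- t))"
      proof (rule outer_measure_of_gt_le)
        fix \<eta> :: real assume \<eta>: "\<eta> > 0"
        \<comment> \<open>Chosen so that replacing \<open>m\<close> by \<open>m + \<delta>\<close>
          raises the bound by exactly \<open>\<eta> / 2\<close>.\<close>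
        define \<delta> where "\<delta> = \<eta> / 2 * real n / (9344 * H + 2592 * t)"
        have a0: "9344 * H + 2592 * t > 0" using H1 t by simp
        have \<delta>: "\<delta> > 0" using \<eta> n0 a0 by (simp add: \<delta>_def)
        obtain g where g: "g \<in> P" "cont_loss \<nu> f0 g < J + \<eta> / 256"
          unfolding J_def by (rule near_INF[OF R1.P_nonempty, of "\<eta> / 256"]) (use \<eta> in auto)
        interpret R: regression \<nu> \<rho> n P f0 \<kappa> D "sqrt (\<sigma>\<^sup>2 + \<delta>)" F by (rule reg[OF \<delta>])
        have LR: "R.Lc = Lc" by (simp add: fun_eq_iff Lc_def R1.Lc_def R.Lc_def)
        have HR: "R.H = H" by (simp add: H_def R.H_def)
        let ?S = "{z \<in> space \<Z>. Lc z > 128 * cont_loss \<nu> f0 g + (m + \<delta>) * (9344 * H + 2592 * t) / real n}"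
        have S: "?S \<in> sets \<Z>" unfolding LR[symmetric] \<Z>_def by measurable
        have "emeasure \<Z> ?S \<le> ennreal (4 * exp (- t))"
          using R.cont_loss_bound[OF G0[OF \<delta>] bd'[OF \<delta>] g(1) t md[OF \<delta>]] unfolding LR HR \<Z>_def .
        then have Sq: "outer_measure_of \<Z> ?S \<le> ennreal (4 * exp (- t))"
          by (simp only: outer_measure_of_eq[OF S])
        show "outer_measure_of M {\<omega> \<in> space M. ?L \<omega> > ?c + \<eta>} \<le> ennreal (4 * exp (- t))"
        proof (rule outer_le[OF _ _ Sq])
          fix \<omega> assume w: "\<omega> \<in> {\<omega> \<in> space M. ?L \<omega> > ?c + \<eta>}"
          have "\<delta> * (9344 * H + 2592 * t) / real n = \<eta> / 2" unfolding \<delta>_def by (rule cancel) (use n0 a0 in auto)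
          then have "(m + \<delta>) * (9344 * H + 2592 * t) / real n = 9344 * (m * H / real n) + 2592 * (m * t / real n) + \<eta> / 2"
            by (simp add: add_divide_distrib algebra_simps)
          moreover have "0 \<le> m * H / real n" "0 \<le> m * t / real n" using m0 H1 t by auto
          ultimately have "128 * cont_loss \<nu> f0 g + (m + \<delta>) * (9344 * H + 2592 * t) / real n \<le> ?c + \<eta>"
            using g(2) J0 by (elim lin1)
          then show "Z \<omega> \<in> ?S" using w Lc[of \<omega>] Z_space[of \<omega>] by auto
        qed auto
      qed
      then show "outer_measure_of M {\<omega> \<in> space M. \<not> ?L \<omega> \<le> ?c} \<le> ennreal (4 * exp (- t))"
        by (simp only: not_le)
      have "0 \<le> exp (- t)" by simp
      \<comment> \<open>The first term of the series is already at least \<open>exp (- t)\<close>,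
        so four times the series covers the whole failure probability.\<close>
      then show "4 * exp (- t) \<le> 1 - (1 - 4 * (\<Sum>j::nat. exp (- (2 ^ j * t / 73728))) - 6 * exp (- t))"
        using tail_sum[OF t, of t] t by linarith
    qed
    have "outer_expectation M (\<lambda>\<omega>. cont_loss \<nu> (fhat (restr n X \<omega>) (restr n Y \<omega>)) f0)
        \<le> (\<integral>\<^sup>+z. ennreal (Lc z) \<partial>\<Z>)"
      by (rule expect_le[OF Lc_meas Lc])
    also have "\<dots> \<le> ennreal (144 * J + 45000000 * (m * H / real n))"
    proof (rule ennreal_le_epsilon)
      fix \<eta> :: real assume \<eta>: "\<eta> > 0"
      define \<delta> where "\<delta> = \<eta> / 2 * real n / (14304 * H)"
      have \<delta>: "\<delta> > 0" using \<eta> n0 H1 by (simp add: \<delta>_def)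
      obtain g where g: "g \<in> P" "cont_loss \<nu> f0 g < J + \<eta> / 128"
        unfolding J_def by (rule near_INF[OF R1.P_nonempty, of "\<eta> / 128"]) (use \<eta> in auto)
      interpret R: regression \<nu> \<rho> n P f0 \<kappa> D "sqrt (\<sigma>\<^sup>2 + \<delta>)" F by (rule reg[OF \<delta>])
      have LR: "R.Lc = Lc" by (simp add: fun_eq_iff Lc_def R1.Lc_def R.Lc_def)
      have HR: "R.H = H" by (simp add: H_def R.H_def)
      have "(\<integral>\<^sup>+z. ennreal (Lc z) \<partial>\<Z>) \<le> ennreal (64 * cont_loss \<nu> f0 g + (m + \<delta>) * (14304 * H) / real n)"
        using R.cont_loss_expectation[OF G0[OF \<delta>] bd'[OF \<delta>] g(1) md[OF \<delta>]] unfolding LR HR \<Z>_def .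
      also have "\<dots> \<le> ennreal (144 * J + 45000000 * (m * H / real n) + \<eta>)"
      proof (rule ennreal_leI)
        have "\<delta> * (14304 * H) / real n = \<eta> / 2" unfolding \<delta>_def by (rule cancel) (use n0 H1 in auto)
        then have "(m + \<delta>) * (14304 * H) / real n = 14304 * (m * H / real n) + \<eta> / 2"
          by (simp add: add_divide_distrib algebra_simps)
        moreover have "0 \<le> m * H / real n" using m0 H1 by auto
        ultimately show "64 * cont_loss \<nu> f0 g + (m + \<delta>) * (14304 * H) / real n \<le> 144 * J + 45000000 * (m * H / real n) + \<eta>"
          using g(2) J0 by (elim lin2)
      qed
      also have "\<dots> = ennreal (144 * J + 45000000 * (m * H / real n)) + ennreal \<eta>"
        using J0 m0 H1 \<eta> by (intro ennreal_plus) auto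
      finally show "(\<integral>\<^sup>+z. ennreal (Lc z) \<partial>\<Z>) \<le> ennreal (144 * J + 45000000 * (m * H / real n)) + ennreal \<eta>" .
    qed
    finally show ?thesis using prob unfolding m_def by blast
  qed

  \<comment> \<open>Discrete norm on the original probability space\<close>
  have disc: "holds_with_prob_at_least M
           (\<lambda>\<omega>. disc_loss n (restr n X \<omega>) (fhat (restr n X \<omega>) (restr n Y \<omega>)) f0
              \<le> 18 * (INF g\<in>P. disc_loss n (restr n X \<omega>) f0 g)
                + 819200 * (\<sigma>\<^sup>2 * H / real n) + 8 * (\<sigma>\<^sup>2 * t / real n))
           (max (1 - 4 * (\<Sum>j::nat. exp (- (2 ^ j * t / 73728)))) 0)" if t: "t > 0" for t
  proof (rule M.holds_with_prob_at_leastI)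
    let ?I = "\<lambda>\<omega>. (INF g\<in>P. disc_loss n (restr n X \<omega>) f0 g)"
    let ?c = "\<lambda>\<omega>. 18 * ?I \<omega> + 819200 * (\<sigma>\<^sup>2 * H / real n) + 8 * (\<sigma>\<^sup>2 * t / real n)"
    let ?L = "\<lambda>\<omega>. disc_loss n (restr n X \<omega>) (fhat (restr n X \<omega>) (restr n Y \<omega>)) f0"
    have "outer_measure_of M {\<omega> \<in> space M. ?L \<omega> > ?c \<omega>} \<le> ennreal (exp (- (t / 8)))"
    proof (rule outer_measure_of_gt_le)
      fix \<eta> :: real assume \<eta>: "\<eta> > 0"
      define \<delta> where "\<delta> = \<eta> * real n / (256 * H + 8 * t)"
      have a0: "256 * H + 8 * t > 0" using H1 t by simp
      have \<delta>: "\<delta> > 0" using \<eta> n0 a0 by (simp add: \<delta>_def)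
      interpret R: regression \<nu> \<rho> n P f0 \<kappa> D "sqrt (\<sigma>\<^sup>2 + \<delta>)" F by (rule reg[OF \<delta>])
      have LR: "R.Ld = Ld" by (simp add: fun_eq_iff Ld_def R1.Ld_def R.Ld_def)
      have HR: "R.H = H" by (simp add: H_def R.H_def)
      \<comment> \<open>The conditional tail has coefficient 64 on its parameter and the claim
        allows 8, so it is used at \<open>t / 8\<close>; the resulting
        \<open>exp (- (t / 8))\<close> is still below the first term of the series.\<close>
      have t8: "t / 8 > 0" using t by simp
      have s2: "(sqrt (\<sigma>\<^sup>2 + \<delta>))\<^sup>2 = \<sigma>\<^sup>2 + \<delta>" using \<delta> by simp
      let ?S = "{z \<in> space \<Z>. Ld z > 2 * (INF g\<in>P. disc_loss n (fst z) f0 g)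
          + (256 * (\<sigma>\<^sup>2 + \<delta>) * H + 64 * (\<sigma>\<^sup>2 + \<delta>) * (t / 8)) / real n}"
      have Sq: "outer_measure_of \<Z> ?S \<le> ennreal (exp (- (t / 8)))"
        using R.disc_loss_bound_INF[OF t8] unfolding LR HR s2 \<Z>_def .
      show "outer_measure_of M {\<omega> \<in> space M. ?L \<omega> > ?c \<omega> + \<eta>} \<le> ennreal (exp (- (t / 8)))"
      proof (rule outer_le[OF _ _ Sq])
        fix \<omega> assume w: "\<omega> \<in> {\<omega> \<in> space M. ?L \<omega> > ?c \<omega> + \<eta>}"
        have "\<delta> * (256 * H + 8 * t) / real n = \<eta>" unfolding \<delta>_def by (rule cancel) (use n0 a0 in auto)
        then have "(256 * (\<sigma>\<^sup>2 + \<delta>) * H + 64 * (\<sigma>\<^sup>2 + \<delta>) * (t / 8)) / real n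
            = 256 * (\<sigma>\<^sup>2 * H / real n) + 8 * (\<sigma>\<^sup>2 * t / real n) + \<eta>"
          by (simp add: add_divide_distrib algebra_simps)
        moreover have "0 \<le> \<sigma>\<^sup>2 * H / real n" using H1 by auto
        moreover have "0 \<le> ?I \<omega>"
          by (rule cINF_greatest[OF R1.P_nonempty]) (rule R1.disc_loss_nonneg)
        ultimately have "2 * ?I \<omega> + (256 * (\<sigma>\<^sup>2 + \<delta>) * H + 64 * (\<sigma>\<^sup>2 + \<delta>) * (t / 8)) / real n \<le> ?c \<omega> + \<eta>"
          by (elim lin3)
        moreover have "fst (Z \<omega>) = restr n X \<omega>" by (simp add: Z_def)
        ultimately show "Z \<omega> \<in> ?S" using w Ld[of \<omega>] Z_space[of \<omega>] by auto
      qed auto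
    qed
    then show "outer_measure_of M {\<omega> \<in> space M. \<not> ?L \<omega> \<le> ?c \<omega>} \<le> ennreal (exp (- (t / 8)))"
      by (simp only: not_le)
    have "0 \<le> exp (- (t / 8))" by simp
    then show "exp (- (t / 8)) \<le> 1 - (1 - 4 * (\<Sum>j::nat. exp (- (2 ^ j * t / 73728))))"
      using tail_sum[OF t, of "t / 8"] t by linarith
  qed
  have "outer_expectation M (\<lambda>\<omega>. disc_loss n (restr n X \<omega>) (fhat (restr n X \<omega>) (restr n Y \<omega>)) f0)
      \<le> (\<integral>\<^sup>+z. ennreal (Ld z) \<partial>\<Z>)"
    by (rule expect_le[OF Ld_meas Ld])
  also have "\<dots> \<le> ennreal (18 * J + 5620000 * (\<sigma>\<^sup>2 * H / real n))"
  proof (rule ennreal_le_epsilon)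
    fix \<eta> :: real assume \<eta>: "\<eta> > 0"
    define \<delta> where "\<delta> = \<eta> / 2 * real n / (256 * H + 128)"
    have a0: "256 * H + 128 > 0" using H1 by simp
    have \<delta>: "\<delta> > 0" using \<eta> n0 a0 by (simp add: \<delta>_def)
    obtain g where g: "g \<in> P" "cont_loss \<nu> f0 g < J + \<eta> / 4"
      unfolding J_def by (rule near_INF[OF R1.P_nonempty, of "\<eta> / 4"]) (use \<eta> in auto)
    interpret R: regression \<nu> \<rho> n P f0 \<kappa> D "sqrt (\<sigma>\<^sup>2 + \<delta>)" F by (rule reg[OF \<delta>])
    have LR: "R.Ld = Ld" by (simp add: fun_eq_iff Ld_def R1.Ld_def R.Ld_def)
    have HR: "R.H = H" by (simp add: H_def R.H_def)
    have s2: "(sqrt (\<sigma>\<^sup>2 + \<delta>))\<^sup>2 = \<sigma>\<^sup>2 + \<delta>" using \<delta> by simp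
    have "(\<integral>\<^sup>+z. ennreal (Ld z) \<partial>\<Z>)
        \<le> ennreal (2 * cont_loss \<nu> f0 g + (256 * (\<sigma>\<^sup>2 + \<delta>) * H + 128 * (\<sigma>\<^sup>2 + \<delta>)) / real n)"
      using R.disc_loss_expectation[OF g(1)] unfolding LR HR s2 \<Z>_def .
    also have "\<dots> \<le> ennreal (18 * J + 5620000 * (\<sigma>\<^sup>2 * H / real n) + \<eta>)"
    proof (rule ennreal_leI)
      have "\<delta> * (256 * H + 128) / real n = \<eta> / 2" unfolding \<delta>_def by (rule cancel) (use n0 a0 in auto)
      then have "(256 * (\<sigma>\<^sup>2 + \<delta>) * H + 128 * (\<sigma>\<^sup>2 + \<delta>)) / real n
          = 256 * (\<sigma>\<^sup>2 * H / real n) + 128 * (\<sigma>\<^sup>2 * 1 / real n) + \<eta> / 2"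
        by (simp add: add_divide_distrib algebra_simps)
      moreover have "\<sigma>\<^sup>2 * 1 / real n \<le> \<sigma>\<^sup>2 * H / real n"
        using H1 by (intro divide_right_mono mult_left_mono) auto
      moreover have "0 \<le> \<sigma>\<^sup>2 * H / real n" using H1 by auto
      ultimately show "2 * cont_loss \<nu> f0 g + (256 * (\<sigma>\<^sup>2 + \<delta>) * H + 128 * (\<sigma>\<^sup>2 + \<delta>)) / real n
          \<le> 18 * J + 5620000 * (\<sigma>\<^sup>2 * H / real n) + \<eta>"
        using g(2) J0 by (elim lin4)
    qed
    also have "\<dots> = ennreal (18 * J + 5620000 * (\<sigma>\<^sup>2 * H / real n)) + ennreal \<eta>"
      using J0 H1 \<eta> by (intro ennreal_plus) auto
    finally show "(\<integral>\<^sup>+z. ennreal (Ld z) \<partial>\<Z>) \<le> ennreal (18 * J + 5620000 * (\<sigma>\<^sup>2 * H / real n)) + ennreal \<eta>" .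
  qed
  finally show ?thesis
    unfolding norm_H J_def[symmetric] using cont disc by blast
qed

end
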